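(* Let $S$ be a source theory in the language $\mathcal L_S$ and $T$ a target theory in the language $\mathcal L_T$, and let a $T$-sound base interpretation of $S$ be given, with associated uniform interpretation $A\mapsto\langle A\rangle^{\boldsymbol a}_{\boldsymbol b}$. If $\Gamma(\boldsymbol x)\vdash_S A(\boldsymbol x)$ (where $\Gamma$ is a finite list of formulas and $\boldsymbol x$ are variables of types $\boldsymbol\sigma$), then there are tuples of closed witnessing terms $\boldsymbol s,\boldsymbol t$ such that $T$ proves: for all $\boldsymbol a$, $\boldsymbol d$ and all $\boldsymbol x^{\boldsymbol\sigma}$, $$\text{if } \forall \boldsymbol b\in \boldsymbol s\boldsymbol a\boldsymbol d\ \langle \Gamma(\boldsymbol x)\rangle^{\boldsymbol a}_{\boldsymbol b},\ \text{ then }\ \langle A(\boldsymbol x)\rangle^{\boldsymbol t\boldsymbol a}_{\boldsymbol d}.$$ In particular, every theorem of $S$ is $\mathcal U$-interpretable in $T$.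
   Context: Source. The finite-type language $\mathcal L_S$ has ground types and the types generated from them by $\sigma\to\tau$; a constant $e_X$ for each ground type $X$; combinators $\Pi,\Sigma$; possibly other constants; a logical equality symbol $\equiv_\sigma$ for each type $\sigma$; possibly other relation symbols. Formulas are built from atomic formulas and $\bot$ with $\wedge,\to,\forall x^\sigma,\exists x^\sigma$ (there is no disjunction). $S$ is a theory in intuitionistic logic (sequent calculus with cut) with axioms $\forall x(x\equiv_\sigma x)$; $\forall x,y(A\wedge x\equiv_\sigma y\to A')$ ($A$ quantifier-free, $A'$ obtained from $A$ by replacing one or more $x$ by $y$); $\Pi xy\equiv x$; $\Sigma xyz\equiv xz(yz)$; and further non-logical axioms. $\vdash_S$ is derivability in $S$. Target. The types and terms of $\mathcal L_T$ include those of $\mathcal L_S$. $\mathcal L_T$ also has ground witnessing types (new, or coinciding with ground types of $\mathcal L_S$); the witnessing types are generated from these by $\rho\to\tau$ and $\rho^*$ (the type of non-empty finite subsets of $\rho$). Terms of witnessing type are called witnessing terms; they include a constant $e_W$ for each ground witnessing type $W$, combinators for all witnessing types, and constants for singleton $\{q\}$ ($\sigma\to\sigma^*$), binary union $\cup$ ($\sigma^*\to\sigma^*\to\sigma^*$) and indexed union $\bigcup_{w\in t}qw$ ($\sigma^*\to(\sigma\to\tau^* )\to\tau^*$). There are membership relations $\in$ between $\sigma$ and $\sigma^*$. $T$ (intuitionistic or classical) treats equality as usual mathematical equality, satisfies the combinator equations and proves the usual set-theoretic properties of $\{\cdot\},\cup,\bigcup,\in$. Tuples. Boldface letters are (possibly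 empty) tuples; $\forall\boldsymbol b\in\boldsymbol B$ means $\forall b_1\in B_1\cdots\forall b_n\in B_n$; application of tuples is componentwise. Base interpretation. To each relation symbol $R(x_1,\dots,x_r)$ of the source language are assigned two (possibly empty) tuples of witnessing types $\boldsymbol\tau_R^+,\boldsymbol\tau_R^-$ and a relation $\langle R(x_1,\dots,x_r)\rangle^{\boldsymbol c}_{\boldsymbol d}$ expressed in $\mathcal L_T$, with $\boldsymbol c$ of types $\boldsymbol\tau^+_R$ and $\boldsymbol d$ of types $\boldsymbol\tau_R^-$. For $\equiv_\sigma$ both tuples are empty and $\langle x\equiv_\sigma y\rangle$ is $x=y$. $\mathcal U$-interpretation. It extends the base interpretation to all formulas: $\langle\bot\rangle:\equiv\bot$, and if $A,B$ have interpretations $\langle A\rangle^{\boldsymbol a}_{\boldsymbol b}$, $\langle B\rangle^{\boldsymbol c}_{\boldsymbol d}$, $$\begin{array}{lcl}\langle A\wedge B\rangle^{\boldsymbol a,\boldsymbol c}_{\boldsymbol b,\boldsymbol d}&:\equiv&\langle A\rangle^{\boldsymbol a}_{\boldsymbol b}\wedge\langle B\rangle^{\boldsymbol c}_{\boldsymbol d}\\ \langle A\to B\rangle^{\boldsymbol f,\boldsymbol g}_{\boldsymbol a,\boldsymbol d}&:\equiv&\forall\boldsymbol b\in\boldsymbol g\boldsymbol a\boldsymbol d\,\langle A\rangle^{\boldsymbol a}_{\boldsymbol b}\to\langle B\rangle^{\boldsymbol f\boldsymbol a}_{\boldsymbol d}\\ \langle\forall x^\sigma A(x)\rangle^{\boldsymbol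 a}_{\boldsymbol b}&:\equiv&\forall x^\sigma\langle A(x)\rangle^{\boldsymbol a}_{\boldsymbol b}\\ \langle\exists x^\sigma A(x)\rangle^{\boldsymbol a}_{\boldsymbol B}&:\equiv&\exists x^\sigma\forall\boldsymbol b\in\boldsymbol B\,\langle A(x)\rangle^{\boldsymbol a}_{\boldsymbol b}.\end{array}$$ A formula $A(\boldsymbol x)$ is $\mathcal U$-interpretable in $T$ if there are closed witnessing terms $\boldsymbol t$ such that $T$ proves $\forall\boldsymbol b\,\langle A(\boldsymbol x)\rangle^{\boldsymbol t}_{\boldsymbol b}$. The base interpretation is a $T$-sound interpretation of $S$ if every non-logical axiom of $S$ is $\mathcal U$-interpretable in $T$. If $\Gamma$ is $B_1,\dots,B_n$, then $\boldsymbol s=\boldsymbol s_1,\dots,\boldsymbol s_n$, $\boldsymbol a=\boldsymbol a_1,\dots,\boldsymbol a_n$, $\boldsymbol b=\boldsymbol b_1,\dots,\boldsymbol b_n$ and $\forall\boldsymbol b\in\boldsymbol s\boldsymbol a\boldsymbol d\,\langle\Gamma\rangle^{\boldsymbol a}_{\boldsymbol b}$ abbreviates $\bigwedge_{i=1}^n\forall\boldsymbol b_i\in\boldsymbol s_i\boldsymbol a\boldsymbol d\,\langle B_i\rangle^{\boldsymbol a_i}_{\boldsymbol b_i}$. *)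

theory Defs
  imports Main
begin

text \<open>Source and target are many-sorted first-order theories over a common syntax in de Bruijn
  style: the index 0 is bound by the innermost quantifier, and a context is the list of the types
  of the free variables, with the type of \<open>Var i\<close> at position \<open>i\<close>.\<close>

datatype 'g ty =
    Ground 'g
  | Arrow "'g ty" "'g ty" (infixr "\<rightharpoonup>" 65)
  | Fin "'g ty"  \<comment> \<open>the type \<open>\<rho>*\<close> of non-empty finite subsets of \<open>\<rho>\<close>\<close>

definition arrows :: "'g ty list \<Rightarrow> 'g ty \<Rightarrow> 'g ty" where
  "arrows \<sigma>s \<tau> = foldr Arrow \<sigma>s \<tau>"

inductive_set fin_types :: "'g set \<Rightarrow> 'g ty set" for G where
  "g \<in> G \<Longrightarrow> Ground g \<in> fin_types G"
| "\<sigma> \<in> fin_types G \<Longrightarrow> \<tau> \<in> fin_types G \<Longrightarrow> \<sigma> \<rightharpoonup> \<tau> \<in> fin_types G"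

inductive_set wit_types :: "'g set \<Rightarrow> 'g ty set" for G where
  "g \<in> G \<Longrightarrow> Ground g \<in> wit_types G"
| "\<sigma> \<in> wit_types G \<Longrightarrow> \<tau> \<in> wit_types G \<Longrightarrow> \<sigma> \<rightharpoonup> \<tau> \<in> wit_types G"
| "\<sigma> \<in> wit_types G \<Longrightarrow> Fin \<sigma> \<in> wit_types G"

datatype ('g, 'c) const =
    Elem 'g  \<comment> \<open>\<open>e\<^sub>X\<close>\<close>
  | PiC "'g ty" "'g ty"
  | SigmaC "'g ty" "'g ty" "'g ty"
  | Singleton "'g ty"
  | BinUnion "'g ty"
  | IndUnion "'g ty" "'g ty"
  | Other 'c "'g ty"  \<comment> \<open>other constants, annotated with their type\<close>

primrec const_type :: "('g, 'c) const \<Rightarrow> 'g ty" where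
  "const_type (Elem g) = Ground g"
| "const_type (PiC \<sigma> \<tau>) = \<sigma> \<rightharpoonup> \<tau> \<rightharpoonup> \<sigma>"
| "const_type (SigmaC \<rho> \<sigma> \<tau>) = (\<rho> \<rightharpoonup> \<sigma> \<rightharpoonup> \<tau>) \<rightharpoonup> (\<rho> \<rightharpoonup> \<sigma>) \<rightharpoonup> \<rho> \<rightharpoonup> \<tau>"
| "const_type (Singleton \<sigma>) = \<sigma> \<rightharpoonup> Fin \<sigma>"
| "const_type (BinUnion \<sigma>) = Fin \<sigma> \<rightharpoonup> Fin \<sigma> \<rightharpoonup> Fin \<sigma>"
| "const_type (IndUnion \<sigma> \<tau>) = Fin \<sigma> \<rightharpoonup> (\<sigma> \<rightharpoonup> Fin \<tau>) \<rightharpoonup> Fin \<tau>"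
| "const_type (Other c \<sigma>) = \<sigma>"

datatype ('g, 'c) tm =
    Var nat
  | Const "('g, 'c) const"
  | App "('g, 'c) tm" "('g, 'c) tm" (infixl "\<cdot>" 200)

definition apps :: "('g, 'c) tm \<Rightarrow> ('g, 'c) tm list \<Rightarrow> ('g, 'c) tm" where
  "apps t us = foldl App t us"

datatype ('g, 'c, 'r) fm =
    Bot
  | Eq "'g ty" "('g, 'c) tm" "('g, 'c) tm"
  | Rel 'r "('g, 'c) tm list"
  | Conj "('g, 'c, 'r) fm" "('g, 'c, 'r) fm"
  | Disj "('g, 'c, 'r) fm" "('g, 'c, 'r) fm"
  | Imp "('g, 'c, 'r) fm" "('g, 'c, 'r) fm"
  | All "'g ty" "('g, 'c, 'r) fm"
  | Ex "'g ty" "('g, 'c, 'r) fm"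

primrec subst_tm :: "(nat \<Rightarrow> ('g, 'c) tm) \<Rightarrow> ('g, 'c) tm \<Rightarrow> ('g, 'c) tm" where
  "subst_tm \<theta> (Var i) = \<theta> i"
| "subst_tm \<theta> (Const c) = Const c"
| "subst_tm \<theta> (t \<cdot> u) = subst_tm \<theta> t \<cdot> subst_tm \<theta> u"

definition lift_tm :: "nat \<Rightarrow> ('g, 'c) tm \<Rightarrow> ('g, 'c) tm" where
  "lift_tm n = subst_tm (\<lambda>i. Var (i + n))"

definition under :: "(nat \<Rightarrow> ('g, 'c) tm) \<Rightarrow> nat \<Rightarrow> ('g, 'c) tm" where
  "under \<theta> = case_nat (Var 0) (\<lambda>i. lift_tm 1 (\<theta> i))"

primrec subst :: "(nat \<Rightarrow> ('g, 'c) tm) \<Rightarrow> ('g, 'c, 'r) fm \<Rightarrow> ('g, 'c, 'r) fm" where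
  "subst \<theta> Bot = Bot"
| "subst \<theta> (Eq \<sigma> t u) = Eq \<sigma> (subst_tm \<theta> t) (subst_tm \<theta> u)"
| "subst \<theta> (Rel r ts) = Rel r (map (subst_tm \<theta>) ts)"
| "subst \<theta> (Conj A B) = Conj (subst \<theta> A) (subst \<theta> B)"
| "subst \<theta> (Disj A B) = Disj (subst \<theta> A) (subst \<theta> B)"
| "subst \<theta> (Imp A B) = Imp (subst \<theta> A) (subst \<theta> B)"
| "subst \<theta> (All \<sigma> A) = All \<sigma> (subst (under \<theta>) A)"
| "subst \<theta> (Ex \<sigma> A) = Ex \<sigma> (subst (under \<theta>) A)"

definition lift :: "nat \<Rightarrow> ('g, 'c, 'r) fm \<Rightarrow> ('g, 'c, 'r) fm" where
  "lift n = subst (\<lambda>i. Var (i + n))"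

definition inst :: "('g, 'c, 'r) fm \<Rightarrow> ('g, 'c) tm \<Rightarrow> ('g, 'c, 'r) fm" where
  "inst A t = subst (case_nat t Var) A"

text \<open>A theory consists of a language and of axioms, which are formulas in context.  The source
  language has no disjunction, whence the flag \<open>has_disj\<close>.\<close>

record ('g, 'c, 'r) fo_theory =
  types :: "'g ty set"
  constants :: "('g, 'c) const set"
  arity :: "'r \<Rightarrow> 'g ty list option"  \<comment> \<open>\<open>None\<close>: not a symbol of the language\<close>
  has_disj :: bool
  classical :: bool
  axioms :: "('g ty list \<times> ('g, 'c, 'r) fm) set"

inductive has_type :: "('g, 'c, 'r) fo_theory \<Rightarrow> 'g ty list \<Rightarrow> ('g, 'c) tm \<Rightarrow> 'g ty \<Rightarrow> bool"
  for T \<Delta> where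
  "i < length \<Delta> \<Longrightarrow> has_type T \<Delta> (Var i) (\<Delta> ! i)"
| "c \<in> constants T \<Longrightarrow> has_type T \<Delta> (Const c) (const_type c)"
| "has_type T \<Delta> t (\<sigma> \<rightharpoonup> \<tau>) \<Longrightarrow> has_type T \<Delta> u \<sigma> \<Longrightarrow> has_type T \<Delta> (t \<cdot> u) \<tau>"

primrec wf_fm :: "('g, 'c, 'r) fo_theory \<Rightarrow> 'g ty list \<Rightarrow> ('g, 'c, 'r) fm \<Rightarrow> bool" where
  "wf_fm T \<Delta> Bot \<longleftrightarrow> True"
| "wf_fm T \<Delta> (Eq \<sigma> t u) \<longleftrightarrow> \<sigma> \<in> types T \<and> has_type T \<Delta> t \<sigma> \<and> has_type T \<Delta> u \<sigma>"
| "wf_fm T \<Delta> (Rel r ts) \<longleftrightarrow> (\<exists>\<sigma>s. arity T r = Some \<sigma>s \<and> list_all2 (has_type T \<Delta>) ts \<sigma>s)"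
| "wf_fm T \<Delta> (Conj A B) \<longleftrightarrow> wf_fm T \<Delta> A \<and> wf_fm T \<Delta> B"
| "wf_fm T \<Delta> (Disj A B) \<longleftrightarrow> has_disj T \<and> wf_fm T \<Delta> A \<and> wf_fm T \<Delta> B"
| "wf_fm T \<Delta> (Imp A B) \<longleftrightarrow> wf_fm T \<Delta> A \<and> wf_fm T \<Delta> B"
| "wf_fm T \<Delta> (All \<sigma> A) \<longleftrightarrow> \<sigma> \<in> types T \<and> wf_fm T (\<sigma> # \<Delta>) A"
| "wf_fm T \<Delta> (Ex \<sigma> A) \<longleftrightarrow> \<sigma> \<in> types T \<and> wf_fm T (\<sigma> # \<Delta>) A"

definition wf_ctx :: "('g, 'c, 'r) fo_theory \<Rightarrow> 'g ty list \<Rightarrow> bool" where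
  "wf_ctx T \<Delta> \<longleftrightarrow> set \<Delta> \<subseteq> types T"

definition wf_seq ::
  "('g, 'c, 'r) fo_theory \<Rightarrow> 'g ty list \<Rightarrow> ('g, 'c, 'r) fm list \<Rightarrow> ('g, 'c, 'r) fm \<Rightarrow> bool" where
  "wf_seq T \<Delta> \<Gamma> A \<longleftrightarrow> wf_ctx T \<Delta> \<and> (\<forall>B \<in> set \<Gamma>. wf_fm T \<Delta> B) \<and> wf_fm T \<Delta> A"

text \<open>Sequent calculus with cut.  Rule \<open>struct\<close> covers weakening, contraction and exchange; rule
  \<open>var\<close> discards a free variable that no longer occurs, i.e. variables of every type are always at
  hand and all sorts are inhabited, as usual in first-order logic.  Rule \<open>nonlog\<close> gives all
  instances of the axioms.\<close>

inductive derives ::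
  "('g, 'c, 'r) fo_theory \<Rightarrow> 'g ty list \<Rightarrow> ('g, 'c, 'r) fm list \<Rightarrow> ('g, 'c, 'r) fm \<Rightarrow> bool"
  for T where
  ident: "wf_seq T \<Delta> \<Gamma> A \<Longrightarrow> A \<in> set \<Gamma> \<Longrightarrow> derives T \<Delta> \<Gamma> A"
| struct: "derives T \<Delta> \<Gamma> A \<Longrightarrow> set \<Gamma> \<subseteq> set \<Gamma>' \<Longrightarrow> wf_seq T \<Delta> \<Gamma>' A \<Longrightarrow> derives T \<Delta> \<Gamma>' A"
| cut: "derives T \<Delta> \<Gamma> A \<Longrightarrow> derives T \<Delta> (A # \<Gamma>) B \<Longrightarrow> derives T \<Delta> \<Gamma> B"
| var: "derives T (\<sigma> # \<Delta>) (map (lift 1) \<Gamma>) (lift 1 A) \<Longrightarrow> wf_seq T \<Delta> \<Gamma> A \<Longrightarrow> derives T \<Delta> \<Gamma> A"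
| botL: "wf_seq T \<Delta> (Bot # \<Gamma>) A \<Longrightarrow> derives T \<Delta> (Bot # \<Gamma>) A"
| conjR: "derives T \<Delta> \<Gamma> A \<Longrightarrow> derives T \<Delta> \<Gamma> B \<Longrightarrow> derives T \<Delta> \<Gamma> (Conj A B)"
| conjL: "derives T \<Delta> (A # B # \<Gamma>) C \<Longrightarrow> derives T \<Delta> (Conj A B # \<Gamma>) C"
| disjR1: "derives T \<Delta> \<Gamma> A \<Longrightarrow> wf_fm T \<Delta> (Disj A B) \<Longrightarrow> derives T \<Delta> \<Gamma> (Disj A B)"
| disjR2: "derives T \<Delta> \<Gamma> B \<Longrightarrow> wf_fm T \<Delta> (Disj A B) \<Longrightarrow> derives T \<Delta> \<Gamma> (Disj A B)"
| disjL: "derives T \<Delta> (A # \<Gamma>) C \<Longrightarrow> derives T \<Delta> (B # \<Gamma>) C \<Longrightarrow> wf_fm T \<Delta> (Disj A B) \<Longrightarrow>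
    derives T \<Delta> (Disj A B # \<Gamma>) C"
| impR: "derives T \<Delta> (A # \<Gamma>) B \<Longrightarrow> derives T \<Delta> \<Gamma> (Imp A B)"
| impL: "derives T \<Delta> \<Gamma> A \<Longrightarrow> derives T \<Delta> (B # \<Gamma>) C \<Longrightarrow> derives T \<Delta> (Imp A B # \<Gamma>) C"
| allR: "derives T (\<sigma> # \<Delta>) (map (lift 1) \<Gamma>) A \<Longrightarrow> wf_seq T \<Delta> \<Gamma> (All \<sigma> A) \<Longrightarrow>
    derives T \<Delta> \<Gamma> (All \<sigma> A)"
| allL: "derives T \<Delta> (inst A t # \<Gamma>) C \<Longrightarrow> has_type T \<Delta> t \<sigma> \<Longrightarrow> wf_fm T \<Delta> (All \<sigma> A) \<Longrightarrow>
    derives T \<Delta> (All \<sigma> A # \<Gamma>) C"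
| exR: "derives T \<Delta> \<Gamma> (inst A t) \<Longrightarrow> has_type T \<Delta> t \<sigma> \<Longrightarrow> wf_fm T \<Delta> (Ex \<sigma> A) \<Longrightarrow>
    derives T \<Delta> \<Gamma> (Ex \<sigma> A)"
| exL: "derives T (\<sigma> # \<Delta>) (A # map (lift 1) \<Gamma>) (lift 1 C) \<Longrightarrow> wf_seq T \<Delta> (Ex \<sigma> A # \<Gamma>) C \<Longrightarrow>
    derives T \<Delta> (Ex \<sigma> A # \<Gamma>) C"
| classic: "classical T \<Longrightarrow> wf_seq T \<Delta> \<Gamma> A \<Longrightarrow> derives T \<Delta> \<Gamma> (Imp (Imp (Imp A Bot) Bot) A)"
| nonlog: "(\<Delta>', A) \<in> axioms T \<Longrightarrow> \<forall>i < length \<Delta>'. has_type T \<Delta> (\<theta> i) (\<Delta>' ! i) \<Longrightarrow>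
    wf_seq T \<Delta> \<Gamma> (subst \<theta> A) \<Longrightarrow> derives T \<Delta> \<Gamma> (subst \<theta> A)"

definition proves_all ::
  "('g, 'c, 'r) fo_theory \<Rightarrow> ('g ty list \<times> ('g, 'c, 'r) fm) set \<Rightarrow> bool" where
  "proves_all T X \<longleftrightarrow> (\<forall>(\<Delta>, A) \<in> X. derives T \<Delta> [] A)"


text \<open>In \<open>\<forall>x,y (A \<and> x \<equiv> y \<rightarrow> A')\<close> the replaced occurrences of \<open>x\<close> are marked by an extra variable:
  \<open>B\<close> lives in the context \<open>z, y, x, \<Delta>\<close> (with \<open>z = Var 0\<close>), \<open>A = B[x/z]\<close> and \<open>A' = B[y/z]\<close>; both
  \<open>x\<close> and \<open>y\<close> may occur elsewhere in \<open>B\<close>.\<close>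

definition leibniz :: "'g ty \<Rightarrow> ('g, 'c, 'r) fm \<Rightarrow> ('g, 'c, 'r) fm" where
  "leibniz \<sigma> B =
    All \<sigma> (All \<sigma> (Imp (Conj (inst B (Var 1)) (Eq \<sigma> (Var 1) (Var 0))) (inst B (Var 0))))"

primrec qfree :: "('g, 'c, 'r) fm \<Rightarrow> bool" where
  "qfree Bot \<longleftrightarrow> True"
| "qfree (Eq \<sigma> t u) \<longleftrightarrow> True"
| "qfree (Rel r ts) \<longleftrightarrow> True"
| "qfree (Conj A B) \<longleftrightarrow> qfree A \<and> qfree B"
| "qfree (Disj A B) \<longleftrightarrow> qfree A \<and> qfree B"
| "qfree (Imp A B) \<longleftrightarrow> qfree A \<and> qfree B"
| "qfree (All \<sigma> A) \<longleftrightarrow> False"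
| "qfree (Ex \<sigma> A) \<longleftrightarrow> False"

definition reflexivity_axioms ::
  "('g, 'c, 'r) fo_theory \<Rightarrow> ('g ty list \<times> ('g, 'c, 'r) fm) set" where
  "reflexivity_axioms T = {([], All \<sigma> (Eq \<sigma> (Var 0) (Var 0))) | \<sigma>. \<sigma> \<in> types T}"

definition leibniz_axioms ::
  "('g, 'c, 'r) fo_theory \<Rightarrow> ('g ty list \<times> ('g, 'c, 'r) fm) set" where
  "leibniz_axioms T =
    {(\<Delta>, leibniz \<sigma> B) | \<Delta> \<sigma> B. wf_ctx T \<Delta> \<and> \<sigma> \<in> types T \<and> wf_fm T (\<sigma> # \<sigma> # \<sigma> # \<Delta>) B}"

definition qfree_leibniz_axioms ::
  "('g, 'c, 'r) fo_theory \<Rightarrow> ('g ty list \<times> ('g, 'c, 'r) fm) set" where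
  "qfree_leibniz_axioms T =
    {(\<Delta>, leibniz \<sigma> B) | \<Delta> \<sigma> B.
      wf_ctx T \<Delta> \<and> \<sigma> \<in> types T \<and> wf_fm T (\<sigma> # \<sigma> # \<sigma> # \<Delta>) B \<and> qfree B}"

definition combinator_axioms :: "'g ty set \<Rightarrow> ('g ty list \<times> ('g, 'c, 'r) fm) set" where
  "combinator_axioms U =
    {([\<sigma>, \<tau>], Eq \<sigma> (Const (PiC \<sigma> \<tau>) \<cdot> Var 0 \<cdot> Var 1) (Var 0)) | \<sigma> \<tau>. \<sigma> \<in> U \<and> \<tau> \<in> U} \<union>
    {([\<rho> \<rightharpoonup> \<sigma> \<rightharpoonup> \<tau>, \<rho> \<rightharpoonup> \<sigma>, \<rho>],
      Eq \<tau> (Const (SigmaC \<rho> \<sigma> \<tau>) \<cdot> Var 0 \<cdot> Var 1 \<cdot> Var 2) (Var 0 \<cdot> Var 2 \<cdot> (Var 1 \<cdot> Var 2)))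
      | \<rho> \<sigma> \<tau>. \<rho> \<in> U \<and> \<sigma> \<in> U \<and> \<tau> \<in> U}"

definition has_combinators :: "('g, 'c, 'r) fo_theory \<Rightarrow> 'g ty set \<Rightarrow> bool" where
  "has_combinators T U \<longleftrightarrow>
    (\<forall>\<sigma> \<in> U. \<forall>\<tau> \<in> U. PiC \<sigma> \<tau> \<in> constants T) \<and>
    (\<forall>\<rho> \<in> U. \<forall>\<sigma> \<in> U. \<forall>\<tau> \<in> U. SigmaC \<rho> \<sigma> \<tau> \<in> constants T)"

definition wf_theory :: "('g, 'c, 'r) fo_theory \<Rightarrow> bool" where
  "wf_theory T \<longleftrightarrow>
    (\<forall>\<sigma> \<tau>. \<sigma> \<rightharpoonup> \<tau> \<in> types T \<longrightarrow> \<sigma> \<in> types T \<and> \<tau> \<in> types T) \<and>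
    (\<forall>\<sigma>. Fin \<sigma> \<in> types T \<longrightarrow> \<sigma> \<in> types T) \<and>
    (\<forall>c \<in> constants T. const_type c \<in> types T) \<and>
    (\<forall>r \<sigma>s. arity T r = Some \<sigma>s \<longrightarrow> set \<sigma>s \<subseteq> types T) \<and>
    (\<forall>(\<Delta>, A) \<in> axioms T. wf_ctx T \<Delta> \<and> wf_fm T \<Delta> A)"


text \<open>Source theory with ground types \<open>G\<close> and further non-logical axioms \<open>N\<close>.  The constants of
  \<open>S\<close> have types without \<open>*\<close>, so the set operations are not among them.\<close>

definition source_theory ::
  "'g set \<Rightarrow> ('g ty list \<times> ('g, 'c, 'r) fm) set \<Rightarrow> ('g, 'c, 'r) fo_theory \<Rightarrow> bool" where
  "source_theory G N S \<longleftrightarrow>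
    wf_theory S \<and> types S = fin_types G \<and> Elem ` G \<subseteq> constants S \<and>
    has_combinators S (types S) \<and> \<not> has_disj S \<and> \<not> classical S \<and>
    axioms S =
      reflexivity_axioms S \<union> qfree_leibniz_axioms S \<union> combinator_axioms (types S) \<union> N"

datatype ('g, 'q) trel = Mem "'g ty" | TRel 'q  \<comment> \<open>relation symbols of the target language\<close>

abbreviation Member ::
  "'g ty \<Rightarrow> ('g, 'c) tm \<Rightarrow> ('g, 'c) tm \<Rightarrow> ('g, 'c, ('g, 'q) trel) fm" where
  "Member \<sigma> t u \<equiv> Rel (Mem \<sigma>) [t, u]"

definition Iff :: "('g, 'c, 'r) fm \<Rightarrow> ('g, 'c, 'r) fm \<Rightarrow> ('g, 'c, 'r) fm" where
  "Iff A B = Conj (Imp A B) (Imp B A)"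

text \<open>The usual properties of the set operations are their membership conditions; no more
  (such as extensionality or non-emptiness) is demanded of the target theory.\<close>

definition set_properties ::
  "'g ty set \<Rightarrow> ('g ty list \<times> ('g, 'c, ('g, 'q) trel) fm) set" where
  "set_properties U =
    {([\<sigma>, \<sigma>],
      Iff (Member \<sigma> (Var 0) (Const (Singleton \<sigma>) \<cdot> Var 1)) (Eq \<sigma> (Var 0) (Var 1))) | \<sigma>. \<sigma> \<in> U} \<union>
    {([\<sigma>, Fin \<sigma>, Fin \<sigma>],
      Iff (Member \<sigma> (Var 0) (Const (BinUnion \<sigma>) \<cdot> Var 1 \<cdot> Var 2))
          (Disj (Member \<sigma> (Var 0) (Var 1)) (Member \<sigma> (Var 0) (Var 2)))) | \<sigma>. \<sigma> \<in> U} \<union>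
    {([\<tau>, Fin \<sigma>, \<sigma> \<rightharpoonup> Fin \<tau>],
      Iff (Member \<tau> (Var 0) (Const (IndUnion \<sigma> \<tau>) \<cdot> Var 1 \<cdot> Var 2))
          (Ex \<sigma> (Conj (Member \<sigma> (Var 0) (Var 2)) (Member \<tau> (Var 1) (Var 3 \<cdot> Var 0)))))
      | \<sigma> \<tau>. \<sigma> \<in> U \<and> \<tau> \<in> U}"

text \<open>Target theory for \<open>S\<close> with ground witnessing types \<open>W\<close>, which may overlap with the ground
  types of \<open>S\<close>.  It may have further types, constants, relation symbols and axioms, and may be
  intuitionistic or classical.\<close>

definition target_theory ::
  "('g, 'c, 'r) fo_theory \<Rightarrow> 'g set \<Rightarrow> ('g, 'c, ('g, 'q) trel) fo_theory \<Rightarrow> bool" where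
  "target_theory S W T \<longleftrightarrow>
    wf_theory T \<and> has_disj T \<and> types S \<subseteq> types T \<and> constants S \<subseteq> constants T \<and>
    wit_types W \<subseteq> types T \<and> Elem ` W \<subseteq> constants T \<and> has_combinators T (wit_types W) \<and>
    (\<forall>\<sigma> \<in> wit_types W. Singleton \<sigma> \<in> constants T \<and> BinUnion \<sigma> \<in> constants T \<and>
      arity T (Mem \<sigma>) = Some [\<sigma>, Fin \<sigma>]) \<and>
    (\<forall>\<sigma> \<in> wit_types W. \<forall>\<tau> \<in> wit_types W. IndUnion \<sigma> \<tau> \<in> constants T) \<and>
    proves_all T (reflexivity_axioms T) \<and> proves_all T (leibniz_axioms T) \<and>
    proves_all T (combinator_axioms (types S)) \<and>
    proves_all T (combinator_axioms (wit_types W)) \<and>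
    proves_all T (set_properties (wit_types W))"


text \<open>\<open>base r\<close> is the formula \<open>\<langle>r(x)\<rangle>\<close> with superscript \<open>c\<close> and subscript \<open>d\<close>, whose variables
  \<open>Var 0, Var 1, \<dots>\<close> are those of \<open>x\<close>, \<open>c\<close>, \<open>d\<close>, in this order.\<close>

record ('g, 'c, 'r, 'q) base_interp =
  base_pos :: "'r \<Rightarrow> 'g ty list"
  base_neg :: "'r \<Rightarrow> 'g ty list"
  base :: "'r \<Rightarrow> ('g, 'c, ('g, 'q) trel) fm"

definition wf_base_interp ::
  "('g, 'c, 'r) fo_theory \<Rightarrow> 'g set \<Rightarrow> ('g, 'c, ('g, 'q) trel) fo_theory \<Rightarrow>
    ('g, 'c, 'r, 'q) base_interp \<Rightarrow> bool" where
  "wf_base_interp S W T I \<longleftrightarrow>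
    (\<forall>r \<sigma>s. arity S r = Some \<sigma>s \<longrightarrow>
      set (base_pos I r) \<subseteq> wit_types W \<and> set (base_neg I r) \<subseteq> wit_types W \<and>
      wf_fm T (\<sigma>s @ base_pos I r @ base_neg I r) (base I r))"

text \<open>Types of the tuples \<open>a\<close> and \<open>b\<close> in \<open>\<langle>A\<rangle>\<close> with superscript \<open>a\<close> and subscript \<open>b\<close>.  As source
  formulas have no disjunction, the values at \<open>Disj\<close> here and in \<open>interp\<close> are irrelevant.\<close>

fun pos :: "('g, 'c, 'r, 'q) base_interp \<Rightarrow> ('g, 'c, 'r) fm \<Rightarrow> 'g ty list"
  and neg :: "('g, 'c, 'r, 'q) base_interp \<Rightarrow> ('g, 'c, 'r) fm \<Rightarrow> 'g ty list"
  where
  "pos I Bot = []"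
| "pos I (Eq \<sigma> t u) = []"
| "pos I (Rel r ts) = base_pos I r"
| "pos I (Conj A B) = pos I A @ pos I B"
| "pos I (Disj A B) = []"
| "pos I (Imp A B) =
    map (arrows (pos I A)) (pos I B) @ map (\<lambda>\<beta>. arrows (pos I A @ neg I B) (Fin \<beta>)) (neg I A)"
| "pos I (All \<sigma> A) = pos I A"
| "pos I (Ex \<sigma> A) = pos I A"
| "neg I Bot = []"
| "neg I (Eq \<sigma> t u) = []"
| "neg I (Rel r ts) = base_neg I r"
| "neg I (Conj A B) = neg I A @ neg I B"
| "neg I (Disj A B) = []"
| "neg I (Imp A B) = pos I A @ neg I B"
| "neg I (All \<sigma> A) = neg I A"
| "neg I (Ex \<sigma> A) = map Fin (neg I A)"

text \<open>\<open>Alls [\<sigma>\<^sub>1, \<dots>, \<sigma>\<^sub>n]\<close> binds a tuple, outermost quantifier first; \<open>tuple_vars k n\<close> is that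
  tuple seen from below \<open>k\<close> further quantifiers.\<close>

definition Alls :: "'g ty list \<Rightarrow> ('g, 'c, 'r) fm \<Rightarrow> ('g, 'c, 'r) fm" where
  "Alls \<sigma>s A = foldr All \<sigma>s A"

definition tuple_vars :: "nat \<Rightarrow> nat \<Rightarrow> ('g, 'c) tm list" where
  "tuple_vars k n = map Var (rev [k..<k + n])"

text \<open>\<open>\<forall>b\<^sub>1 \<in> B\<^sub>1 \<dots> \<forall>b\<^sub>n \<in> B\<^sub>n. A\<close>, where the \<open>B\<^sub>i\<close> are terms in the outer context and \<open>A\<close> is
  in the context extended by all of \<open>b\<^sub>1, \<dots>, b\<^sub>n\<close>\<close>

fun bounded_Alls ::
  "'g ty list \<Rightarrow> ('g, 'c) tm list \<Rightarrow> ('g, 'c, ('g, 'q) trel) fm \<Rightarrow> ('g, 'c, ('g, 'q) trel) fm"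
  where
  "bounded_Alls (\<sigma> # \<sigma>s) (B # Bs) A =
    All \<sigma> (Imp (Member \<sigma> (Var 0) (lift_tm 1 B)) (bounded_Alls \<sigma>s (map (lift_tm 1) Bs) A))"
| "bounded_Alls _ _ A = A"

primrec depth :: "('g, 'c, 'r) fm \<Rightarrow> nat" where
  "depth Bot = 0"
| "depth (Eq \<sigma> t u) = 0"
| "depth (Rel r ts) = 0"
| "depth (Conj A B) = Suc (max (depth A) (depth B))"
| "depth (Disj A B) = Suc (max (depth A) (depth B))"
| "depth (Imp A B) = Suc (max (depth A) (depth B))"
| "depth (All \<sigma> A) = Suc (depth A)"
| "depth (Ex \<sigma> A) = Suc (depth A)"

lemma depth_subst [simp]: "depth (subst \<theta> A) = depth A"
  by (induction A arbitrary: \<theta>) auto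

lemma depth_lift [simp]: "depth (lift n A) = depth A"
  by (simp add: lift_def)

text \<open>The uniform interpretation: \<open>interp I A as bs\<close> is \<open>\<langle>A\<rangle>\<close> with superscript \<open>as\<close> and subscript
  \<open>bs\<close>, all in the same context.\<close>

function interp ::
  "('g, 'c, 'r, 'q) base_interp \<Rightarrow> ('g, 'c, 'r) fm \<Rightarrow> ('g, 'c) tm list \<Rightarrow> ('g, 'c) tm list \<Rightarrow>
    ('g, 'c, ('g, 'q) trel) fm" where
  "interp I Bot as bs = Bot"
| "interp I (Eq \<sigma> t u) as bs = Eq \<sigma> t u"
| "interp I (Rel r ts) as bs = subst (\<lambda>i. (ts @ as @ bs) ! i) (base I r)"
| "interp I (Conj A B) ac bd =
    (let a = take (length (pos I A)) ac; c = drop (length (pos I A)) ac;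
         b = take (length (neg I A)) bd; d = drop (length (neg I A)) bd
     in Conj (interp I A a b) (interp I B c d))"
| "interp I (Disj A B) as bs = Bot"
| "interp I (Imp A B) fg ad =
    (let f = take (length (pos I B)) fg; g = drop (length (pos I B)) fg;
         a = take (length (pos I A)) ad; d = drop (length (pos I A)) ad;
         n = length (neg I A)
     in Imp (bounded_Alls (neg I A) (map (\<lambda>h. apps h (a @ d)) g)
               (interp I (lift n A) (map (lift_tm n) a) (tuple_vars 0 n)))
            (interp I B (map (\<lambda>h. apps h a) f) d))"
| "interp I (All \<sigma> A) as bs = All \<sigma> (interp I A (map (lift_tm 1) as) (map (lift_tm 1) bs))"
| "interp I (Ex \<sigma> A) as Bs =
    (let n = length (neg I A)
     in Ex \<sigma> (bounded_Alls (neg I A) (map (lift_tm 1) Bs)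
               (interp I (lift n A) (map (lift_tm (n + 1)) as) (tuple_vars 0 n))))"
  by pat_completeness auto
termination
  by (relation "measure (\<lambda>(I, A, as, bs). depth A)") auto

text \<open>Terms of the target language are closed iff they are typable in the empty context.\<close>

definition closed_witnesses ::
  "'g set \<Rightarrow> ('g, 'c, ('g, 'q) trel) fo_theory \<Rightarrow> ('g, 'c) tm list \<Rightarrow> 'g ty list \<Rightarrow> bool" where
  "closed_witnesses W T ts \<sigma>s \<longleftrightarrow> set \<sigma>s \<subseteq> wit_types W \<and> list_all2 (has_type T []) ts \<sigma>s"

text \<open>The terms \<open>ts\<close> are closed and hence need no lifting below the quantifiers.\<close>

definition interpretable ::
  "'g set \<Rightarrow> ('g, 'c, ('g, 'q) trel) fo_theory \<Rightarrow> ('g, 'c, 'r, 'q) base_interp \<Rightarrow>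
    'g ty list \<Rightarrow> ('g, 'c, 'r) fm \<Rightarrow> bool" where
  "interpretable W T I \<Delta> A \<longleftrightarrow>
    (\<exists>ts. closed_witnesses W T ts (pos I A) \<and>
      derives T \<Delta> []
        (Alls (neg I A)
          (interp I (lift (length (neg I A)) A) ts (tuple_vars 0 (length (neg I A))))))"

definition sound_interp ::
  "('g ty list \<times> ('g, 'c, 'r) fm) set \<Rightarrow> 'g set \<Rightarrow> ('g, 'c, ('g, 'q) trel) fo_theory \<Rightarrow>
    ('g, 'c, 'r, 'q) base_interp \<Rightarrow> bool" where
  "sound_interp N W T I \<longleftrightarrow> (\<forall>(\<Delta>, A) \<in> N. interpretable W T I \<Delta> A)"

text \<open>\<open>\<And>\<^sub>i \<forall>b\<^sub>i \<in> s\<^sub>i a d. \<langle>B\<^sub>i\<rangle>\<close> with superscript \<open>a\<^sub>i\<close> and subscript \<open>b\<^sub>i\<close>, where \<open>\<Gamma> = B\<^sub>1, \<dots>, B\<^sub>n\<close>;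
  the tuple \<open>as\<close> is the concatenation of the \<open>a\<^sub>i\<close>, and \<open>args\<close> is \<open>a, d\<close>\<close>

fun interp_hyps ::
  "('g, 'c, 'r, 'q) base_interp \<Rightarrow> ('g, 'c, 'r) fm list \<Rightarrow> ('g, 'c) tm list list \<Rightarrow>
    ('g, 'c) tm list \<Rightarrow> ('g, 'c) tm list \<Rightarrow> ('g, 'c, ('g, 'q) trel) fm" where
  "interp_hyps I (B # \<Gamma>) (s # ss) as args =
    (let n = length (neg I B)
     in Conj (bounded_Alls (neg I B) (map (\<lambda>h. apps h args) s)
               (interp I (lift n B) (map (lift_tm n) (take (length (pos I B)) as))
                 (tuple_vars 0 n)))
             (interp_hyps I \<Gamma> ss (drop (length (pos I B)) as) args))"
| "interp_hyps I _ _ as args = Imp Bot Bot"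

end

theory Submission
  imports Defs
begin

text \<open>The target theory is studied through its own derivability relation, read as a Kripke model: a
  world is a context with hypotheses, and worlds are extended by appending variables at the end of
  the context, so that terms and formulas persist without lifting.  In this model \<open>\<langle>A\<rangle>\<close> unfolds to
  its meaning, and every rule of the source calculus becomes a construction on witnesses:
  hypotheses used in several premises are joined by binary unions, cuts and implications on the
  left by indexed unions.  The witnesses are carried along as functions definable by open terms,
  and bracket abstraction closes them at the end.  The axioms other than the given ones have trivial
  witnesses, replacement of equals in \<open>\<langle>A\<rangle>\<close> being available in the target theory.\<close>

section \<open>Substitution\<close>

text \<open>Two features of the interpretation shape the argument. Witnesses may not depend on the
  values of the source variables, so they have to be fixed before the environment that gives these
  variables their values. And \<open>\<forall>b \<in> B. \<langle>A\<rangle>\<close> becomes weaker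
  as \<open>B\<close> shrinks, so several demands on one hypothesis are reconciled by a larger
  bound, without deciding which of them would fail. Derivability is not a Kripke model in the full
  sense: a forced existential formula need not have a witness in its world and can be eliminated
  only towards another formula of \<open>T\<close>. This suffices, because the goal at that point is
  always an interpreted formula. Disjunction has to be introduced only, namely to enter a binary
  union. Bracket abstraction obeys its equations only up to provable equality; hence witnesses and
  bounds are compared by forced equality and forced inclusion. As equality in an argument of an
  arbitrary \<open>\<langle>A\<rangle>\<close> must be usable, Leibniz' rule of \<open>T\<close> is
  applied to formulas with quantifiers.\<close>

lemma subst_tm_comp: "subst_tm \<theta> (subst_tm \<eta> t) = subst_tm (\<lambda>i. subst_tm \<theta> (\<eta> i)) t"
  by (induction t) auto

lemma subst_tm_Var [simp]: "subst_tm Var t = t"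
  by (induction t) auto

lemma under_comp: "(\<lambda>i. subst_tm (under \<theta>) (under \<eta> i)) = under (\<lambda>i. subst_tm \<theta> (\<eta> i))"
  by (auto simp: under_def lift_tm_def subst_tm_comp fun_eq_iff split: nat.split)

lemma subst_comp: "subst \<theta> (subst \<eta> A) = subst (\<lambda>i. subst_tm \<theta> (\<eta> i)) A"
  by (induction A arbitrary: \<theta> \<eta>) (auto simp: subst_tm_comp under_comp)

lemma under_Var [simp]: "under Var = Var"
  by (auto simp: under_def lift_tm_def fun_eq_iff split: nat.split)

lemma subst_Var [simp]: "subst Var A = A"
  by (induction A) (auto simp: map_idI)

lemma lift_tm_0 [simp]: "lift_tm 0 t = t"
  by (simp add: lift_tm_def)

lemma lift_tm_comp: "lift_tm m (lift_tm n t) = lift_tm (n + m) t"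
  by (simp add: lift_tm_def subst_tm_comp add.assoc)

lemma subst_tm_under_lift [simp]: "subst_tm (under \<theta>) (lift_tm (Suc 0) t) = lift_tm (Suc 0) (subst_tm \<theta> t)"
  by (simp add: lift_tm_def subst_tm_comp) (simp add: under_def lift_tm_def)

lemma subst_under_lift [simp]: "subst (under \<theta>) (lift (Suc 0) A) = lift (Suc 0) (subst \<theta> A)"
  by (simp add: lift_def subst_comp) (simp add: under_def lift_tm_def)

lemma subst_inst: "subst \<theta> (inst A t) = inst (subst (under \<theta>) A) (subst_tm \<theta> t)"
  unfolding inst_def subst_comp
  by (rule arg_cong[of _ _ "\<lambda>\<theta>. subst \<theta> A"])
    (auto simp: fun_eq_iff under_def lift_tm_def subst_tm_comp split: nat.split)

text \<open>Instantiating a quantified formula under the environment \<open>\<theta>\<close> amounts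
  to evaluating its body in the environment extended by \<open>t\<close>; the eigenvariable rules
  use their premises in this form.\<close>

lemma inst_under: "inst (subst (under \<theta>) A) t = subst (case_nat t \<theta>) A"
  unfolding inst_def subst_comp
  by (rule arg_cong[of _ _ "\<lambda>\<theta>. subst \<theta> A"])
    (auto simp: fun_eq_iff under_def lift_tm_def subst_tm_comp split: nat.split)

lemma subst_case_nat_lift [simp]: "subst (case_nat t \<theta>) (lift (Suc 0) A) = subst \<theta> A"
  by (simp add: lift_def subst_comp)

section \<open>Typed substitutions and the substitution lemma for derivations\<close>

text \<open>A typed environment giving values in \<open>\<Delta>'\<close> to the variables of
  \<open>\<Delta>\<close>. Values beyond \<open>length \<Delta>\<close> are unconstrained;
  \<open>subst_tm_cong\<close> and \<open>subst_cong\<close> make sure that they do not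
  matter.\<close>

definition sub_type ::
  "('g, 'c, 'r) fo_theory \<Rightarrow> 'g ty list \<Rightarrow> (nat \<Rightarrow> ('g, 'c) tm) \<Rightarrow> 'g ty list \<Rightarrow> bool" where
  "sub_type T \<Delta> \<theta> \<Delta>' \<longleftrightarrow> (\<forall>i < length \<Delta>. has_type T \<Delta>' (\<theta> i) (\<Delta> ! i))"

lemma has_type_cong:
  assumes "constants T = constants T'"
  shows "has_type T \<Delta> t \<sigma> \<longleftrightarrow> has_type T' \<Delta> t \<sigma>"
proof
  show "has_type T' \<Delta> t \<sigma>" if "has_type T \<Delta> t \<sigma>"
    using that by induction (auto simp: assms intro: has_type.intros)
  show "has_type T \<Delta> t \<sigma>" if "has_type T' \<Delta> t \<sigma>"
    using that by induction (auto simp: assms intro: has_type.intros)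
qed

lemma has_type_mono: "has_type T \<Delta> t \<sigma> \<Longrightarrow> constants T \<subseteq> constants T' \<Longrightarrow> has_type T' \<Delta> t \<sigma>"
  by (induction rule: has_type.induct) (auto intro: has_type.intros)

lemma has_type_subst:
  "has_type T \<Delta> t \<sigma> \<Longrightarrow> sub_type T \<Delta> \<theta> \<Delta>' \<Longrightarrow> has_type T \<Delta>' (subst_tm \<theta> t) \<sigma>"
  by (induction rule: has_type.induct) (auto simp: sub_type_def intro: has_type.intros)

lemma has_type_append: "has_type T \<Delta> t \<sigma> \<Longrightarrow> has_type T (\<Delta> @ \<Delta>') t \<sigma>"
proof (induction rule: has_type.induct)
  case (1 i)
  then show ?case using has_type.intros(1)[of i "\<Delta> @ \<Delta>'" T] by (simp add: nth_append)
qed (auto intro: has_type.intros)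

lemma has_type_Var: "i < length \<Delta> \<Longrightarrow> \<sigma> = \<Delta> ! i \<Longrightarrow> has_type T \<Delta> (Var i) \<sigma>"
  by (simp add: has_type.intros)

lemma has_type_lift: "has_type T \<Delta> t \<sigma> \<Longrightarrow> n = length \<Delta>' \<Longrightarrow> has_type T (\<Delta>' @ \<Delta>) (lift_tm n t) \<sigma>"
  unfolding lift_tm_def
  by (erule has_type_subst) (auto simp: sub_type_def nth_append intro!: has_type_Var)

lemma has_type_lift_1: "has_type T \<Delta> t \<sigma> \<Longrightarrow> has_type T (\<tau> # \<Delta>) (lift_tm (Suc 0) t) \<sigma>"
  using has_type_lift[of T \<Delta> t \<sigma> "Suc 0" "[\<tau>]"] by simp

lemma sub_type_under: "sub_type T \<Delta> \<theta> \<Delta>' \<Longrightarrow> sub_type T (\<sigma> # \<Delta>) (under \<theta>) (\<sigma> # \<Delta>')"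
  by (auto simp: sub_type_def under_def nth_Cons intro: has_type_Var has_type_lift_1 split: nat.splits)

lemma sub_type_case_nat:
  "sub_type T (\<sigma> # \<Delta>) (case_nat t \<theta>) \<Delta>' \<longleftrightarrow> has_type T \<Delta>' t \<sigma> \<and> sub_type T \<Delta> \<theta> \<Delta>'"
  by (force simp: sub_type_def nth_Cons less_Suc_eq_0_disj split: nat.splits)

lemma sub_type_Var: "sub_type T \<Delta> Var (\<Delta> @ \<Delta>')"
  by (auto simp: sub_type_def nth_append intro!: has_type_Var)

lemma sub_type_comp:
  "sub_type T \<Delta> \<theta> \<Delta>' \<Longrightarrow> sub_type T \<Delta>' \<eta> \<Delta>'' \<Longrightarrow> sub_type T \<Delta> (\<lambda>i. subst_tm \<eta> (\<theta> i)) \<Delta>''"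
  by (auto simp: sub_type_def[of T \<Delta>] intro: has_type_subst)

lemma sub_type_append: "sub_type T \<Delta> \<theta> \<Delta>' \<Longrightarrow> sub_type T \<Delta> \<theta> (\<Delta>' @ \<Delta>'')"
  by (auto simp: sub_type_def intro: has_type_append)

lemma wf_fm_subst: "wf_fm T \<Delta> A \<Longrightarrow> sub_type T \<Delta> \<theta> \<Delta>' \<Longrightarrow> wf_fm T \<Delta>' (subst \<theta> A)"
proof (induction A arbitrary: \<Delta> \<Delta>' \<theta>)
  case (Rel r ts)
  then show ?case
    by (auto simp: list_all2_conv_all_nth intro: has_type_subst)
qed (auto intro: has_type_subst sub_type_under)

lemma subst_tm_cong:
  "has_type T \<Delta> t \<sigma> \<Longrightarrow> (\<And>i. i < length \<Delta> \<Longrightarrow> \<theta> i = \<eta> i) \<Longrightarrow> subst_tm \<theta> t = subst_tm \<eta> t"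
  by (induction rule: has_type.induct) auto

lemma subst_cong:
  "wf_fm T \<Delta> A \<Longrightarrow> (\<And>i. i < length \<Delta> \<Longrightarrow> \<theta> i = \<eta> i) \<Longrightarrow> subst \<theta> A = subst \<eta> A"
proof (induction A arbitrary: \<Delta> \<theta> \<eta>)
  case (Rel r ts)
  have "subst_tm \<theta> t = subst_tm \<eta> t" if "t \<in> set ts" for t
  proof -
    from that Rel.prems(1) obtain \<sigma> where "has_type T \<Delta> t \<sigma>"
      by (auto simp: list_all2_conv_all_nth in_set_conv_nth)
    then show ?thesis using Rel.prems(2) by (rule subst_tm_cong)
  qed
  then show ?case by simp
next
  case (All \<sigma> A)
  from All.IH[of "\<sigma> # \<Delta>" "under \<theta>" "under \<eta>"] All.prems show ?case
    by (auto simp: under_def split: nat.split)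
next
  case (Ex \<sigma> A)
  from Ex.IH[of "\<sigma> # \<Delta>" "under \<theta>" "under \<eta>"] Ex.prems show ?case
    by (auto simp: under_def split: nat.split)
next
  case (Eq \<sigma> t u)
  then show ?case using subst_tm_cong[of T \<Delta> _ \<sigma> \<theta> \<eta>] by simp
next
  case (Conj A B)
  from Conj.prems show ?case using Conj.IH[of \<Delta> \<theta> \<eta>] by simp
next
  case (Disj A B)
  from Disj.prems show ?case using Disj.IH[of \<Delta> \<theta> \<eta>] by simp
next
  case (Imp A B)
  from Imp.prems show ?case using Imp.IH[of \<Delta> \<theta> \<eta>] by simp
qed simp

lemma subst_tm_closed: "has_type T [] t \<sigma> \<Longrightarrow> subst_tm \<theta> t = t"
  using subst_tm_cong[of T "[]" t \<sigma> \<theta> Var] by simp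

lemma wf_fm_append: "wf_fm T \<Delta> A \<Longrightarrow> wf_fm T (\<Delta> @ \<Delta>') A"
  using wf_fm_subst[OF _ sub_type_Var] by fastforce

lemma wf_fm_inst: "wf_fm T (\<sigma> # \<Delta>) A \<Longrightarrow> has_type T \<Delta> t \<sigma> \<Longrightarrow> wf_fm T \<Delta> (inst A t)"
  unfolding inst_def by (erule wf_fm_subst) (simp add: sub_type_case_nat sub_type_Var[of T \<Delta> "[]", simplified])

lemma derives_wf: "derives T \<Delta> \<Gamma> A \<Longrightarrow> wf_seq T \<Delta> \<Gamma> A"
  by (induction rule: derives.induct) (auto simp: wf_seq_def)

lemma wf_seq_subst:
  "wf_seq T \<Delta> \<Gamma> A \<Longrightarrow> wf_ctx T \<Delta>' \<Longrightarrow> sub_type T \<Delta> \<theta> \<Delta>' \<Longrightarrow>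
    wf_seq T \<Delta>' (map (subst \<theta>) \<Gamma>) (subst \<theta> A)"
  by (auto simp: wf_seq_def intro: wf_fm_subst)

text \<open>The common source of all changes of context: weakening (by the identity substitution),
  renaming of a fresh variable, and instantiation of theorems of \<open>T\<close>. The axiom case
  works because \<open>nonlog\<close> admits arbitrary instances and substitutions compose.\<close>

lemma derives_subst:
  assumes "derives T \<Delta> \<Gamma> A" and "wf_ctx T \<Delta>'" and "sub_type T \<Delta> \<theta> \<Delta>'"
  shows "derives T \<Delta>' (map (subst \<theta>) \<Gamma>) (subst \<theta> A)"
  using assms
proof (induction arbitrary: \<Delta>' \<theta> rule: derives.induct)
  case (ident \<Delta> \<Gamma> A)
  then show ?case by (simp add: derives.ident wf_seq_subst)
next
  case (struct \<Delta> \<Gamma> A \<Gamma>')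
  from struct.IH[OF struct.prems] show ?case
    by (rule derives.struct) (use struct in \<open>auto simp: wf_seq_subst\<close>)
next
  case (cut \<Delta> \<Gamma> A B)
  from derives.cut[OF cut.IH(1)[OF cut.prems]] cut.IH(2)[OF cut.prems] show ?case by simp
next
  case (var \<sigma> \<Delta> \<Gamma> A)
  have "wf_ctx T (\<sigma> # \<Delta>')"
    using derives_wf[OF var.hyps(1)] var.prems by (auto simp: wf_seq_def wf_ctx_def)
  from var.IH[OF this sub_type_under[OF var.prems(2)]] show ?case
    by - (rule derives.var[of T \<sigma>], use var in \<open>auto simp: o_def wf_seq_subst\<close>)
next
  case (botL \<Delta> \<Gamma> A)
  from wf_seq_subst[OF botL] show ?case by (simp add: derives.botL)
next
  case (conjR \<Delta> \<Gamma> A B)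
  then show ?case by (simp add: derives.conjR)
next
  case (conjL \<Delta> A B \<Gamma> C)
  from conjL.IH[OF conjL.prems] show ?case by (simp add: derives.conjL)
next
  case (disjR1 \<Delta> \<Gamma> A B)
  with wf_fm_subst[OF disjR1.hyps(2) disjR1.prems(2)] show ?case by (simp add: derives.disjR1)
next
  case (disjR2 \<Delta> \<Gamma> B A)
  with wf_fm_subst[OF disjR2.hyps(2) disjR2.prems(2)] show ?case by (simp add: derives.disjR2)
next
  case (disjL \<Delta> A \<Gamma> C B)
  with wf_fm_subst[OF disjL.hyps(3) disjL.prems(2)] show ?case by (simp add: derives.disjL)
next
  case (impR \<Delta> A \<Gamma> B)
  from impR.IH[OF impR.prems] show ?case by (simp add: derives.impR)
next
  case (impL \<Delta> \<Gamma> A B C)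
  from impL.IH(1)[OF impL.prems] impL.IH(2)[OF impL.prems] show ?case by (simp add: derives.impL)
next
  case (allR \<sigma> \<Delta> \<Gamma> A)
  have "wf_ctx T (\<sigma> # \<Delta>')"
    using derives_wf[OF allR.hyps(1)] allR.prems by (auto simp: wf_seq_def wf_ctx_def)
  from allR.IH[OF this sub_type_under[OF allR.prems(2)]] wf_seq_subst[OF allR.hyps(2) allR.prems]
  show ?case by (simp add: o_def derives.allR)
next
  case (allL \<Delta> A t \<Gamma> C \<sigma>)
  from allL.IH[OF allL.prems] wf_fm_subst[OF allL.hyps(3) allL.prems(2)]
    has_type_subst[OF allL.hyps(2) allL.prems(2)]
  show ?case by (simp add: subst_inst derives.allL)
next
  case (exR \<Delta> \<Gamma> A t \<sigma>)
  from exR.IH[OF exR.prems] wf_fm_subst[OF exR.hyps(3) exR.prems(2)]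
    has_type_subst[OF exR.hyps(2) exR.prems(2)]
  show ?case by (simp add: subst_inst derives.exR)
next
  case (exL \<sigma> \<Delta> A \<Gamma> C)
  have "wf_ctx T (\<sigma> # \<Delta>')"
    using derives_wf[OF exL.hyps(1)] exL.prems by (auto simp: wf_seq_def wf_ctx_def)
  from exL.IH[OF this sub_type_under[OF exL.prems(2)]] wf_seq_subst[OF exL.hyps(2) exL.prems]
  show ?case by (simp add: o_def derives.exL)
next
  case (classic \<Delta> \<Gamma> A)
  with wf_seq_subst[OF classic(2-4)] show ?case by (simp add: derives.classic)
next
  case (nonlog \<Delta>\<^sub>0 A \<Delta> \<eta> \<Gamma>)
  from wf_seq_subst[OF nonlog(3-5)] show ?case
    unfolding subst_comp using nonlog
    by - (rule derives.nonlog[of \<Delta>\<^sub>0], auto simp: has_type_subst)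
qed

section \<open>The Kripke-style semantics of derivability\<close>

datatype ('g, 'c, 'r) world = World (ctx: "'g ty list") (hyps: "('g, 'c, 'r) fm list")

locale forcing =
  fixes T :: "('g, 'c, 'r) fo_theory"
begin

definition world :: "('g, 'c, 'r) world \<Rightarrow> bool" where
  "world w \<longleftrightarrow> wf_ctx T (ctx w) \<and> (\<forall>B \<in> set (hyps w). wf_fm T (ctx w) B)"

text \<open>Plain derivability instead of a recursion on formulas; the clauses of Kripke semantics
  are recovered below as introduction and elimination lemmas.\<close>

definition forces :: "('g, 'c, 'r) world \<Rightarrow> ('g, 'c, 'r) fm \<Rightarrow> bool"
    (infix "\<Vdash>" 50) where
  "w \<Vdash> A \<longleftrightarrow> derives T (ctx w) (hyps w) A"

text \<open>Hypotheses are compared as sets, which rule \<open>struct\<close> permits. Both ends are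
  required to be worlds, so that well-formedness travels along with the order.\<close>

definition extends ::
  "('g, 'c, 'r) world \<Rightarrow> ('g, 'c, 'r) world \<Rightarrow> bool"
    (infix "\<preceq>" 50) where
  "w \<preceq> w' \<longleftrightarrow> world w \<and> world w' \<and> (\<exists>\<Delta>. ctx w' = ctx w @ \<Delta>) \<and> set (hyps w) \<subseteq> set (hyps w')"

abbreviation wf :: "('g, 'c, 'r) world \<Rightarrow> ('g, 'c, 'r) fm \<Rightarrow> bool" where
  "wf w \<equiv> wf_fm T (ctx w)"

abbreviation typed :: "('g, 'c, 'r) world \<Rightarrow> ('g, 'c) tm \<Rightarrow> 'g ty \<Rightarrow> bool" where
  "typed w \<equiv> has_type T (ctx w)"

abbreviation typeds ::
  "('g, 'c, 'r) world \<Rightarrow> ('g, 'c) tm list \<Rightarrow> 'g ty list \<Rightarrow> bool" where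
  "typeds w \<equiv> list_all2 (typed w)"

abbreviation sub ::
  "('g, 'c, 'r) world \<Rightarrow> 'g ty list \<Rightarrow> (nat \<Rightarrow> ('g, 'c) tm) \<Rightarrow> bool" where
  "sub w \<Delta> \<theta> \<equiv> sub_type T \<Delta> \<theta> (ctx w)"

lemma extends_refl [simp]: "w \<preceq> w \<longleftrightarrow> world w"
  by (auto simp: extends_def)

lemma extends_trans [trans]: "w \<preceq> w' \<Longrightarrow> w' \<preceq> w'' \<Longrightarrow> w \<preceq> w''"
  by (auto simp: extends_def)

lemma extendsD: "w \<preceq> w' \<Longrightarrow> world w" "w \<preceq> w' \<Longrightarrow> world w'"
  by (auto simp: extends_def)

lemma typed_mono: "typed w t \<sigma> \<Longrightarrow> w \<preceq> w' \<Longrightarrow> typed w' t \<sigma>"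
  by (auto simp: extends_def intro: has_type_append)

lemma typeds_mono: "typeds w ts \<sigma>s \<Longrightarrow> w \<preceq> w' \<Longrightarrow> typeds w' ts \<sigma>s"
  by (auto intro: list_all2_mono typed_mono)

lemma sub_mono: "sub w \<Delta> \<theta> \<Longrightarrow> w \<preceq> w' \<Longrightarrow> sub w' \<Delta> \<theta>"
  by (auto simp: extends_def intro: sub_type_append)

lemma forces_wf: "w \<Vdash> A \<Longrightarrow> world w" "w \<Vdash> A \<Longrightarrow> wf w A"
  using derives_wf by (auto simp: forces_def wf_seq_def world_def)

lemma forces_mono:
  assumes "w \<Vdash> A" and "w \<preceq> w'"
  shows "w' \<Vdash> A"
proof -
  from assms(2) obtain \<Delta> where \<Delta>: "ctx w' = ctx w @ \<Delta>" and sub: "set (hyps w) \<subseteq> set (hyps w')"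
    and w': "world w'"
    by (auto simp: extends_def)
  \<comment> \<open>The identity substitution, typed from \<open>ctx w\<close> into the longer
    context, performs the weakening.\<close>
  have "derives T (ctx w') (map (subst Var) (hyps w)) (subst Var A)"
    using derives_subst assms(1) w' sub_type_Var unfolding forces_def world_def \<Delta> by blast
  then have d: "derives T (ctx w') (hyps w) A"
    by (simp add: map_idI)
  then show ?thesis
    unfolding forces_def using sub w' derives_wf[OF d]
    by (intro derives.struct[OF d]) (auto simp: world_def wf_seq_def)
qed

lemma wf_seqI: "world w \<Longrightarrow> wf w A \<Longrightarrow> wf_seq T (ctx w) (hyps w) A"
  by (simp add: wf_seq_def world_def)

lemma world_Cons: "world w \<Longrightarrow> wf w A \<Longrightarrow> world (World (ctx w) (A # hyps w))"
  by (auto simp: world_def)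

lemma extends_Cons: "world w \<Longrightarrow> wf w A \<Longrightarrow> w \<preceq> World (ctx w) (A # hyps w)"
  by (auto simp: world_def extends_def)

lemma forces_hyp: "world w \<Longrightarrow> A \<in> set (hyps w) \<Longrightarrow> w \<Vdash> A"
  by (auto simp: forces_def world_def wf_seq_def intro: derives.ident)

lemma forces_cut: "w \<Vdash> A \<Longrightarrow> World (ctx w) (A # hyps w) \<Vdash> B \<Longrightarrow> w \<Vdash> B"
  by (auto simp: forces_def intro: derives.cut)

section \<open>Kripke clauses for connectives and quantifiers\<close>

lemma forces_BotE: "w \<Vdash> Bot \<Longrightarrow> wf w A \<Longrightarrow> w \<Vdash> A"
  by (rule forces_cut, assumption)
    (auto simp: forces_def intro!: derives.botL dest!: derives_wf simp: wf_seq_def)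

lemma forces_Conj: "w \<Vdash> Conj A B \<longleftrightarrow> w \<Vdash> A \<and> w \<Vdash> B"
proof
  assume *: "w \<Vdash> Conj A B"
  then have "world (World (ctx w) (A # B # hyps w))"
    using forces_wf[OF *] by (auto simp: world_def)
  then have "World (ctx w) (A # B # hyps w) \<Vdash> A" "(World (ctx w) (A # B # hyps w)) \<Vdash> B"
    by (auto intro: forces_hyp)
  then have "World (ctx w) (Conj A B # hyps w) \<Vdash> A" "(World (ctx w) (Conj A B # hyps w)) \<Vdash> B"
    by (auto simp: forces_def intro: derives.conjL)
  with * show "w \<Vdash> A \<and> w \<Vdash> B"
    by (blast intro: forces_cut)
qed (auto simp: forces_def intro: derives.conjR)

text \<open>Among all extensions one is generic: \<open>w\<close> with \<open>A\<close> added to its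
  hypotheses. The third assumption is applied to that one, and \<open>impR\<close> does the
  rest.\<close>

lemma forces_ImpI:
  assumes "world w" "wf w A" and "\<And>w'. w \<preceq> w' \<Longrightarrow> w' \<Vdash> A \<Longrightarrow> w' \<Vdash> B"
  shows "w \<Vdash> Imp A B"
proof -
  have "World (ctx w) (A # hyps w) \<Vdash> B"
    using assms(1,2) by (intro assms(3)) (auto intro!: forces_hyp world_Cons extends_Cons)
  then show ?thesis
    by (auto simp: forces_def intro: derives.impR)
qed

lemma forces_ImpE:
  assumes "w \<Vdash> Imp A B" "w \<Vdash> A"
  shows "w \<Vdash> B"
proof (rule forces_cut[OF assms(1)])
  have "World (ctx w) (B # hyps w) \<Vdash> B"
    using forces_wf[OF assms(1)] by (auto intro: forces_hyp world_Cons)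
  with assms(2) show "World (ctx w) (Imp A B # hyps w) \<Vdash> B"
    by (auto simp: forces_def intro: derives.impL)
qed

lemma forces_DisjI1: "w \<Vdash> A \<Longrightarrow> wf w (Disj A B) \<Longrightarrow> w \<Vdash> Disj A B"
  and forces_DisjI2: "w \<Vdash> B \<Longrightarrow> wf w (Disj A B) \<Longrightarrow> w \<Vdash> Disj A B"
  by (auto simp: forces_def intro: derives.disjR1 derives.disjR2)

text \<open>Worlds receive a fresh variable at the end of the context, whereas the eigenvariable of
  the calculus has index 0. This renaming moves the last variable to the front; hypotheses that do
  not contain it are merely lifted.\<close>

lemma derives_last_var:
  assumes "derives T (\<Delta> @ [\<sigma>]) \<Phi> A" "\<And>B. B \<in> set \<Phi> \<Longrightarrow> wf_fm T \<Delta> B" "wf_ctx T \<Delta>"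
  shows "derives T (\<sigma> # \<Delta>) (map (lift (Suc 0)) \<Phi>)
    (subst (\<lambda>i. if i = length \<Delta> then Var 0 else Var (Suc i)) A)"
proof -
  let ?\<rho> = "\<lambda>i. if i = length \<Delta> then Var 0 else Var (Suc i)"
  have "wf_ctx T (\<sigma> # \<Delta>)"
    using derives_wf[OF assms(1)] by (auto simp: wf_seq_def wf_ctx_def)
  moreover have "sub_type T (\<Delta> @ [\<sigma>]) ?\<rho> (\<sigma> # \<Delta>)"
    by (auto simp: sub_type_def nth_append intro!: has_type_Var)
  ultimately have "derives T (\<sigma> # \<Delta>) (map (subst ?\<rho>) \<Phi>) (subst ?\<rho> A)"
    using derives_subst[OF assms(1)] by blast
  moreover have "map (subst ?\<rho>) \<Phi> = map (lift (Suc 0)) \<Phi>"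
    using assms(2) by (auto simp: lift_def intro!: subst_cong)
  ultimately show ?thesis by simp
qed

lemma world_snoc: "world w \<Longrightarrow> \<sigma> \<in> types T \<Longrightarrow> world (World (ctx w @ [\<sigma>]) (hyps w))"
  by (auto simp: world_def wf_ctx_def intro: wf_fm_append)

lemma extends_snoc: "world w \<Longrightarrow> \<sigma> \<in> types T \<Longrightarrow> w \<preceq> (World (ctx w @ [\<sigma>]) (hyps w))"
  using world_snoc by (auto simp: extends_def)

text \<open>The renaming of \<open>derives_last_var\<close> cancels instantiation at the fresh last
  variable and so returns the matrix demanded by \<open>allR\<close> and \<open>exL\<close>.\<close>

lemma subst_fresh_inst:
  assumes "wf_fm T (\<sigma> # \<Delta>) A"
  shows "subst (\<lambda>i. if i = length \<Delta> then Var 0 else Var (Suc i)) (inst A (Var (length \<Delta>))) = A"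
proof -
  have "subst (\<lambda>i. if i = length \<Delta> then Var 0 else Var (Suc i)) (inst A (Var (length \<Delta>)))
      = subst Var A"
    unfolding inst_def subst_comp
    by (rule subst_cong[OF assms]) (auto split: nat.split)
  then show ?thesis by simp
qed

lemma forces_AllI:
  assumes "world w" "wf w (All \<sigma> A)"
    and "\<And>w' t. w \<preceq> w' \<Longrightarrow> typed w' t \<sigma> \<Longrightarrow> w' \<Vdash> inst A t"
  shows "w \<Vdash> All \<sigma> A"
proof -
  have \<sigma>: "\<sigma> \<in> types T" and A: "wf_fm T (\<sigma> # ctx w) A"
    using assms(2) by auto
  \<comment> \<open>The generic extension: one new variable of type \<open>\<sigma>\<close>, whose
    index at the end of the context is \<open>length (ctx w)\<close>.\<close>
  have "World (ctx w @ [\<sigma>]) (hyps w) \<Vdash> inst A (Var (length (ctx w)))"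
    using assms(1) \<sigma> by (intro assms(3) extends_snoc) (auto intro: has_type_Var)
  then have "derives T (\<sigma> # ctx w) (map (lift (Suc 0)) (hyps w)) A"
    using derives_last_var[of "ctx w" \<sigma> "hyps w"] assms(1) subst_fresh_inst[OF A]
    by (fastforce simp: forces_def world_def)
  then show ?thesis
    unfolding forces_def using assms(1,2) by (auto intro!: derives.allR wf_seqI)
qed

lemma forces_AllE:
  assumes "w \<Vdash> All \<sigma> A" "typed w t \<sigma>"
  shows "w \<Vdash> inst A t"
proof (rule forces_cut[OF assms(1)])
  have "World (ctx w) (inst A t # hyps w) \<Vdash> inst A t"
    using forces_wf[OF assms(1)] assms(2) by (auto intro!: forces_hyp world_Cons wf_fm_inst)
  then show "World (ctx w) (All \<sigma> A # hyps w) \<Vdash> inst A t"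
    unfolding forces_def world.sel
    by (rule derives.allL) (use assms forces_wf[OF assms(1)] in auto)
qed

lemma forces_ExI: "w \<Vdash> inst A t \<Longrightarrow> typed w t \<sigma> \<Longrightarrow> wf w (Ex \<sigma> A) \<Longrightarrow> w \<Vdash> Ex \<sigma> A"
  unfolding forces_def by (rule derives.exR)

text \<open>The element \<open>t\<close> exists only in extensions of \<open>w\<close>, so it can be
  used only for a conclusion \<open>C\<close> that already makes sense at \<open>w\<close>.\<close>

lemma forces_ExE:
  assumes "w \<Vdash> Ex \<sigma> A" "wf w C"
    and "\<And>w' t. w \<preceq> w' \<Longrightarrow> typed w' t \<sigma> \<Longrightarrow> w' \<Vdash> inst A t \<Longrightarrow> w' \<Vdash> C"
  shows "w \<Vdash> C"
proof (rule forces_cut[OF assms(1)])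
  let ?n = "length (ctx w)"
  let ?\<rho> = "\<lambda>i. if i = ?n then Var 0 else Var (Suc i)"
  let ?v = "(World (ctx w @ [\<sigma>]) (hyps w))"
  let ?A = "inst A (Var ?n)"
  let ?w = "(World (ctx w @ [\<sigma>]) (?A # hyps w))"
  have w: "world w" and \<sigma>: "\<sigma> \<in> types T" and A: "wf_fm T (\<sigma> # ctx w) A"
    using forces_wf[OF assms(1)] by auto
  have "wf_fm T (\<sigma> # ctx w @ [\<sigma>]) A"
    using wf_fm_append[OF A] by simp
  then have wfA: "wf ?v ?A"
    by (auto intro!: wf_fm_inst has_type_Var)
  have le: "w \<preceq> ?w"
    using extends_trans[OF extends_snoc[OF w \<sigma>] extends_Cons[OF world_snoc[OF w \<sigma>] wfA]] by simp
  then have "?w \<Vdash> C"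
    by (intro assms(3)) (auto intro!: has_type_Var forces_hyp dest: extendsD)
  \<comment> \<open>The instance \<open>?A\<close> contains the fresh variable. It is discharged
    first, since \<open>derives_last_var\<close> requires the hypotheses to live in the old
    context.\<close>
  then have "derives T (ctx w @ [\<sigma>]) (hyps w) (Imp ?A C)"
    by (auto simp: forces_def intro: derives.impR)
  then have "derives T (\<sigma> # ctx w) (map (lift (Suc 0)) (hyps w)) (subst ?\<rho> (Imp ?A C))"
    using w by (intro derives_last_var) (auto simp: world_def)
  moreover have "subst ?\<rho> C = lift (Suc 0) C"
    unfolding lift_def by (rule subst_cong[OF assms(2)]) auto
  ultimately have d: "(World (\<sigma> # ctx w) (map (lift (Suc 0)) (hyps w))) \<Vdash> Imp A (lift (Suc 0) C)"
    using subst_fresh_inst[OF A] by (simp add: forces_def)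
  then have "(World (\<sigma> # ctx w) (A # map (lift (Suc 0)) (hyps w))) \<Vdash> lift (Suc 0) C"
    using forces_wf[OF d] A
    by (intro forces_ImpE[OF forces_mono[OF d]]) (auto intro!: forces_hyp simp: extends_def world_def)
  then show "World (ctx w) (Ex \<sigma> A # hyps w) \<Vdash> C"
    unfolding forces_def
    using derives.exL[of T \<sigma> "ctx w" A "hyps w" C] w \<sigma> A assms(2)
    by (auto simp: wf_seq_def world_def)
qed

text \<open>Semantic form of rule \<open>var\<close>: moving the appended variable to index 0 just
  lifts \<open>A\<close> and the hypotheses of \<open>w\<close>.\<close>

lemma forces_discard_var:
  assumes "world w" "wf w A" "World (ctx w @ [\<sigma>]) (hyps w) \<Vdash> A"
  shows "w \<Vdash> A"
proof -
  have "derives T (\<sigma> # ctx w) (map (lift (Suc 0)) (hyps w))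
      (subst (\<lambda>i. if i = length (ctx w) then Var 0 else Var (Suc i)) A)"
    using derives_last_var[of "ctx w" \<sigma> "hyps w" A] assms by (auto simp: world_def forces_def)
  also have "subst (\<lambda>i. if i = length (ctx w) then Var 0 else Var (Suc i)) A = lift (Suc 0) A"
    unfolding lift_def by (rule subst_cong[OF assms(2)]) auto
  finally show ?thesis
    unfolding forces_def using derives.var[of T \<sigma> "ctx w" "hyps w" A] wf_seqI[OF assms(1,2)] by simp
qed

lemma forces_derivable:
  assumes "derives T \<Delta> [] A" "world w" "sub w \<Delta> \<theta>"
  shows "w \<Vdash> subst \<theta> A"
proof -
  from assms have d: "derives T (ctx w) [] (subst \<theta> A)"
    using derives_subst[OF assms(1), of "ctx w" \<theta>] by (auto simp: world_def)
  show ?thesis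
    unfolding forces_def
    by (rule derives.struct[OF d]) (use derives_wf[OF d] assms(2) in \<open>auto simp: wf_seq_def world_def\<close>)
qed

end

section \<open>Equality\<close>

lemma has_type_types: "has_type T \<Delta> t \<sigma> \<Longrightarrow> wf_theory T \<Longrightarrow> wf_ctx T \<Delta> \<Longrightarrow> \<sigma> \<in> types T"
proof (induction rule: has_type.induct)
  case (1 i)
  then show ?case by (auto simp: wf_ctx_def)
next
  case (2 c)
  then show ?case unfolding wf_theory_def by blast
next
  case (3 t \<sigma> \<tau> u)
  then show ?case unfolding wf_theory_def by blast
qed

locale forcing_eq = forcing T for T :: "('g, 'c, 'r) fo_theory" +
  assumes wf_T: "wf_theory T"
    and reflexivity: "proves_all T (reflexivity_axioms T)"
    and leibniz: "proves_all T (leibniz_axioms T)"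
begin

lemma typed_types: "typed w t \<sigma> \<Longrightarrow> world w \<Longrightarrow> \<sigma> \<in> types T"
  using has_type_types wf_T by (auto simp: world_def)

lemma eq_refl:
  assumes "world w" "typed w t \<sigma>"
  shows "w \<Vdash> Eq \<sigma> t t"
proof -
  have "derives T [] [] (All \<sigma> (Eq \<sigma> (Var 0) (Var 0)))"
    using reflexivity typed_types[OF assms(2,1)] by (auto simp: proves_all_def reflexivity_axioms_def)
  from forces_derivable[OF this assms(1), of Var] have "w \<Vdash> All \<sigma> (Eq \<sigma> (Var 0) (Var 0))"
    by (simp only: subst_Var sub_type_def) simp
  from forces_AllE[OF this assms(2)] show ?thesis by (simp add: inst_def)
qed

lemma eq_inst:
  assumes eq: "w \<Vdash> Eq \<sigma> t u" and t: "w \<Vdash> inst B t" and B: "wf_fm T (\<sigma> # ctx w) B"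
  shows "w \<Vdash> inst B u"
proof -
  \<comment> \<open>Index 0 stays the marked variable \<open>z\<close> of \<open>leibniz\<close>,
    while the other variables of \<open>B\<close> are shifted beyond \<open>z\<close>,
    \<open>y\<close> and \<open>x\<close>. So \<open>x\<close> and \<open>y\<close> enter at the
    marked places alone, and the two instantiations below give exactly \<open>inst B t\<close> and
    \<open>inst B u\<close>.\<close>
  let ?B = "subst (case_nat (Var 0) (\<lambda>i. Var (i + 3))) B"
  have w: "world w" and \<sigma>: "\<sigma> \<in> types T" and tu: "typed w t \<sigma>" "typed w u \<sigma>"
    using forces_wf[OF eq] by auto
  have "wf_fm T (\<sigma> # \<sigma> # \<sigma> # ctx w) ?B"
    by (rule wf_fm_subst[OF B])
      (auto simp: sub_type_case_nat sub_type_def[of T "ctx w"] numeral_3_eq_3 intro: has_type_Var)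
  then have "derives T (ctx w) [] (leibniz \<sigma> ?B)"
    using leibniz \<sigma> w by (force simp: proves_all_def leibniz_axioms_def world_def)
  from forces_derivable[OF this w, of Var] have "w \<Vdash> leibniz \<sigma> ?B"
    using sub_type_Var[of T "ctx w" "[]"] by simp
  then have "w \<Vdash> inst (All \<sigma> (Imp (Conj (inst ?B (Var 1)) (Eq \<sigma> (Var 1) (Var 0))) (inst ?B (Var 0)))) t"
    unfolding leibniz_def using tu(1) by (rule forces_AllE)
  then have "w \<Vdash> All \<sigma> (subst (under (case_nat t Var))
      (Imp (Conj (inst ?B (Var 1)) (Eq \<sigma> (Var 1) (Var 0))) (inst ?B (Var 0))))"
    by (simp only: inst_def[of "All _ _"] subst.simps)
  from forces_AllE[OF this tu(2)]
  have "w \<Vdash> Imp (Conj (inst B t) (Eq \<sigma> t u)) (inst B u)"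
  proof -
    have "subst (case_nat u Var) (subst (under (case_nat t Var)) (inst ?B (Var 1))) = inst B t"
      "subst (case_nat u Var) (subst (under (case_nat t Var)) (inst ?B (Var 0))) = inst B u"
      unfolding inst_def subst_comp
      by (intro arg_cong[of _ _ "\<lambda>\<theta>. subst \<theta> B"];
          auto simp: fun_eq_iff under_def lift_tm_def subst_tm_comp numeral_3_eq_3 split: nat.split)+
    moreover have "subst_tm (case_nat u Var) (under (case_nat t Var) 1) = t"
      by (simp add: under_def lift_tm_def subst_tm_comp)
    moreover have "subst_tm (case_nat u Var) (under (case_nat t Var) 0) = u"
      by (simp add: under_def)
    moreover note \<open>w \<Vdash> inst (subst _ _) u\<close>
    ultimately show ?thesis
      by (simp only: inst_def[of _ u] subst.simps subst_tm.simps)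
  qed
  then show ?thesis
    by (rule forces_ImpE) (simp add: forces_Conj eq t)
qed

text \<open>The variables are replaced one by one, each time by Leibniz' rule.\<close>

lemma eq_subst:
  assumes X: "wf_fm T \<Delta> X"
    and eq: "\<And>i. i < length \<Delta> \<Longrightarrow> w \<Vdash> Eq (\<Delta> ! i) (\<theta> i) (\<eta> i)"
    and \<theta>: "w \<Vdash> subst \<theta> X"
  shows "w \<Vdash> subst \<eta> X"
proof -
  have types: "typed w (\<theta> i) (\<Delta> ! i) \<and> typed w (\<eta> i) (\<Delta> ! i)" if "i < length \<Delta>" for i
    using forces_wf(2)[OF eq[OF that]] by simp
  have "w \<Vdash> subst (\<lambda>i. if i < k then \<eta> i else \<theta> i) X" if "k \<le> length \<Delta>" for k
    using that
  proof (induction k)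
    case 0
    then show ?case using \<theta> by simp
  next
    case (Suc k)
    let ?\<rho> = "\<lambda>i. if i < k then lift_tm 1 (\<eta> i) else if i = k then Var 0 else lift_tm 1 (\<theta> i)"
    have inst: "inst (subst ?\<rho> X) t = subst (\<lambda>i. if i < k then \<eta> i else if i = k then t else \<theta> i) X" for t
      unfolding inst_def subst_comp
      by (rule arg_cong[of _ _ "\<lambda>\<theta>. subst \<theta> X"]) (auto simp: fun_eq_iff lift_tm_def subst_tm_comp)
    have "sub_type T \<Delta> ?\<rho> (\<Delta> ! k # ctx w)"
      using types by (auto simp: sub_type_def intro: has_type_lift_1 has_type_Var)
    then have wf: "wf_fm T (\<Delta> ! k # ctx w) (subst ?\<rho> X)"
      by (rule wf_fm_subst[OF X])
    have "(\<lambda>i. if i < k then \<eta> i else \<theta> i) = (\<lambda>i. if i < k then \<eta> i else if i = k then \<theta> k else \<theta> i)"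
      by auto
    then have "w \<Vdash> inst (subst ?\<rho> X) (\<theta> k)"
      unfolding inst using Suc by simp
    then have "w \<Vdash> inst (subst ?\<rho> X) (\<eta> k)"
      by (rule eq_inst[OF eq _ wf, rotated]) (use Suc in simp)
    moreover have "(\<lambda>i. if i < Suc k then \<eta> i else \<theta> i) = (\<lambda>i. if i < k then \<eta> i else if i = k then \<eta> k else \<theta> i)"
      by (auto simp: less_Suc_eq)
    ultimately show ?case
      unfolding inst by simp
  qed
  then have "w \<Vdash> subst (\<lambda>i. if i < length \<Delta> then \<eta> i else \<theta> i) X"
    by simp
  also have "subst (\<lambda>i. if i < length \<Delta> then \<eta> i else \<theta> i) X = subst \<eta> X"
    by (rule subst_cong[OF X]) simp
  finally show ?thesis .
qed

text \<open>Rewriting both sides of an equation at once. Symmetry and transitivity both follow, by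
  taking reflexivity for the equations that should change nothing.\<close>

lemma eq_rewrite:
  assumes "w \<Vdash> Eq \<sigma> t t'" "w \<Vdash> Eq \<sigma> u u'" "w \<Vdash> Eq \<sigma> t u"
  shows "w \<Vdash> Eq \<sigma> t' u'"
proof -
  have "\<sigma> \<in> types T"
    using forces_wf(2)[OF assms(1)] by simp
  then have "wf_fm T [\<sigma>, \<sigma>] (Eq \<sigma> (Var 0) (Var 1))"
    by (auto intro: has_type_Var)
  moreover have "w \<Vdash> Eq ([\<sigma>, \<sigma>] ! i) ([t, u] ! i) ([t', u'] ! i)" if "i < length [\<sigma>, \<sigma>]" for i
    using that assms by (auto simp: less_Suc_eq)
  moreover have "w \<Vdash> subst (\<lambda>i. [t, u] ! i) (Eq \<sigma> (Var 0) (Var 1))"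
    using assms(3) by simp
  ultimately have "w \<Vdash> subst (\<lambda>i. [t', u'] ! i) (Eq \<sigma> (Var 0) (Var 1))"
    by (rule eq_subst)
  then show ?thesis by simp
qed

lemma eq_sym: "w \<Vdash> Eq \<sigma> t u \<Longrightarrow> w \<Vdash> Eq \<sigma> u t"
  by (rule eq_rewrite[of w \<sigma> t u t t]) (use forces_wf[of w "Eq \<sigma> t u"] in \<open>auto intro: eq_refl\<close>)

lemma eq_trans [trans]: "w \<Vdash> Eq \<sigma> t u \<Longrightarrow> w \<Vdash> Eq \<sigma> u v \<Longrightarrow> w \<Vdash> Eq \<sigma> t v"
  by (rule eq_rewrite[of w \<sigma> t t u v]) (use forces_wf[of w "Eq \<sigma> t u"] in \<open>auto intro: eq_refl\<close>)

lemma eq_App: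
  assumes "w \<Vdash> Eq (\<sigma> \<rightharpoonup> \<tau>) f g" "w \<Vdash> Eq \<sigma> t u"
  shows "w \<Vdash> Eq \<tau> (f \<cdot> t) (g \<cdot> u)"
proof -
  note wf = forces_wf[OF assms(1)] forces_wf(2)[OF assms(2)]
  \<comment> \<open>Each side of the equation has its own pair of variables: filled with
    \<open>f, t, f, t\<close> it holds by reflexivity, and then only the right-hand pair is replaced
    by \<open>g, u\<close>.\<close>
  let ?\<Delta> = "[\<sigma> \<rightharpoonup> \<tau>, \<sigma>, \<sigma> \<rightharpoonup> \<tau>, \<sigma>]"
  let ?X = "Eq \<tau> (Var 0 \<cdot> Var 1) (Var 2 \<cdot> Var 3)"
  have "\<sigma> \<rightharpoonup> \<tau> \<in> types T" using wf(2) by simp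
  with wf_T have "\<tau> \<in> types T" unfolding wf_theory_def by blast
  then have "wf_fm T ?\<Delta> ?X"
    by (auto intro!: has_type.intros(3)[of _ _ _ \<sigma>] has_type_Var)
  moreover have "w \<Vdash> Eq (?\<Delta> ! i) ([f, t, f, t] ! i) ([f, t, g, u] ! i)" if "i < length ?\<Delta>" for i
    using that wf assms by (auto simp: less_Suc_eq intro: eq_refl)
  moreover have "w \<Vdash> subst (\<lambda>i. [f, t, f, t] ! i) ?X"
    using wf \<open>\<tau> \<in> types T\<close> by (auto intro!: eq_refl has_type.intros(3))
  ultimately have "w \<Vdash> subst (\<lambda>i. [f, t, g, u] ! i) ?X"
    by (rule eq_subst)
  then show ?thesis by simp
qed

end

section \<open>The interpretation under substitution\<close>

lemma subst_tm_apps: "subst_tm \<theta> (apps h ts) = apps (subst_tm \<theta> h) (map (subst_tm \<theta>) ts)"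
  unfolding apps_def by (induction ts arbitrary: h) auto

lemma apps_Nil [simp]: "apps h [] = h" and apps_Cons: "apps h (t # ts) = apps (h \<cdot> t) ts"
  by (simp_all add: apps_def)

lemma arrows_Nil [simp]: "arrows [] \<tau> = \<tau>" and arrows_Cons [simp]: "arrows (\<sigma> # \<sigma>s) \<tau> = \<sigma> \<rightharpoonup> arrows \<sigma>s \<tau>"
  by (simp_all add: arrows_def)

lemma has_type_apps:
  "list_all2 (has_type T \<Delta>) ts \<sigma>s \<Longrightarrow> has_type T \<Delta> h (arrows \<sigma>s \<tau>) \<Longrightarrow> has_type T \<Delta> (apps h ts) \<tau>"
  by (induction ts \<sigma>s arbitrary: h rule: list_all2_induct) (auto simp: apps_Cons intro: has_type.intros(3))

lemma arrows_wit: "set \<sigma>s \<subseteq> wit_types W \<Longrightarrow> \<tau> \<in> wit_types W \<Longrightarrow> arrows \<sigma>s \<tau> \<in> wit_types W"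
  by (induction \<sigma>s) (auto intro: wit_types.intros)

lemma funpow_under: "(under ^^ n) \<theta> i = (if i < n then Var i else lift_tm n (\<theta> (i - n)))"
proof (induction n arbitrary: i)
  case (Suc n)
  then show ?case
    by (cases i) (auto simp: under_def lift_tm_def subst_tm_comp)
qed simp

lemma lift_funpow_under [simp]: "subst ((under ^^ n) \<theta>) (lift n A) = lift n (subst \<theta> A)"
  unfolding lift_def subst_comp by (simp add: funpow_under lift_tm_def)

lemma lift_tm_funpow_under [simp]: "subst_tm ((under ^^ n) \<theta>) (lift_tm n t) = lift_tm n (subst_tm \<theta> t)"
  unfolding lift_tm_def subst_tm_comp by (simp add: funpow_under lift_tm_def)

lemma length_tuple_vars [simp]: "length (tuple_vars k n) = n"
  by (simp add: tuple_vars_def)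

lemma nth_tuple_vars: "i < n \<Longrightarrow> tuple_vars k n ! i = Var (k + n - 1 - i)"
  by (simp add: tuple_vars_def rev_nth)

lemma tuple_vars_funpow_under [simp]:
  "map (subst_tm ((under ^^ n) \<theta>)) (tuple_vars 0 n) = tuple_vars 0 n"
  by (rule nth_equalityI) (auto simp: nth_tuple_vars funpow_under)

text \<open>The outermost binder of a tuple has the largest index, hence the reversed block in the
  context.\<close>

lemma list_all2_tuple_vars:
  "n = length \<beta>s \<Longrightarrow> k = length \<Delta> \<Longrightarrow>
    list_all2 (has_type T (\<Delta> @ rev \<beta>s @ \<Delta>')) (tuple_vars k n) \<beta>s"
  by (auto simp: list_all2_conv_all_nth nth_tuple_vars nth_append rev_nth intro!: has_type_Var)

lemma subst_bounded_Alls: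
  "length Bs = length \<beta>s \<Longrightarrow>
    subst \<theta> (bounded_Alls \<beta>s Bs X) =
      bounded_Alls \<beta>s (map (subst_tm \<theta>) Bs) (subst ((under ^^ length \<beta>s) \<theta>) X)"
proof (induction \<beta>s arbitrary: \<theta> Bs)
  case (Cons \<beta> \<beta>s)
  then obtain B Bs' where "Bs = B # Bs'" by (cases Bs) auto
  with Cons.prems show ?case
    by (simp add: Cons.IH funpow_swap1 o_def) (simp add: under_def)
qed simp

lemma list_all2_lift_1:
  "list_all2 (has_type T \<Delta>) ts \<sigma>s \<Longrightarrow> list_all2 (has_type T (\<tau> # \<Delta>)) (map (lift_tm (Suc 0)) ts) \<sigma>s"
  by (auto simp: list_all2_conv_all_nth intro: has_type_lift_1)

lemma list_all2_lift:
  "list_all2 (has_type T \<Delta>) ts \<sigma>s \<Longrightarrow> n = length \<Delta>' \<Longrightarrow>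
    list_all2 (has_type T (\<Delta>' @ \<Delta>)) (map (lift_tm n) ts) \<sigma>s"
  by (auto simp: list_all2_conv_all_nth intro: has_type_lift)

section \<open>Instantiation of a quantified tuple\<close>

text \<open>The list is reversed because index 0 belongs to the innermost quantifier, which binds
  the last component. This substitution cancels \<open>lift n\<close> and sends
  \<open>tuple_vars 0 n\<close> to \<open>bs\<close>.\<close>

definition inst_tuple :: "('g, 'c) tm list \<Rightarrow> nat \<Rightarrow> ('g, 'c) tm" where
  "inst_tuple bs i = (if i < length bs then rev bs ! i else Var (i - length bs))"

lemma inst_tuple_Nil [simp]: "inst_tuple [] = Var"
  by (simp add: inst_tuple_def fun_eq_iff)

lemma inst_tuple_lift [simp]:
  "length bs = n \<Longrightarrow> subst (inst_tuple bs) (lift n A) = A"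
  by (simp add: lift_def subst_comp inst_tuple_def)

lemma inst_tuple_lift_tm [simp]:
  "length bs = n \<Longrightarrow> subst_tm (inst_tuple bs) (lift_tm n t) = t"
  by (simp add: lift_tm_def subst_tm_comp inst_tuple_def)

lemma inst_tuple_vars [simp]:
  "length bs = n \<Longrightarrow> map (subst_tm (inst_tuple bs)) (tuple_vars 0 n) = bs"
  by (rule nth_equalityI) (auto simp: nth_tuple_vars inst_tuple_def rev_nth)

text \<open>Filling the outermost slot while the other \<open>n\<close> are still bound, and those
  afterwards, is the same as filling all at once. This is the inductive step whenever the
  quantifiers of a tuple are removed one by one.\<close>

lemma inst_tuple_Cons:
  "n = length bs \<Longrightarrow>
    subst (inst_tuple bs) (subst ((under ^^ n) (case_nat b Var)) X) = subst (inst_tuple (b # bs)) X"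
  unfolding subst_comp
  by (rule arg_cong[of _ _ "\<lambda>\<theta>. subst \<theta> X"])
    (auto simp: fun_eq_iff funpow_under inst_tuple_def nth_append rev_nth not_less
      lift_tm_def subst_tm_comp split: nat.split)

lemma pos_subst [simp]: "pos I (subst \<theta> A) = pos I A"
  and neg_subst [simp]: "neg I (subst \<theta> A) = neg I A"
  by (induction A arbitrary: \<theta>) auto

lemma pos_lift [simp]: "pos I (lift n A) = pos I A" and neg_lift [simp]: "neg I (lift n A) = neg I A"
  by (simp_all add: lift_def)

lemma pos_inst [simp]: "pos I (inst A t) = pos I A" and neg_inst [simp]: "neg I (inst A t) = neg I A"
  by (simp_all add: inst_def)

locale uniform_interpretation = forcing_eq T
  for T :: "('g, 'c, ('g, 'q) trel) fo_theory" +
  fixes G W :: "'g set"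
    and N :: "('g ty list \<times> ('g, 'c, 'r) fm) set"
    and S :: "('g, 'c, 'r) fo_theory"
    and I :: "('g, 'c, 'r, 'q) base_interp"
  assumes source: "source_theory G N S"
    and target: "target_theory S W T"
    and base_wf: "wf_base_interp S W T I"
    and sound: "sound_interp N W T I"
begin

lemma wit_types_T: "wit_types W \<subseteq> types T"
  and types_S_T: "types S \<subseteq> types T"
  and constants_S_T: "constants S \<subseteq> constants T"
  using target by (auto simp: target_theory_def)

lemma arity_Mem: "\<sigma> \<in> wit_types W \<Longrightarrow> arity T (Mem \<sigma>) = Some [\<sigma>, Fin \<sigma>]"
  using target by (auto simp: target_theory_def)

text \<open>Substituting terms of \<open>T\<close> into formulas of \<open>S\<close> leaves the language of \<open>S\<close>; the language \<open>S\<^sub>T\<close>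
  is closed under such substitutions.\<close>

definition S\<^sub>T :: "('g, 'c, 'r) fo_theory" where
  "S\<^sub>T = S\<lparr>constants := constants T\<rparr>"

lemma S\<^sub>T_simps [simp]: "types S\<^sub>T = types S" "arity S\<^sub>T = arity S" "has_disj S\<^sub>T = has_disj S"
  by (simp_all add: S\<^sub>T_def)

lemma has_type_S\<^sub>T [simp]: "has_type S\<^sub>T = has_type T"
  by (intro ext has_type_cong) (simp add: S\<^sub>T_def)

lemma sub_type_S\<^sub>T [simp]: "sub_type S\<^sub>T = sub_type T"
  by (intro ext) (simp add: sub_type_def)

lemma wf_S\<^sub>T: "wf_fm S \<Delta> A \<Longrightarrow> wf_fm S\<^sub>T \<Delta> A"
proof (induction A arbitrary: \<Delta>)
  case (Eq \<sigma> t u)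
  then show ?case by (auto intro: has_type_mono[OF _ constants_S_T])
next
  case (Rel r ts)
  then show ?case by (auto elim!: list_all2_mono intro: has_type_mono[OF _ constants_S_T])
qed auto

lemma pos_neg_wit: "wf_fm S\<^sub>T \<Delta> A \<Longrightarrow> set (pos I A) \<subseteq> wit_types W \<and> set (neg I A) \<subseteq> wit_types W"
proof (induction A arbitrary: \<Delta>)
  case (Rel r ts)
  then show ?case using base_wf by (auto simp: wf_base_interp_def)
next
  case (Imp A B)
  from Imp.IH[of \<Delta>] Imp.prems show ?case
    by (auto intro!: arrows_wit wit_types.intros)
next
  case (All \<sigma> A)
  from All.IH[of "\<sigma> # \<Delta>"] All.prems show ?case by simp
next
  case (Ex \<sigma> A)
  from Ex.IH[of "\<sigma> # \<Delta>"] Ex.prems show ?case by (auto intro: wit_types.intros)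
qed fastforce+

lemmas pos_wit = pos_neg_wit[THEN conjunct1] and neg_wit = pos_neg_wit[THEN conjunct2]

lemma wf_bounded_Alls:
  "list_all2 (has_type T \<Delta>) Bs (map Fin \<beta>s) \<Longrightarrow> set \<beta>s \<subseteq> wit_types W \<Longrightarrow>
    wf_fm T (rev \<beta>s @ \<Delta>) X \<Longrightarrow> wf_fm T \<Delta> (bounded_Alls \<beta>s Bs X)"
proof (induction \<beta>s arbitrary: \<Delta> Bs)
  case (Cons \<beta> \<beta>s)
  then obtain B Bs' where Bs: "Bs = B # Bs'" by (cases Bs) auto
  have "wf_fm T (\<beta> # \<Delta>) (bounded_Alls \<beta>s (map (lift_tm (Suc 0)) Bs') X)"
    using Cons.prems by (intro Cons.IH) (auto simp: Bs intro: list_all2_lift_1)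
  then show ?case
    using Cons.prems wit_types_T by (auto simp: Bs arity_Mem intro: has_type_Var has_type_lift_1)
qed simp

lemma wf_lift: "wf_fm S\<^sub>T \<Delta> A \<Longrightarrow> n = length \<Delta>' \<Longrightarrow> wf_fm S\<^sub>T (\<Delta>' @ \<Delta>) (lift n A)"
  unfolding lift_def by (erule wf_fm_subst) (auto simp: sub_type_def nth_append intro!: has_type_Var)

text \<open>The recursive calls of \<open>interp\<close> are on \<open>lift n A\<close>, which is no
  subformula, so the induction is on \<open>depth\<close>. The lengths are prescribed because
  \<open>take\<close> and \<open>drop\<close> have to cut the tuples at the places intended.\<close>

lemma interp_subst:
  "wf_fm S\<^sub>T \<Delta> A \<Longrightarrow> length as = length (pos I A) \<Longrightarrow> length bs = length (neg I A) \<Longrightarrow>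
    subst \<theta> (interp I A as bs) = interp I (subst \<theta> A) (map (subst_tm \<theta>) as) (map (subst_tm \<theta>) bs)"
proof (induction "depth A" arbitrary: A as bs \<theta> \<Delta> rule: less_induct)
  case less
  show ?case
  proof (cases A)
    case (Rel r ts)
    with less.prems obtain \<sigma>s where \<sigma>s: "arity S r = Some \<sigma>s" "length ts = length \<sigma>s"
      by (auto dest: list_all2_lengthD)
    then have wf: "wf_fm T (\<sigma>s @ base_pos I r @ base_neg I r) (base I r)"
      using base_wf by (auto simp: wf_base_interp_def)
    \<comment> \<open>Beyond the end of a list \<open>!\<close> need not commute with
      \<open>map\<close>; well-formedness of the base formula restricts the comparison to the
      indices in range.\<close>
    show ?thesis
      using less.prems \<sigma>s
      by (simp add: Rel subst_comp) (rule subst_cong[OF wf], simp del: map_append add: map_append[symmetric])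
  next
    case (Conj A1 A2)
    with less.prems show ?thesis
      by (auto simp: Let_def less.hyps take_map drop_map)
  next
    case (Imp A1 A2)
    let ?n = "length (neg I A1)"
    have wf: "wf_fm S\<^sub>T (neg I A1 @ \<Delta>) (lift ?n A1)" "wf_fm S\<^sub>T \<Delta> A2"
      using less.prems by (auto simp: Imp intro: wf_lift)
    obtain f g where as: "as = f @ g" "length f = length (pos I A2)" "length g = ?n"
      using less.prems(2) that[of "take (length (pos I A2)) as" "drop (length (pos I A2)) as"]
      by (simp add: Imp)
    obtain a d where bs: "bs = a @ d" "length a = length (pos I A1)" "length d = length (neg I A2)"
      using less.prems(3) that[of "take (length (pos I A1)) bs" "drop (length (pos I A1)) bs"]
      by (simp add: Imp)
    have "subst \<eta> (interp I (lift ?n A1) (map (lift_tm ?n) a) (tuple_vars 0 ?n)) =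
        interp I (subst \<eta> (lift ?n A1)) (map (subst_tm \<eta>) (map (lift_tm ?n) a))
          (map (subst_tm \<eta>) (tuple_vars 0 ?n))" for \<eta>
      using bs by (intro less.hyps[OF _ wf(1)]) (auto simp: Imp)
    moreover have "subst \<theta> (interp I A2 (map (\<lambda>h. apps h a) f) d) =
        interp I (subst \<theta> A2) (map (subst_tm \<theta>) (map (\<lambda>h. apps h a) f)) (map (subst_tm \<theta>) d)"
      using as bs by (intro less.hyps[OF _ wf(2)]) (auto simp: Imp)
    ultimately show ?thesis
      by (simp add: Imp Let_def as bs subst_bounded_Alls subst_tm_apps o_def)
  next
    case (All \<sigma> A1)
    with less.prems show ?thesis
      by (auto simp: less.hyps o_def)
  next
    case (Ex \<sigma> A1)
    let ?n = "length (neg I A1)"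
    have "wf_fm S\<^sub>T (neg I A1 @ \<sigma> # \<Delta>) (lift ?n A1)"
      using less.prems by (intro wf_lift) (auto simp: Ex)
    moreover have "lift_tm (Suc ?n) t = lift_tm ?n (lift_tm 1 t)" for t :: "('g, 'c) tm"
      by (simp add: lift_tm_comp)
    ultimately show ?thesis
      using less.prems
      by (simp add: Ex Let_def subst_bounded_Alls less.hyps o_def)
  qed simp_all
qed

lemma wf_interp:
  "wf_fm S\<^sub>T \<Delta> A \<Longrightarrow> list_all2 (has_type T \<Delta>) as (pos I A) \<Longrightarrow>
    list_all2 (has_type T \<Delta>) bs (neg I A) \<Longrightarrow> wf_fm T \<Delta> (interp I A as bs)"
proof (induction "depth A" arbitrary: A as bs \<Delta> rule: less_induct)
  case less
  show ?case
  proof (cases A)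
    case (Eq \<sigma> t u)
    with less.prems types_S_T show ?thesis by auto
  next
    case (Rel r ts)
    with less.prems obtain \<sigma>s where \<sigma>s: "arity S r = Some \<sigma>s" "list_all2 (has_type T \<Delta>) ts \<sigma>s"
      by auto
    then have wf: "wf_fm T (\<sigma>s @ base_pos I r @ base_neg I r) (base I r)"
      using base_wf by (auto simp: wf_base_interp_def)
    have "list_all2 (has_type T \<Delta>) (ts @ as @ bs) (\<sigma>s @ base_pos I r @ base_neg I r)"
      using \<sigma>s less.prems Rel by (auto intro: list_all2_appendI)
    then show ?thesis
      by (auto simp: Rel sub_type_def list_all2_conv_all_nth intro!: wf_fm_subst[OF wf])
  next
    case (Conj A1 A2)
    with less.prems show ?thesis
      by (auto simp: Let_def list_all2_append2 intro!: less.hyps)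
  next
    case (Imp A1 A2)
    let ?n = "length (neg I A1)"
    from less.prems obtain f g a d where as: "as = f @ g" and bs: "bs = a @ d"
      and f: "list_all2 (has_type T \<Delta>) f (map (arrows (pos I A1)) (pos I A2))"
      and g: "list_all2 (has_type T \<Delta>) g (map (\<lambda>\<beta>. arrows (pos I A1 @ neg I A2) (Fin \<beta>)) (neg I A1))"
      and a: "list_all2 (has_type T \<Delta>) a (pos I A1)"
      and d: "list_all2 (has_type T \<Delta>) d (neg I A2)"
      by (auto simp: Imp list_all2_append2)
    have len: "length f = length (pos I A2)" "length a = length (pos I A1)"
      using f a by (auto dest: list_all2_lengthD)
    have "wf_fm T (rev (neg I A1) @ \<Delta>)
        (interp I (lift ?n A1) (map (lift_tm ?n) a) (tuple_vars 0 ?n))"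
      using less.prems a
      by (intro less.hyps)
        (auto simp: Imp intro!: wf_lift list_all2_lift list_all2_tuple_vars[of _ _ _ "[]", simplified])
    moreover have "list_all2 (has_type T \<Delta>) (map (\<lambda>h. apps h (a @ d)) g) (map Fin (neg I A1))"
      using g list_all2_appendI[OF a d] by (auto simp: list_all2_conv_all_nth[of _ g] list_all2_conv_all_nth[of _ "map _ _"] intro: has_type_apps)
    ultimately have "wf_fm T \<Delta> (bounded_Alls (neg I A1) (map (\<lambda>h. apps h (a @ d)) g)
        (interp I (lift ?n A1) (map (lift_tm ?n) a) (tuple_vars 0 ?n)))"
      using neg_wit less.prems by (auto simp: Imp intro!: wf_bounded_Alls)
    moreover have "list_all2 (has_type T \<Delta>) (map (\<lambda>h. apps h a) f) (pos I A2)"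
      using f a by (auto simp: list_all2_conv_all_nth[of _ f] list_all2_conv_all_nth[of _ "map _ _"] intro: has_type_apps)
    then have "wf_fm T \<Delta> (interp I A2 (map (\<lambda>h. apps h a) f) d)"
      using d less.prems by (intro less.hyps) (auto simp: Imp)
    ultimately show ?thesis
      by (simp add: Imp as bs Let_def len)
  next
    case (All \<sigma> A1)
    with less.prems types_S_T show ?thesis
      by (auto intro!: less.hyps list_all2_lift_1)
  next
    case (Ex \<sigma> A1)
    let ?n = "length (neg I A1)"
    \<comment> \<open>The shift by \<open>n + 1\<close> crosses two layers, the existential variable
      and the bounded tuple, which are typed one after the other.\<close>
    have eq: "map (lift_tm (Suc ?n)) as = map (lift_tm ?n) (map (lift_tm (Suc 0)) as)"
      by (simp add: lift_tm_comp)
    have wf: "wf_fm T (rev (neg I A1) @ \<sigma> # \<Delta>)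
        (interp I (lift ?n A1) (map (lift_tm ?n) (map (lift_tm (Suc 0)) as)) (tuple_vars 0 ?n))"
      using less.prems
      by (intro less.hyps)
        (auto simp del: map_map simp: Ex
          intro!: wf_lift list_all2_lift list_all2_lift_1 list_all2_tuple_vars[of _ _ _ "[]", simplified])
    show ?thesis
      using wf[folded eq] less.prems types_S_T neg_wit[of "\<sigma> # \<Delta>" A1]
      by (auto simp: Ex Let_def intro!: wf_bounded_Alls list_all2_lift_1)
  qed simp_all
qed

section \<open>Forcing interpreted formulas\<close>

definition members ::
  "('g, 'c, ('g, 'q) trel) world \<Rightarrow> 'g ty list \<Rightarrow> ('g, 'c) tm list \<Rightarrow>
    ('g, 'c) tm list \<Rightarrow> bool" where
  "members w \<beta>s bs Bs \<longleftrightarrow> (\<forall>i < length \<beta>s. w \<Vdash> Member (\<beta>s ! i) (bs ! i) (Bs ! i))"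

lemma members_Nil [simp]: "members w [] bs Bs"
  by (simp add: members_def)

lemma members_Cons [simp]:
  "members w (\<beta> # \<beta>s) (b # bs) (B # Bs) \<longleftrightarrow> w \<Vdash> Member \<beta> b B \<and> members w \<beta>s bs Bs"
  by (auto simp: members_def less_Suc_eq_0_disj)

lemma members_append:
  "length bs = length \<beta>s \<Longrightarrow> length Bs = length \<beta>s \<Longrightarrow>
    members w (\<beta>s @ \<beta>s') (bs @ bs') (Bs @ Bs') \<longleftrightarrow> members w \<beta>s bs Bs \<and> members w \<beta>s' bs' Bs'"
proof (induction \<beta>s arbitrary: bs Bs)
  case (Cons \<beta> \<beta>s)
  then show ?case by (cases bs; cases Bs) auto
qed simp

lemma members_mono: "members w \<beta>s bs Bs \<Longrightarrow> w \<preceq> w' \<Longrightarrow> members w' \<beta>s bs Bs"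
  by (auto simp: members_def intro: forces_mono)

text \<open>The alternating Kripke clauses for \<open>All\<close> and \<open>Imp\<close>, one pair
  for each component, collapse to a single quantification over extensions: a chain of extensions is
  an extension, and typing and membership persist along it.\<close>

lemma forces_bounded_Alls:
  assumes "world w" "set \<beta>s \<subseteq> wit_types W" "typeds w Bs (map Fin \<beta>s)" "wf_fm T (rev \<beta>s @ ctx w) X"
  shows "w \<Vdash> bounded_Alls \<beta>s Bs X \<longleftrightarrow>
    (\<forall>w' bs. w \<preceq> w' \<longrightarrow> typeds w' bs \<beta>s \<longrightarrow> members w' \<beta>s bs Bs \<longrightarrow> w' \<Vdash> subst (inst_tuple bs) X)"
  using assms
proof (induction \<beta>s arbitrary: w Bs X)
  case Nil
  then show ?case by (auto intro: forces_mono)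
next
  case (Cons \<beta> \<beta>s)
  then obtain B Bs' where Bs: "Bs = B # Bs'" by (cases Bs) auto
  let ?n = "length \<beta>s"
  \<comment> \<open>Only the outermost component is replaced, below the \<open>?n\<close> binders of
    the others, which are left to the induction hypothesis.\<close>
  let ?X = "\<lambda>t. subst ((under ^^ ?n) (case_nat t Var)) X"
  have B: "typed w B (Fin \<beta>)" and Bs': "typeds w Bs' (map Fin \<beta>s)"
    using Cons.prems by (auto simp: Bs)
  have wf: "wf w (bounded_Alls (\<beta> # \<beta>s) Bs X)"
    using Cons.prems by (intro wf_bounded_Alls)
  have wfX: "wf_fm T (rev \<beta>s @ ctx w') (?X t)" if "w \<preceq> w'" "typed w' t \<beta>" for w' t
  proof (rule wf_fm_subst)
    show "wf_fm T (rev \<beta>s @ \<beta> # ctx w) X" using Cons.prems(4) by simp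
    have "has_type T (rev \<beta>s @ ctx w') (lift_tm (length \<beta>s) t) \<beta>"
      using that(2) by (intro has_type_lift) auto
    moreover have "ctx w' ! j = ctx w ! j" "j < length (ctx w')" if "j < length (ctx w)" for j
      using \<open>w \<preceq> w'\<close> that by (auto simp: extends_def nth_append)
    ultimately show "sub_type T (rev \<beta>s @ \<beta> # ctx w) ((under ^^ ?n) (case_nat t Var)) (rev \<beta>s @ ctx w')"
      by (auto simp: sub_type_def funpow_under nth_append nth_Cons lift_tm_def intro!: has_type_Var
        split: nat.split)
  qed
  have inst: "inst (Imp (Member \<beta> (Var 0) (lift_tm 1 B)) (bounded_Alls \<beta>s (map (lift_tm 1) Bs') X)) t =
      Imp (Member \<beta> t B) (bounded_Alls \<beta>s Bs' (?X t))" for t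
    using list_all2_lengthD[OF Bs']
    by (simp add: inst_def subst_bounded_Alls lift_tm_def subst_tm_comp o_def)
  have \<beta>s: "set \<beta>s \<subseteq> wit_types W"
    using Cons.prems(2) by simp
  have key: "typeds v bs \<beta>s \<Longrightarrow> subst (inst_tuple bs) (?X t) = subst (inst_tuple (t # bs)) X" for v bs t
    using inst_tuple_Cons[of ?n bs t X] by (simp add: list_all2_lengthD)
  note IH = Cons.IH[OF extendsD(2) _ typeds_mono[OF Bs']]
  have IH: "w' \<Vdash> bounded_Alls \<beta>s Bs' (?X t) \<longleftrightarrow>
      (\<forall>w'' bs. w' \<preceq> w'' \<longrightarrow> typeds w'' bs \<beta>s \<longrightarrow> members w'' \<beta>s bs Bs' \<longrightarrow>
        w'' \<Vdash> subst (inst_tuple (t # bs)) X)" if "w \<preceq> w'" "typed w' t \<beta>" for w' t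
    unfolding IH[OF that(1) \<beta>s that(1) wfX[OF that]] using key by metis
  show ?case
  proof (intro iffI allI impI)
    fix w' bbs
    assume *: "w \<Vdash> bounded_Alls (\<beta> # \<beta>s) Bs X" "w \<preceq> w'" "typeds w' bbs (\<beta> # \<beta>s)"
      "members w' (\<beta> # \<beta>s) bbs Bs"
    then obtain b bs where bs: "bbs = b # bs" by (cases bbs) auto
    have "w' \<Vdash> inst (Imp (Member \<beta> (Var 0) (lift_tm 1 B)) (bounded_Alls \<beta>s (map (lift_tm 1) Bs') X)) b"
      by (rule forces_AllE[OF forces_mono[OF _ *(2)]]) (use * in \<open>auto simp: bs Bs\<close>)
    then have "w' \<Vdash> bounded_Alls \<beta>s Bs' (?X b)"
      unfolding inst by (rule forces_ImpE) (use * in \<open>auto simp: bs Bs\<close>)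
    then show "w' \<Vdash> subst (inst_tuple bbs) X"
      using * IH[OF *(2), of b] by (auto simp: bs Bs dest: extendsD)
  next
    assume *: "\<forall>w' bs. w \<preceq> w' \<longrightarrow> typeds w' bs (\<beta> # \<beta>s) \<longrightarrow> members w' (\<beta> # \<beta>s) bs Bs \<longrightarrow>
        w' \<Vdash> subst (inst_tuple bs) X"
    show "w \<Vdash> bounded_Alls (\<beta> # \<beta>s) Bs X"
      unfolding Bs bounded_Alls.simps
    proof (rule forces_AllI)
      show "wf w (All \<beta> (Imp (Member \<beta> (Var 0) (lift_tm 1 B)) (bounded_Alls \<beta>s (map (lift_tm 1) Bs') X)))"
        using wf by (simp add: Bs)
      fix w' t
      assume w': "w \<preceq> w'" "typed w' t \<beta>"
      show "w' \<Vdash> inst (Imp (Member \<beta> (Var 0) (lift_tm 1 B)) (bounded_Alls \<beta>s (map (lift_tm 1) Bs') X)) t"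
        unfolding inst
      proof (rule forces_ImpI)
        show "world w'" using w' by (auto dest: extendsD)
        show "wf w' (Member \<beta> t B)"
          using Cons.prems(2) typed_mono[OF B w'(1)] w'(2) by (auto simp: arity_Mem)
        fix w''
        assume w'': "w' \<preceq> w''" "w'' \<Vdash> Member \<beta> t B"
        have le: "w \<preceq> w''" using w' w'' by (blast intro: extends_trans)
        show "w'' \<Vdash> bounded_Alls \<beta>s Bs' (?X t)"
          unfolding IH[OF le typed_mono[OF w'(2) w''(1)]]
        proof (intro allI impI)
          fix v bs
          assume v: "w'' \<preceq> v" "typeds v bs \<beta>s" "members v \<beta>s bs Bs'"
          have "w \<preceq> v" using le v(1) by (rule extends_trans)
          moreover have "typeds v (t # bs) (\<beta> # \<beta>s)"
            using v w' w'' typed_mono by (auto intro: typed_mono)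
          moreover have "members v (\<beta> # \<beta>s) (t # bs) Bs"
            using v w'' by (auto simp: Bs intro: forces_mono)
          ultimately show "v \<Vdash> subst (inst_tuple (t # bs)) X"
            using * by blast
        qed
      qed
    qed (fact Cons.prems)
  qed
qed

text \<open>The meaning of \<open>\<forall>b \<in> Bs. \<langle>A\<rangle>\<close>. Ranging over all
  extensions makes it persistent, and it avoids the syntax of bounded quantifiers in the treatment
  of the rules.\<close>

definition bforces ::
  "('g, 'c, ('g, 'q) trel) world \<Rightarrow> ('g, 'c, 'r) fm \<Rightarrow> ('g, 'c) tm list \<Rightarrow>
    ('g, 'c) tm list \<Rightarrow> bool" where
  "bforces w A as Bs \<longleftrightarrow> (\<forall>w' bs. w \<preceq> w' \<longrightarrow> typeds w' bs (neg I A) \<longrightarrow>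
    members w' (neg I A) bs Bs \<longrightarrow> w' \<Vdash> interp I A as bs)"

lemma bforces_mono: "bforces w A as Bs \<Longrightarrow> w \<preceq> w' \<Longrightarrow> bforces w' A as Bs"
  unfolding bforces_def using extends_trans by blast

lemma bforcesD:
  "bforces w A as Bs \<Longrightarrow> world w \<Longrightarrow> typeds w bs (neg I A) \<Longrightarrow> members w (neg I A) bs Bs \<Longrightarrow>
    w \<Vdash> interp I A as bs"
  by (auto simp: bforces_def)

text \<open>\<open>interp\<close> lifts \<open>A\<close> and its positive tuple below the bounded
  quantifiers, and \<open>inst_tuple\<close> cancels this lifting; what remains of the matrix is
  \<open>interp I A as bs\<close>.\<close>

lemma forces_bounded_interp:
  assumes "world w" "wf_fm S\<^sub>T (ctx w) A" "typeds w as (pos I A)" "typeds w Bs (map Fin (neg I A))"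
    and "n = length (neg I A)"
  shows "w \<Vdash> bounded_Alls (neg I A) Bs (interp I (lift n A) (map (lift_tm n) as) (tuple_vars 0 n)) \<longleftrightarrow>
    bforces w A as Bs"
proof -
  have wf: "wf_fm S\<^sub>T (rev (neg I A) @ ctx w) (lift n A)"
    using assms by (intro wf_lift) auto
  have "wf_fm T (rev (neg I A) @ ctx w) (interp I (lift n A) (map (lift_tm n) as) (tuple_vars 0 n))"
    by (rule wf_interp[OF wf])
      (use assms in \<open>auto intro!: list_all2_lift list_all2_tuple_vars[of _ _ _ "[]", simplified]\<close>)
  from forces_bounded_Alls[OF assms(1) neg_wit[OF assms(2)] assms(4) this]
  have "w \<Vdash> bounded_Alls (neg I A) Bs (interp I (lift n A) (map (lift_tm n) as) (tuple_vars 0 n)) \<longleftrightarrow>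
    (\<forall>w' bs. w \<preceq> w' \<longrightarrow> typeds w' bs (neg I A) \<longrightarrow> members w' (neg I A) bs Bs \<longrightarrow>
      w' \<Vdash> subst (inst_tuple bs) (interp I (lift n A) (map (lift_tm n) as) (tuple_vars 0 n)))" .
  moreover have "subst (inst_tuple bs) (interp I (lift n A) (map (lift_tm n) as) (tuple_vars 0 n)) =
      interp I A as bs" if "typeds w' bs (neg I A)" for w' bs
    using list_all2_lengthD[OF that] list_all2_lengthD[OF assms(3)] assms(5)
    by (subst interp_subst[OF wf]) (auto simp: o_def)
  ultimately show ?thesis
    unfolding bforces_def by simp
qed

lemma forces_interp_Conj:
  assumes "length a = length (pos I A)" "length b = length (neg I A)"
  shows "w \<Vdash> interp I (Conj A B) (a @ c) (b @ d) \<longleftrightarrow> w \<Vdash> interp I A a b \<and> w \<Vdash> interp I B c d"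
  using assms by (simp add: Let_def forces_Conj)

lemma typeds_apps:
  assumes "typeds w hs (map (\<lambda>\<beta>. arrows \<sigma>s (F \<beta>)) \<beta>s)" "typeds w ts \<sigma>s"
  shows "typeds w (map (\<lambda>h. apps h ts) hs) (map F \<beta>s)"
  using assms(1) has_type_apps[OF assms(2)] by (auto simp: list_all2_conv_all_nth)

lemma forces_interp_Imp:
  assumes "world w" "wf_fm S\<^sub>T (ctx w) (Imp A B)"
    and f: "typeds w f (map (arrows (pos I A)) (pos I B))"
    and g: "typeds w g (map (\<lambda>\<beta>. arrows (pos I A @ neg I B) (Fin \<beta>)) (neg I A))"
    and a: "typeds w a (pos I A)" and d: "typeds w d (neg I B)"
  shows "w \<Vdash> interp I (Imp A B) (f @ g) (a @ d) \<longleftrightarrow>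
    (\<forall>w'. w \<preceq> w' \<longrightarrow> bforces w' A a (map (\<lambda>h. apps h (a @ d)) g) \<longrightarrow>
      w' \<Vdash> interp I B (map (\<lambda>h. apps h a) f) d)"
proof -
  let ?n = "length (neg I A)"
  let ?g = "map (\<lambda>h. apps h (a @ d)) g"
  let ?f = "map (\<lambda>h. apps h a) f"
  let ?X = "bounded_Alls (neg I A) ?g (interp I (lift ?n A) (map (lift_tm ?n) a) (tuple_vars 0 ?n))"
  have len: "length f = length (pos I B)" "length a = length (pos I A)"
    using f a by (auto dest: list_all2_lengthD)
  have interp: "interp I (Imp A B) (f @ g) (a @ d) = Imp ?X (interp I B ?f d)"
    by (simp add: Let_def len)
  have tg: "typeds w ?g (map Fin (neg I A))"
    by (rule typeds_apps[OF g]) (rule list_all2_appendI[OF a d])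
  have "typeds w (f @ g) (pos I (Imp A B))" "typeds w (a @ d) (neg I (Imp A B))"
    using f g a d by (auto intro: list_all2_appendI)
  from wf_interp[OF assms(2) this] have wf: "wf w ?X"
    unfolding interp by simp
  have X: "w' \<Vdash> ?X \<longleftrightarrow> bforces w' A a ?g" if "w \<preceq> w'" for w'
    using that assms(2) wf_fm_append
    by (intro forces_bounded_interp typeds_mono[OF a that] typeds_mono[OF tg that])
      (auto simp: extends_def)
  show ?thesis
    unfolding interp
    using X forces_ImpI[OF assms(1) wf] forces_ImpE forces_mono by blast
qed

lemma inst_interp:
  assumes "wf_fm S\<^sub>T (\<sigma> # \<Delta>) A" "length as = length (pos I A)" "length bs = length (neg I A)"
  shows "inst (interp I A (map (lift_tm (Suc 0)) as) (map (lift_tm (Suc 0)) bs)) t = interp I (inst A t) as bs"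
proof -
  have "subst_tm (case_nat t Var) (lift_tm (Suc 0) u) = u" for u :: "('g, 'c) tm"
    by (simp add: lift_tm_def subst_tm_comp)
  then show ?thesis
    using assms(2,3) by (simp add: inst_def interp_subst[OF assms(1)] o_def)
qed

lemma wf_S\<^sub>T_mono: "wf_fm S\<^sub>T (ctx w) A \<Longrightarrow> w \<preceq> w' \<Longrightarrow> wf_fm S\<^sub>T (ctx w') A"
  by (auto simp: extends_def intro: wf_fm_append)

lemma wf_S\<^sub>T_inst: "wf_fm S\<^sub>T (\<sigma> # \<Delta>) A \<Longrightarrow> w \<preceq> w' \<Longrightarrow> ctx w = \<Delta> \<Longrightarrow> typed w' t \<sigma> \<Longrightarrow> wf_fm S\<^sub>T (ctx w') (inst A t)"
  using wf_fm_append[of S\<^sub>T "\<sigma> # \<Delta>" A] by (auto simp: extends_def intro!: wf_fm_inst)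

lemma forces_interp_All:
  assumes "world w" "wf_fm S\<^sub>T (ctx w) (All \<sigma> A)" "typeds w as (pos I A)" "typeds w bs (neg I A)"
  shows "w \<Vdash> interp I (All \<sigma> A) as bs \<longleftrightarrow>
    (\<forall>w' t. w \<preceq> w' \<longrightarrow> typed w' t \<sigma> \<longrightarrow> w' \<Vdash> interp I (inst A t) as bs)"
proof -
  have inst: "inst (interp I A (map (lift_tm (Suc 0)) as) (map (lift_tm (Suc 0)) bs)) t = interp I (inst A t) as bs"
    for t
    using assms by (intro inst_interp[of \<sigma> "ctx w"]) (auto dest: list_all2_lengthD)
  have wf: "wf w (interp I (All \<sigma> A) as bs)"
    using assms by (intro wf_interp) auto
  show ?thesis
  proof (intro iffI allI impI)
    show "w' \<Vdash> interp I (inst A t) as bs"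
      if "w \<Vdash> interp I (All \<sigma> A) as bs" "w \<preceq> w'" "typed w' t \<sigma>" for w' t
      using forces_AllE[OF forces_mono[OF that(1,2)[unfolded interp.simps]] that(3)] by (simp add: inst)
    show "w \<Vdash> interp I (All \<sigma> A) as bs"
      if "\<forall>w' t. w \<preceq> w' \<longrightarrow> typed w' t \<sigma> \<longrightarrow> w' \<Vdash> interp I (inst A t) as bs"
      using that forces_AllI[OF assms(1) wf[unfolded interp.simps]] by (simp add: inst)
  qed
qed

text \<open>Shared by introduction and elimination of \<exists>: the matrix is kept abstract as
  \<open>X\<close>, since only the meaning of its instances matters.\<close>

lemma inst_interp_Ex:
  assumes "world w" "wf_fm S\<^sub>T (ctx w) (Ex \<sigma> A)" "typeds w as (pos I A)" "typeds w Bs (map Fin (neg I A))"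
  obtains X where "interp I (Ex \<sigma> A) as Bs = Ex \<sigma> X"
    and "\<And>w' t. w \<preceq> w' \<Longrightarrow> typed w' t \<sigma> \<Longrightarrow> w' \<Vdash> inst X t \<longleftrightarrow> bforces w' (inst A t) as Bs"
proof -
  let ?n = "length (neg I A)"
  let ?X = "bounded_Alls (neg I A) (map (lift_tm 1) Bs)
      (interp I (lift ?n A) (map (lift_tm (?n + 1)) as) (tuple_vars 0 ?n))"
  have wf: "wf_fm S\<^sub>T (neg I A @ \<sigma> # ctx w) (lift ?n A)"
    using assms by (intro wf_lift) auto
  have "inst ?X t = bounded_Alls (neg I A) Bs (interp I (lift ?n (inst A t)) (map (lift_tm ?n) as) (tuple_vars 0 ?n))" for t
  proof -
    have 1: "subst_tm (case_nat t Var) (lift_tm (Suc 0) u) = u" for u :: "('g, 'c) tm"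
      by (simp add: lift_tm_def subst_tm_comp)
    have "lift_tm (?n + 1) u = lift_tm ?n (lift_tm (Suc 0) u)" for u :: "('g, 'c) tm"
      by (simp add: lift_tm_comp)
    then have 2: "subst_tm ((under ^^ ?n) (case_nat t Var)) (lift_tm (?n + 1) u) = lift_tm ?n u" for u :: "('g, 'c) tm"
      by (simp add: 1)
    show ?thesis
      using list_all2_lengthD[OF assms(3)] list_all2_lengthD[OF assms(4)]
      by (simp add: inst_def subst_bounded_Alls interp_subst[OF wf] o_def 1 2[simplified])
  qed
  then have "w' \<Vdash> inst ?X t \<longleftrightarrow> bforces w' (inst A t) as Bs" if "w \<preceq> w'" "typed w' t \<sigma>" for w' t
    using forces_bounded_interp[of w' "inst A t" as Bs ?n] that assms wf_S\<^sub>T_inst[of \<sigma> "ctx w" A w w' t]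
    by (auto intro: typeds_mono dest: extendsD)
  then show thesis
    by (intro that[of ?X]) (auto simp: Let_def)
qed

lemma forces_interp_ExI:
  assumes "world w" "wf_fm S\<^sub>T (ctx w) (Ex \<sigma> A)" "typeds w as (pos I A)" "typeds w Bs (map Fin (neg I A))"
    and "typed w t \<sigma>" "bforces w (inst A t) as Bs"
  shows "w \<Vdash> interp I (Ex \<sigma> A) as Bs"
proof -
  have "wf w (interp I (Ex \<sigma> A) as Bs)"
    using assms by (intro wf_interp) auto
  then show ?thesis
    using inst_interp_Ex[OF assms(1-4)] forces_ExI assms(1,5,6) by (metis extends_refl)
qed

lemma forces_interp_ExE:
  assumes "world w" "wf_fm S\<^sub>T (ctx w) (Ex \<sigma> A)" "typeds w as (pos I A)" "typeds w Bs (map Fin (neg I A))"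
    and "w \<Vdash> interp I (Ex \<sigma> A) as Bs" "wf w C"
    and *: "\<And>w' t. w \<preceq> w' \<Longrightarrow> typed w' t \<sigma> \<Longrightarrow> bforces w' (inst A t) as Bs \<Longrightarrow> w' \<Vdash> C"
  shows "w \<Vdash> C"
proof -
  obtain X where X: "interp I (Ex \<sigma> A) as Bs = Ex \<sigma> X"
    and inst: "\<And>w' t. w \<preceq> w' \<Longrightarrow> typed w' t \<sigma> \<Longrightarrow> w' \<Vdash> inst X t \<longleftrightarrow> bforces w' (inst A t) as Bs"
    using inst_interp_Ex[OF assms(1-4)] by blast
  show ?thesis
    by (rule forces_ExE[OF assms(5)[unfolded X] assms(6)]) (simp add: inst *)
qed

section \<open>Replacement of equals in interpreted formulas\<close>

definition eqs ::
  "('g, 'c, ('g, 'q) trel) world \<Rightarrow> 'g ty list \<Rightarrow> ('g, 'c) tm list \<Rightarrow>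
    ('g, 'c) tm list \<Rightarrow> bool" where
  "eqs w \<sigma>s ts us \<longleftrightarrow> length ts = length \<sigma>s \<and> length us = length \<sigma>s \<and>
    (\<forall>i < length \<sigma>s. w \<Vdash> Eq (\<sigma>s ! i) (ts ! i) (us ! i))"

lemma eqs_refl: "world w \<Longrightarrow> typeds w ts \<sigma>s \<Longrightarrow> eqs w \<sigma>s ts ts"
  by (auto simp: eqs_def list_all2_conv_all_nth intro: eq_refl)

lemma eqs_sym: "eqs w \<sigma>s ts us \<Longrightarrow> eqs w \<sigma>s us ts"
  by (auto simp: eqs_def intro: eq_sym)

lemma eqs_mono: "eqs w \<sigma>s ts us \<Longrightarrow> w \<preceq> w' \<Longrightarrow> eqs w' \<sigma>s ts us"
  by (auto simp: eqs_def intro: forces_mono)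

text \<open>Both formulas are instances of one formula \<open>?X\<close>, the interpretation of
  \<open>A\<close> at tuples of variables placed in front of the variables of
  \<open>\<Delta>\<close>. So \<open>eq_subst\<close>, applied to \<open>?X\<close>, replaces the
  environment and both tuples simultaneously.\<close>

lemma interp_cong:
  assumes A: "wf_fm S\<^sub>T \<Delta> A" and \<theta>: "eqs w \<Delta> (map \<theta> [0..<length \<Delta>]) (map \<eta> [0..<length \<Delta>])"
    and as: "eqs w (pos I A) as as'" and bs: "eqs w (neg I A) bs bs'"
    and "w \<Vdash> interp I (subst \<theta> A) as bs"
  shows "w \<Vdash> interp I (subst \<eta> A) as' bs'"
proof -
  let ?p = "length (pos I A)" and ?q = "length (neg I A)"
  let ?as = "map Var [0..<?p]" and ?bs = "map Var [?p..<?p + ?q]"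
  let ?X = "interp I (lift (?p + ?q) A) ?as ?bs"
  let ?\<Delta> = "(pos I A @ neg I A) @ \<Delta>"
  let ?\<theta> = "\<lambda>\<theta> as bs i. if i < ?p + ?q then (as @ bs) ! i else \<theta> (i - (?p + ?q))"
  have wf: "wf_fm S\<^sub>T ?\<Delta> (lift (?p + ?q) A)"
    using A by (intro wf_lift) auto
  have X: "wf_fm T ?\<Delta> ?X"
    by (rule wf_interp[OF wf]) (auto simp: list_all2_conv_all_nth nth_append intro!: has_type_Var)
  have eq: "subst (?\<theta> \<theta> as bs) ?X = interp I (subst \<theta> A) as bs"
    if "length as = ?p" "length bs = ?q" for \<theta> as bs
  proof -
    have "map (subst_tm (?\<theta> \<theta> as bs)) ?as = as" "map (subst_tm (?\<theta> \<theta> as bs)) ?bs = bs"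
      using that by (auto intro!: nth_equalityI simp: nth_append)
    moreover have "subst (?\<theta> \<theta> as bs) (lift (?p + ?q) A) = subst \<theta> A"
      by (simp add: lift_def subst_comp)
    ultimately show ?thesis
      by (subst interp_subst[OF wf]) auto
  qed
  have len: "length as = ?p" "length as' = ?p" "length bs = ?q" "length bs' = ?q"
    using as bs by (auto simp: eqs_def)
  have "w \<Vdash> Eq (?\<Delta> ! i) (?\<theta> \<theta> as bs i) (?\<theta> \<eta> as' bs' i)" if "i < length ?\<Delta>" for i
    using that \<theta> as bs by (auto simp: eqs_def nth_append)
  from eq_subst[OF X this] assms(5) show ?thesis
    using len by (simp add: eq)
qed

lemma interp_cong_tuples:
  assumes "wf_fm S\<^sub>T (ctx w) A" "eqs w (pos I A) as as'" "eqs w (neg I A) bs bs'" "w \<Vdash> interp I A as bs"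
  shows "w \<Vdash> interp I A as' bs'"
  using interp_cong[OF assms(1), of w Var Var, OF eqs_refl assms(2,3)] assms(4) forces_wf(1)[OF assms(4)]
  by (auto simp: list_all2_conv_all_nth intro!: has_type_Var)

lemma Member_cong:
  assumes "w \<Vdash> Eq (Fin \<sigma>) B B'" "\<sigma> \<in> wit_types W" "w \<Vdash> Member \<sigma> b B"
  shows "w \<Vdash> Member \<sigma> b B'"
proof -
  have wf: "wf_fm T [\<sigma>, Fin \<sigma>] (Member \<sigma> (Var 0) (Var 1))"
    using assms(2) by (auto simp: arity_Mem intro: has_type_Var)
  have b: "w \<Vdash> Eq \<sigma> b b"
    using forces_wf[OF assms(3)] assms(2) by (auto simp: arity_Mem intro: eq_refl)
  have "w \<Vdash> subst (\<lambda>i. [b, B'] ! i) (Member \<sigma> (Var 0) (Var 1))"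
    by (rule eq_subst[OF wf, of w "\<lambda>i. [b, B] ! i"]) (use assms b in \<open>auto simp: less_Suc_eq\<close>)
  then show ?thesis by simp
qed

lemma members_cong:
  "members w \<beta>s bs Bs \<Longrightarrow> eqs w (map Fin \<beta>s) Bs Bs' \<Longrightarrow> set \<beta>s \<subseteq> wit_types W \<Longrightarrow> members w \<beta>s bs Bs'"
  by (auto simp: members_def eqs_def intro!: Member_cong[of w _ "Bs ! _" "Bs' ! _"])

lemma bforces_cong:
  assumes "bforces w A as Bs" "wf_fm S\<^sub>T (ctx w) A" "eqs w (pos I A) as as'" "eqs w (map Fin (neg I A)) Bs Bs'"
  shows "bforces w A as' Bs'"
  unfolding bforces_def
proof (intro allI impI)
  fix w' bs
  assume w': "w \<preceq> w'" "typeds w' bs (neg I A)" "members w' (neg I A) bs Bs'"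
  have "members w' (neg I A) bs Bs"
    using members_cong[OF w'(3) eqs_mono[OF eqs_sym[OF assms(4)] w'(1)]] neg_wit[OF assms(2)] by simp
  with assms(1) w' have "w' \<Vdash> interp I A as bs"
    by (auto simp: bforces_def)
  then show "w' \<Vdash> interp I A as' bs"
    using wf_S\<^sub>T_mono[OF assms(2) w'(1)] eqs_mono[OF assms(3) w'(1)] w' extendsD(2)[OF w'(1)]
    by (intro interp_cong_tuples[of w' A as as' bs bs] eqs_refl) auto
qed

section \<open>Definable witnesses\<close>

lemma wit_Arrow [simp]: "\<sigma> \<rightharpoonup> \<tau> \<in> wit_types W \<longleftrightarrow> \<sigma> \<in> wit_types W \<and> \<tau> \<in> wit_types W"
  by (auto intro: wit_types.intros elim: wit_types.cases)

lemma wit_Fin [simp]: "Fin \<sigma> \<in> wit_types W \<longleftrightarrow> \<sigma> \<in> wit_types W"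
  by (auto intro: wit_types.intros elim: wit_types.cases)

lemma wit_arrows: "arrows \<sigma>s \<tau> \<in> wit_types W \<longleftrightarrow> set \<sigma>s \<subseteq> wit_types W \<and> \<tau> \<in> wit_types W"
  by (induction \<sigma>s) auto

lemma has_type_Const: "c \<in> constants T \<Longrightarrow> \<tau> = const_type c \<Longrightarrow> has_type T \<Delta> (Const c) \<tau>"
  by (simp add: has_type.intros)

lemma Pi_type:
  assumes "\<sigma> \<in> wit_types W" "\<tau> \<in> wit_types W"
  shows "has_type T \<Delta> (Const (PiC \<sigma> \<tau>)) (\<sigma> \<rightharpoonup> \<tau> \<rightharpoonup> \<sigma>)"
  by (rule has_type_Const) (use target assms in \<open>simp_all add: target_theory_def has_combinators_def\<close>)

lemma Sigma_type:
  assumes "\<rho> \<in> wit_types W" "\<sigma> \<in> wit_types W" "\<tau> \<in> wit_types W"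
  shows "has_type T \<Delta> (Const (SigmaC \<rho> \<sigma> \<tau>)) ((\<rho> \<rightharpoonup> \<sigma> \<rightharpoonup> \<tau>) \<rightharpoonup> (\<rho> \<rightharpoonup> \<sigma>) \<rightharpoonup> \<rho> \<rightharpoonup> \<tau>)"
  by (rule has_type_Const) (use target assms in \<open>simp_all add: target_theory_def has_combinators_def\<close>)

lemma Singleton_type: "\<sigma> \<in> wit_types W \<Longrightarrow> has_type T \<Delta> (Const (Singleton \<sigma>)) (\<sigma> \<rightharpoonup> Fin \<sigma>)"
  by (rule has_type_Const) (use target in \<open>simp_all add: target_theory_def\<close>)

lemma BinUnion_type:
  "\<sigma> \<in> wit_types W \<Longrightarrow> has_type T \<Delta> (Const (BinUnion \<sigma>)) (Fin \<sigma> \<rightharpoonup> Fin \<sigma> \<rightharpoonup> Fin \<sigma>)"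
  by (rule has_type_Const) (use target in \<open>simp_all add: target_theory_def\<close>)

lemma IndUnion_type:
  "\<sigma> \<in> wit_types W \<Longrightarrow> \<tau> \<in> wit_types W \<Longrightarrow>
    has_type T \<Delta> (Const (IndUnion \<sigma> \<tau>)) (Fin \<sigma> \<rightharpoonup> (\<sigma> \<rightharpoonup> Fin \<tau>) \<rightharpoonup> Fin \<tau>)"
  by (rule has_type_Const) (use target in \<open>simp_all add: target_theory_def\<close>)

lemma derivable_tuple:
  assumes "derives T \<Delta> [] A" "world w" "typeds w ts \<Delta>"
  shows "w \<Vdash> subst ((!) ts) A"
  using assms by (intro forces_derivable) (auto simp: sub_type_def list_all2_conv_all_nth)

lemma forces_Pi:
  assumes "world w" "\<sigma> \<in> wit_types W" "\<tau> \<in> wit_types W" "typed w t \<sigma>" "typed w u \<tau>"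
  shows "w \<Vdash> Eq \<sigma> (Const (PiC \<sigma> \<tau>) \<cdot> t \<cdot> u) t"
proof -
  have "derives T [\<sigma>, \<tau>] [] (Eq \<sigma> (Const (PiC \<sigma> \<tau>) \<cdot> Var 0 \<cdot> Var 1) (Var 0))"
    using target assms by (auto simp: target_theory_def proves_all_def combinator_axioms_def)
  from derivable_tuple[OF this assms(1), of "[t, u]"] assms show ?thesis by simp
qed

lemma forces_Sigma:
  assumes "world w" "\<rho> \<in> wit_types W" "\<sigma> \<in> wit_types W" "\<tau> \<in> wit_types W"
    and "typed w t (\<rho> \<rightharpoonup> \<sigma> \<rightharpoonup> \<tau>)" "typed w u (\<rho> \<rightharpoonup> \<sigma>)" "typed w v \<rho>"
  shows "w \<Vdash> Eq \<tau> (Const (SigmaC \<rho> \<sigma> \<tau>) \<cdot> t \<cdot> u \<cdot> v) (t \<cdot> v \<cdot> (u \<cdot> v))"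
proof -
  have "derives T [\<rho> \<rightharpoonup> \<sigma> \<rightharpoonup> \<tau>, \<rho> \<rightharpoonup> \<sigma>, \<rho>] []
      (Eq \<tau> (Const (SigmaC \<rho> \<sigma> \<tau>) \<cdot> Var 0 \<cdot> Var 1 \<cdot> Var 2) (Var 0 \<cdot> Var 2 \<cdot> (Var 1 \<cdot> Var 2)))"
    using target assms by (auto simp: target_theory_def proves_all_def combinator_axioms_def)
  from derivable_tuple[OF this assms(1), of "[t, u, v]"] assms show ?thesis by simp
qed

text \<open>Bounds are only ever enlarged, so it is membership in a newly built set that has to be
  established: the right-to-left half of the equivalences.\<close>

lemma set_property:
  assumes "(\<Delta>, Iff A B) \<in> set_properties (wit_types W)" "world w" "typeds w ts \<Delta>" "w \<Vdash> subst ((!) ts) B"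
  shows "w \<Vdash> subst ((!) ts) A"
proof -
  have "derives T \<Delta> [] (Iff A B)"
    using target assms(1) by (auto simp: target_theory_def proves_all_def)
  from derivable_tuple[OF this assms(2,3)] have "w \<Vdash> Imp (subst ((!) ts) B) (subst ((!) ts) A)"
    by (simp add: Iff_def forces_Conj)
  then show ?thesis using assms(4) by (rule forces_ImpE)
qed

lemma forces_Singleton:
  assumes "world w" "\<sigma> \<in> wit_types W" "typed w t \<sigma>"
  shows "w \<Vdash> Member \<sigma> t (Const (Singleton \<sigma>) \<cdot> t)"
  using set_property[of "[\<sigma>, \<sigma>]" "Member \<sigma> (Var 0) (Const (Singleton \<sigma>) \<cdot> Var 1)" "Eq \<sigma> (Var 0) (Var 1)" w "[t, t]"]
    assms eq_refl
  by (auto simp: set_properties_def)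

text \<open>The disjunction in the last assumption is one of the metatheory: it is known which of
  the two sets contains \<open>t\<close>, so the disjunction in \<open>T\<close> is
  introduced.\<close>

lemma forces_BinUnion:
  assumes "world w" "\<sigma> \<in> wit_types W" "typed w t \<sigma>" "typed w A (Fin \<sigma>)" "typed w B (Fin \<sigma>)"
    and "w \<Vdash> Member \<sigma> t A \<or> w \<Vdash> Member \<sigma> t B"
  shows "w \<Vdash> Member \<sigma> t (Const (BinUnion \<sigma>) \<cdot> A \<cdot> B)"
proof -
  have "wf w (Disj (Member \<sigma> t A) (Member \<sigma> t B))"
    using target assms by (auto simp: target_theory_def)
  then have "w \<Vdash> Disj (Member \<sigma> t A) (Member \<sigma> t B)"
    using assms(6) forces_DisjI1 forces_DisjI2 by blast
  then show ?thesis
    using set_property[of "[\<sigma>, Fin \<sigma>, Fin \<sigma>]" "Member \<sigma> (Var 0) (Const (BinUnion \<sigma>) \<cdot> Var 1 \<cdot> Var 2)"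
        "Disj (Member \<sigma> (Var 0) (Var 1)) (Member \<sigma> (Var 0) (Var 2))" w "[t, A, B]"] assms
    by (auto simp: set_properties_def)
qed

lemma forces_IndUnion:
  assumes "world w" "\<sigma> \<in> wit_types W" "\<tau> \<in> wit_types W" "typed w t \<tau>" "typed w A (Fin \<sigma>)"
    and "typed w q (\<sigma> \<rightharpoonup> Fin \<tau>)" "typed w u \<sigma>" "w \<Vdash> Member \<sigma> u A" "w \<Vdash> Member \<tau> t (q \<cdot> u)"
  shows "w \<Vdash> Member \<tau> t (Const (IndUnion \<sigma> \<tau>) \<cdot> A \<cdot> q)"
proof -
  let ?E = "Ex \<sigma> (Conj (Member \<sigma> (Var 0) (Var 2)) (Member \<tau> (Var 1) (Var 3 \<cdot> Var 0)))"
  let ?E' = "subst ((!) [t, A, q]) ?E"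
  have "wf_fm T [\<tau>, Fin \<sigma>, \<sigma> \<rightharpoonup> Fin \<tau>] ?E"
    using assms wit_types_T by (auto simp: arity_Mem intro!: has_type.intros(3)[of _ _ _ \<sigma>] has_type_Var)
  then have "wf w ?E'"
    by (rule wf_fm_subst) (use assms in \<open>auto simp: sub_type_def less_Suc_eq\<close>)
  then have "w \<Vdash> ?E'"
    unfolding subst.simps
    by (rule forces_ExI[OF _ assms(7), rotated])
      (use assms in \<open>simp add: inst_def under_def lift_tm_def subst_tm_comp forces_Conj numeral_2_eq_2 numeral_3_eq_3\<close>)
  then show ?thesis
    using set_property[of "[\<tau>, Fin \<sigma>, \<sigma> \<rightharpoonup> Fin \<tau>]"
        "Member \<tau> (Var 0) (Const (IndUnion \<sigma> \<tau>) \<cdot> Var 1 \<cdot> Var 2)" ?E w "[t, A, q]"] assms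
    by (auto simp: set_properties_def)
qed

text \<open>Witnesses are handled as functions on tuples of terms that are definable by open witnessing
  terms; closed ones appear only at the end, by bracket abstraction.\<close>

inductive wtm :: "'g ty list \<Rightarrow> ('g, 'c) tm \<Rightarrow> 'g ty \<Rightarrow> bool" for \<alpha>s where
  wtm_Var: "i < length \<alpha>s \<Longrightarrow> \<alpha>s ! i \<in> wit_types W \<Longrightarrow> wtm \<alpha>s (Var i) (\<alpha>s ! i)"
| wtm_closed: "has_type T [] t \<sigma> \<Longrightarrow> \<sigma> \<in> wit_types W \<Longrightarrow> wtm \<alpha>s t \<sigma>"
| wtm_App: "wtm \<alpha>s t (\<sigma> \<rightharpoonup> \<tau>) \<Longrightarrow> wtm \<alpha>s u \<sigma> \<Longrightarrow> wtm \<alpha>s (t \<cdot> u) \<tau>"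

lemma wtm_wit: "wtm \<alpha>s t \<sigma> \<Longrightarrow> \<sigma> \<in> wit_types W"
  by (induction rule: wtm.induct) auto

lemma wtm_has_type: "wtm \<alpha>s t \<sigma> \<Longrightarrow> has_type T \<alpha>s t \<sigma>"
  by (induction rule: wtm.induct) (auto intro: has_type.intros dest: has_type_append[of T "[]" _ _ \<alpha>s])

text \<open>The defining term \<open>u\<close> is chosen before \<open>as\<close>, with
  \<open>Var i\<close> standing for the i-th argument; this uniformity is what abstraction needs.
  Only lists of the right length are constrained, hence the congruence rule
  \<open>dterm_cong\<close>.\<close>

definition dterm :: "'g ty list \<Rightarrow> 'g ty \<Rightarrow> (('g, 'c) tm list \<Rightarrow> ('g, 'c) tm) \<Rightarrow> bool" where
  "dterm \<alpha>s \<tau> f \<longleftrightarrow>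
    (\<exists>u. wtm \<alpha>s u \<tau> \<and> (\<forall>as. length as = length \<alpha>s \<longrightarrow> f as = subst_tm ((!) as) u))"

definition dtup :: "'g ty list \<Rightarrow> 'g ty list \<Rightarrow> (('g, 'c) tm list \<Rightarrow> ('g, 'c) tm list) \<Rightarrow> bool" where
  "dtup \<alpha>s \<beta>s F \<longleftrightarrow> (\<forall>as. length as = length \<alpha>s \<longrightarrow> length (F as) = length \<beta>s) \<and>
    (\<forall>i < length \<beta>s. dterm \<alpha>s (\<beta>s ! i) (\<lambda>as. F as ! i))"

lemma dterm_cong:
  "\<tau> = \<tau>' \<Longrightarrow> (\<And>as. length as = length \<alpha>s \<Longrightarrow> f as = g as) \<Longrightarrow> dterm \<alpha>s \<tau> f \<longleftrightarrow> dterm \<alpha>s \<tau>' g"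
  by (auto simp: dterm_def)

lemma dterm_wit: "dterm \<alpha>s \<tau> f \<Longrightarrow> \<tau> \<in> wit_types W"
  by (auto simp: dterm_def dest: wtm_wit)

lemma dterm_typed:
  assumes "dterm \<alpha>s \<tau> f" "typeds w as \<alpha>s"
  shows "typed w (f as) \<tau>"
proof -
  from assms(1) obtain u where "wtm \<alpha>s u \<tau>" "f as = subst_tm ((!) as) u"
    using list_all2_lengthD[OF assms(2)] by (auto simp: dterm_def)
  with assms(2) show ?thesis
    by (auto simp: sub_type_def list_all2_conv_all_nth intro!: has_type_subst[OF wtm_has_type])
qed

lemma dterm_closed: "has_type T [] t \<tau> \<Longrightarrow> \<tau> \<in> wit_types W \<Longrightarrow> dterm \<alpha>s \<tau> (\<lambda>as. t)"
  unfolding dterm_def by (intro exI[of _ t]) (simp add: subst_tm_closed wtm_closed)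

lemma dterm_App:
  assumes "dterm \<alpha>s (\<sigma> \<rightharpoonup> \<tau>) f" "dterm \<alpha>s \<sigma> g"
  shows "dterm \<alpha>s \<tau> (\<lambda>as. f as \<cdot> g as)"
proof -
  from assms obtain u v where "wtm \<alpha>s u (\<sigma> \<rightharpoonup> \<tau>)" "wtm \<alpha>s v \<sigma>"
    "\<And>as. length as = length \<alpha>s \<Longrightarrow> f as = subst_tm ((!) as) u"
    "\<And>as. length as = length \<alpha>s \<Longrightarrow> g as = subst_tm ((!) as) v"
    unfolding dterm_def by blast
  then show ?thesis
    unfolding dterm_def by (intro exI[of _ "u \<cdot> v"]) (simp add: wtm_App[of _ _ \<sigma>])
qed

lemma dterm_nth: "i < length \<alpha>s \<Longrightarrow> \<alpha>s ! i \<in> wit_types W \<Longrightarrow> dterm \<alpha>s (\<alpha>s ! i) (\<lambda>as. as ! i)"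
  unfolding dterm_def by (intro exI[of _ "Var i"]) (simp add: wtm_Var)

lemma dtup_nth: "dtup \<alpha>s \<beta>s F \<Longrightarrow> i < length \<beta>s \<Longrightarrow> dterm \<alpha>s (\<beta>s ! i) (\<lambda>as. F as ! i)"
  by (simp add: dtup_def)

lemma dtup_length: "dtup \<alpha>s \<beta>s F \<Longrightarrow> length as = length \<alpha>s \<Longrightarrow> length (F as) = length \<beta>s"
  by (simp add: dtup_def)

lemma dtup_wit: "dtup \<alpha>s \<beta>s F \<Longrightarrow> set \<beta>s \<subseteq> wit_types W"
  unfolding dtup_def in_set_conv_nth subset_iff using dterm_wit by blast

lemma dtup_typed:
  assumes "dtup \<alpha>s \<beta>s F" "typeds w as \<alpha>s"
  shows "typeds w (F as) \<beta>s"
  unfolding list_all2_conv_all_nth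
  using dtup_length[OF assms(1) list_all2_lengthD[OF assms(2)]] dterm_typed[OF dtup_nth[OF assms(1)] assms(2)]
  by simp

text \<open>Composition needs no renaming: a variable of the outer defining term is replaced by the
  corresponding component of \<open>K\<close>, and closed subterms stay as they are.\<close>

lemma dterm_comp:
  assumes "dterm \<beta>s \<tau> f" "dtup \<alpha>s \<beta>s K"
  shows "dterm \<alpha>s \<tau> (\<lambda>as. f (K as))"
proof -
  from assms(1) obtain u where u: "wtm \<beta>s u \<tau>"
    and f: "\<And>bs. length bs = length \<beta>s \<Longrightarrow> f bs = subst_tm ((!) bs) u"
    by (auto simp: dterm_def)
  from u have "dterm \<alpha>s \<tau> (\<lambda>as. subst_tm ((!) (K as)) u)"
  proof induction
    case (wtm_Var i)
    then show ?case using dtup_nth[OF assms(2)] by simp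
  next
    case (wtm_closed t \<sigma>)
    then show ?case by (simp add: subst_tm_closed dterm_closed)
  qed (auto intro: dterm_App)
  then show ?thesis
    using dterm_cong[of \<tau> \<tau> \<alpha>s "\<lambda>as. f (K as)"] f dtup_length[OF assms(2)] by auto
qed

lemma dtup_comp:
  assumes "dtup \<beta>s \<gamma>s F" "dtup \<alpha>s \<beta>s K"
  shows "dtup \<alpha>s \<gamma>s (\<lambda>as. F (K as))"
  unfolding dtup_def
  using dterm_comp[OF dtup_nth[OF assms(1)] assms(2)] dtup_length[OF assms(1)] dtup_length[OF assms(2)]
  by simp

lemma dtup_id: "set \<alpha>s \<subseteq> wit_types W \<Longrightarrow> dtup \<alpha>s \<alpha>s (\<lambda>as. as)"
  unfolding dtup_def by (auto intro!: dterm_nth)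

lemma dtup_Nil: "dtup \<alpha>s [] (\<lambda>as. [])"
  by (simp add: dtup_def)

lemma dtup_append:
  assumes "dtup \<alpha>s \<beta>s F" "dtup \<alpha>s \<gamma>s K"
  shows "dtup \<alpha>s (\<beta>s @ \<gamma>s) (\<lambda>as. F as @ K as)"
  unfolding dtup_def
proof (intro conjI allI impI)
  show "length (F as @ K as) = length (\<beta>s @ \<gamma>s)" if "length as = length \<alpha>s" for as
    using that assms by (simp add: dtup_length)
  show "dterm \<alpha>s ((\<beta>s @ \<gamma>s) ! i) (\<lambda>as. (F as @ K as) ! i)" if "i < length (\<beta>s @ \<gamma>s)" for i
  proof (cases "i < length \<beta>s")
    case True
    then show ?thesis
      using dtup_nth[OF assms(1) True] dtup_length[OF assms(1)]
      by (simp add: nth_append cong: dterm_cong)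
  next
    case False
    then show ?thesis
      using dtup_nth[OF assms(2), of "i - length \<beta>s"] that dtup_length[OF assms(1)]
      by (simp add: nth_append cong: dterm_cong)
  qed
qed

lemma dtup_take:
  assumes "dtup \<alpha>s (\<beta>s @ \<gamma>s) F"
  shows "dtup \<alpha>s \<beta>s (\<lambda>as. take (length \<beta>s) (F as))"
  unfolding dtup_def
proof (intro conjI allI impI)
  show "length (take (length \<beta>s) (F as)) = length \<beta>s" if "length as = length \<alpha>s" for as
    using dtup_length[OF assms that] by simp
  show "dterm \<alpha>s (\<beta>s ! i) (\<lambda>as. take (length \<beta>s) (F as) ! i)" if "i < length \<beta>s" for i
    using that dtup_nth[OF assms, of i] by (simp add: nth_append)
qed

lemma dtup_drop: 
  assumes "dtup \<alpha>s (\<beta>s @ \<gamma>s) F"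
  shows "dtup \<alpha>s \<gamma>s (\<lambda>as. drop (length \<beta>s) (F as))"
  unfolding dtup_def
proof (intro conjI allI impI)
  show "length (drop (length \<beta>s) (F as)) = length \<gamma>s" if "length as = length \<alpha>s" for as
    using dtup_length[OF assms that] by simp
  show "dterm \<alpha>s (\<gamma>s ! i) (\<lambda>as. drop (length \<beta>s) (F as) ! i)" if "i < length \<gamma>s" for i
    using that dtup_nth[OF assms, of "length \<beta>s + i"] dtup_length[OF assms]
    by (simp cong: dterm_cong)
qed

lemma dterm_apps:
  assumes "dtup \<alpha>s \<gamma>s K" "dterm \<alpha>s (arrows \<gamma>s \<tau>) f"
  shows "dterm \<alpha>s \<tau> (\<lambda>as. apps (f as) (K as))"
  using assms
proof (induction \<gamma>s arbitrary: f K)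
  case Nil
  then show ?case by (simp add: dtup_def cong: dterm_cong)
next
  case (Cons \<gamma> \<gamma>s)
  have "dterm \<alpha>s \<gamma> (\<lambda>as. K as ! 0)"
    using dtup_nth[OF Cons.prems(1), of 0] by simp
  with Cons.prems(2) have "dterm \<alpha>s (arrows \<gamma>s \<tau>) (\<lambda>as. f as \<cdot> (K as ! 0))"
    by (auto intro: dterm_App)
  moreover have "dtup \<alpha>s \<gamma>s (\<lambda>as. drop (length [\<gamma>]) (K as))"
    by (rule dtup_drop) (use Cons.prems in simp)
  ultimately have "dterm \<alpha>s \<tau> (\<lambda>as. apps (f as \<cdot> (K as ! 0)) (drop (length [\<gamma>]) (K as)))"
    by (rule Cons.IH[rotated])
  moreover have "apps (f as \<cdot> (K as ! 0)) (drop (length [\<gamma>]) (K as)) = apps (f as) (K as)"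
    if "length as = length \<alpha>s" for as
    using dtup_length[OF Cons.prems(1) that] by (cases "K as") (auto simp: apps_Cons)
  ultimately show ?case
    by (simp cong: dterm_cong)
qed

lemma dtup_apps:
  assumes "dtup \<alpha>s (map (\<lambda>\<beta>. arrows \<gamma>s (F \<beta>)) \<beta>s) H" "dtup \<alpha>s \<gamma>s K"
  shows "dtup \<alpha>s (map F \<beta>s) (\<lambda>as. map (\<lambda>h. apps h (K as)) (H as))"
  unfolding dtup_def
proof (intro conjI allI impI)
  show "length (map (\<lambda>h. apps h (K as)) (H as)) = length (map F \<beta>s)" if "length as = length \<alpha>s" for as
    using dtup_length[OF assms(1) that] by simp
  show "dterm \<alpha>s (map F \<beta>s ! i) (\<lambda>as. map (\<lambda>h. apps h (K as)) (H as) ! i)"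
    if "i < length (map F \<beta>s)" for i
    using that dterm_apps[OF assms(2), of "F (\<beta>s ! i)" "\<lambda>as. H as ! i"] dtup_nth[OF assms(1), of i]
      dtup_length[OF assms(1)]
    by (simp cong: dterm_cong)
qed

lemma dtup_choice:
  assumes "\<And>i. i < length \<beta>s \<Longrightarrow> \<exists>f. dterm \<alpha>s (\<beta>s ! i) f \<and> P i f"
  shows "\<exists>F. dtup \<alpha>s \<beta>s F \<and> (\<forall>i < length \<beta>s. P i (\<lambda>as. F as ! i))"
proof -
  from assms obtain f where f: "\<And>i. i < length \<beta>s \<Longrightarrow> dterm \<alpha>s (\<beta>s ! i) (f i) \<and> P i (f i)"
    by metis
  let ?F = "\<lambda>as. map (\<lambda>i. f i as) [0..<length \<beta>s]"
  have "(\<lambda>as. ?F as ! i) = f i" if "i < length \<beta>s" for i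
    using that by auto
  with f show ?thesis
    by (intro exI[of _ ?F]) (simp add: dtup_def)
qed

text \<open>From \<open>Elem\<close> at ground types, constant functions by \<open>PiC\<close> and
  singletons at \<open>Fin\<close>. These terms fill all components whose value is irrelevant, as in
  weakening and in the rule for \<open>Bot\<close>.\<close>

lemma closed_inhabitant: "\<sigma> \<in> wit_types W \<Longrightarrow> \<exists>t. has_type T [] t \<sigma>"
proof (induction rule: wit_types.induct)
  case (1 g)
  then have "has_type T [] (Const (Elem g)) (Ground g)"
    using target by (intro has_type_Const) (auto simp: target_theory_def)
  then show ?case by blast
next
  case (2 \<sigma> \<tau>)
  then show ?case using has_type.intros(3) Pi_type by blast
next
  case (3 \<sigma>)
  then show ?case using has_type.intros(3) Singleton_type by blast
qed

lemma ex_dtup: "set \<beta>s \<subseteq> wit_types W \<Longrightarrow> \<exists>F. dtup \<alpha>s \<beta>s F"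
  using dtup_choice[of \<beta>s \<alpha>s "\<lambda>_ _. True"] closed_inhabitant dterm_closed
  by (metis nth_mem subset_iff)

section \<open>Bracket abstraction\<close>

text \<open>By induction on the defining term: K for closed terms and for the remaining variables, S
  K K for the abstracted variable, S for applications. The combinator equations are those of
  \<open>T\<close>, so the result is an equation forced at every world.\<close>

lemma dterm_lam_1:
  assumes "dterm (\<alpha>s @ [\<gamma>]) \<tau> f" "\<gamma> \<in> wit_types W"
  shows "\<exists>q. dterm \<alpha>s (\<gamma> \<rightharpoonup> \<tau>) q \<and> (\<forall>w as g. world w \<longrightarrow> typeds w as \<alpha>s \<longrightarrow> typed w g \<gamma> \<longrightarrow>
    w \<Vdash> Eq \<tau> (q as \<cdot> g) (f (as @ [g])))"
proof -
  from assms(1) obtain u where u: "wtm (\<alpha>s @ [\<gamma>]) u \<tau>"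
    and f: "\<And>as. length as = length (\<alpha>s @ [\<gamma>]) \<Longrightarrow> f as = subst_tm ((!) as) u"
    by (auto simp: dterm_def)
  from u have "\<exists>q. dterm \<alpha>s (\<gamma> \<rightharpoonup> \<tau>) q \<and> (\<forall>w as g. world w \<longrightarrow> typeds w as \<alpha>s \<longrightarrow> typed w g \<gamma> \<longrightarrow>
    w \<Vdash> Eq \<tau> (q as \<cdot> g) (subst_tm ((!) (as @ [g])) u))"
  proof induction
    case (wtm_Var i)
    show ?case
    proof (cases "i < length \<alpha>s")
      case True
      then have wit: "\<alpha>s ! i \<in> wit_types W" using wtm_Var by (simp add: nth_append)
      have "dterm \<alpha>s (\<gamma> \<rightharpoonup> \<alpha>s ! i) (\<lambda>as. Const (PiC (\<alpha>s ! i) \<gamma>) \<cdot> (as ! i))"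
        using wit True assms(2) by (intro dterm_App[OF dterm_closed]) (auto intro: dterm_nth Pi_type)
      moreover have "w \<Vdash> Eq (\<alpha>s ! i) (Const (PiC (\<alpha>s ! i) \<gamma>) \<cdot> (as ! i) \<cdot> g) ((as @ [g]) ! i)"
        if "world w" "typeds w as \<alpha>s" "typed w g \<gamma>" for w as g
        using forces_Pi[OF that(1) wit assms(2) _ that(3), of "as ! i"] that(2) True
        by (simp add: nth_append list_all2_conv_all_nth)
      moreover have "(\<alpha>s @ [\<gamma>]) ! i = \<alpha>s ! i" using True by (simp add: nth_append)
      ultimately show ?thesis unfolding subst_tm.simps by (simp only:) blast
    next
      case False
      then have i: "i = length \<alpha>s" using wtm_Var by simp
      \<comment> \<open>The identity S K K. The two K differ in type: \<open>?K'\<close> has to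
        discard \<open>?K \<cdot> g\<close>, which is of type
        \<open>\<gamma> \<rightharpoonup> \<gamma>\<close>.\<close>
      let ?K = "Const (PiC \<gamma> \<gamma>)" and ?K' = "Const (PiC \<gamma> (\<gamma> \<rightharpoonup> \<gamma>))" and ?S = "Const (SigmaC \<gamma> (\<gamma> \<rightharpoonup> \<gamma>) \<gamma>)"
      have K: "has_type T \<Delta> ?K (\<gamma> \<rightharpoonup> \<gamma> \<rightharpoonup> \<gamma>)" and K': "has_type T \<Delta> ?K' (\<gamma> \<rightharpoonup> (\<gamma> \<rightharpoonup> \<gamma>) \<rightharpoonup> \<gamma>)"
        and S: "has_type T \<Delta> ?S ((\<gamma> \<rightharpoonup> (\<gamma> \<rightharpoonup> \<gamma>) \<rightharpoonup> \<gamma>) \<rightharpoonup> (\<gamma> \<rightharpoonup> \<gamma> \<rightharpoonup> \<gamma>) \<rightharpoonup> \<gamma> \<rightharpoonup> \<gamma>)" for \<Delta>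
        using assms(2) by (simp_all add: Pi_type Sigma_type)
      have "dterm \<alpha>s (\<gamma> \<rightharpoonup> \<gamma>) (\<lambda>as. ?S \<cdot> ?K' \<cdot> ?K)"
        using assms(2) by (intro dterm_closed has_type.intros(3)[OF has_type.intros(3)[OF S K'] K]) auto
      moreover have "w \<Vdash> Eq \<gamma> (?S \<cdot> ?K' \<cdot> ?K \<cdot> g) ((as @ [g]) ! i)"
        if "world w" "typeds w as \<alpha>s" "typed w g \<gamma>" for w as g
      proof -
        have "w \<Vdash> Eq \<gamma> (?S \<cdot> ?K' \<cdot> ?K \<cdot> g) (?K' \<cdot> g \<cdot> (?K \<cdot> g))"
          using that assms(2) K K' by (intro forces_Sigma) auto
        moreover have "w \<Vdash> Eq \<gamma> (?K' \<cdot> g \<cdot> (?K \<cdot> g)) g"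
          using that assms(2) has_type.intros(3)[OF K that(3)] by (intro forces_Pi) auto
        ultimately have "w \<Vdash> Eq \<gamma> (?S \<cdot> ?K' \<cdot> ?K \<cdot> g) g"
          by (rule eq_trans)
        then show ?thesis
          using i list_all2_lengthD[OF that(2)] by (simp add: nth_append)
      qed
      moreover have "(\<alpha>s @ [\<gamma>]) ! i = \<gamma>" using i by simp
      ultimately show ?thesis unfolding subst_tm.simps by (simp only:) blast
    qed
  next
    case (wtm_closed t \<sigma>)
    have "dterm \<alpha>s (\<gamma> \<rightharpoonup> \<sigma>) (\<lambda>as. Const (PiC \<sigma> \<gamma>) \<cdot> t)"
      using wtm_closed assms(2) by (intro dterm_App[OF dterm_closed dterm_closed]) (auto intro: Pi_type)
    moreover have "w \<Vdash> Eq \<sigma> (Const (PiC \<sigma> \<gamma>) \<cdot> t \<cdot> g) t" if "world w" "typed w g \<gamma>" for w g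
      using that wtm_closed assms(2) has_type_append[of T "[]" t \<sigma> "ctx w"] by (intro forces_Pi) auto
    ultimately show ?case using subst_tm_closed[OF wtm_closed(1)] by auto
  next
    case (wtm_App t \<sigma> \<tau> u)
    then obtain q r where q: "dterm \<alpha>s (\<gamma> \<rightharpoonup> \<sigma> \<rightharpoonup> \<tau>) q" and r: "dterm \<alpha>s (\<gamma> \<rightharpoonup> \<sigma>) r"
      and eq: "\<And>w as g. world w \<Longrightarrow> typeds w as \<alpha>s \<Longrightarrow> typed w g \<gamma> \<Longrightarrow>
        w \<Vdash> Eq (\<sigma> \<rightharpoonup> \<tau>) (q as \<cdot> g) (subst_tm ((!) (as @ [g])) t)"
        "\<And>w as g. world w \<Longrightarrow> typeds w as \<alpha>s \<Longrightarrow> typed w g \<gamma> \<Longrightarrow>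
        w \<Vdash> Eq \<sigma> (r as \<cdot> g) (subst_tm ((!) (as @ [g])) u)"
      by blast
    have wit: "\<sigma> \<in> wit_types W" "\<tau> \<in> wit_types W"
      using dterm_wit[OF q] by auto
    let ?q = "\<lambda>as. Const (SigmaC \<gamma> \<sigma> \<tau>) \<cdot> q as \<cdot> r as"
    have "dterm \<alpha>s (\<gamma> \<rightharpoonup> \<tau>) ?q"
      using wit assms(2)
      by (intro dterm_App[OF dterm_App[OF dterm_closed[OF Sigma_type] q] r]) auto
    moreover have "w \<Vdash> Eq \<tau> (?q as \<cdot> g) (subst_tm ((!) (as @ [g])) (t \<cdot> u))"
      if "world w" "typeds w as \<alpha>s" "typed w g \<gamma>" for w as g
    proof -
      have "w \<Vdash> Eq \<tau> (?q as \<cdot> g) (q as \<cdot> g \<cdot> (r as \<cdot> g))"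
        using that wit assms(2) dterm_typed[OF q that(2)] dterm_typed[OF r that(2)]
        by (intro forces_Sigma) auto
      also have "w \<Vdash> Eq \<tau> (q as \<cdot> g \<cdot> (r as \<cdot> g)) (subst_tm ((!) (as @ [g])) (t \<cdot> u))"
        unfolding subst_tm.simps using eq that by (intro eq_App) auto
      finally show ?thesis .
    qed
    ultimately show ?case by blast
  qed
  then show ?thesis
    using f by (auto simp: list_all2_conv_all_nth)
qed

lemma eq_apps:
  "w \<Vdash> Eq (arrows \<sigma>s \<tau>) h h' \<Longrightarrow> typeds w ts \<sigma>s \<Longrightarrow> w \<Vdash> Eq \<tau> (apps h ts) (apps h' ts)"
proof (induction \<sigma>s arbitrary: h h' ts)
  case (Cons \<sigma> \<sigma>s)
  from Cons.prems(2) obtain t ts' where ts: "ts = t # ts'" by (cases ts) auto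
  have "w \<Vdash> Eq (arrows \<sigma>s \<tau>) (h \<cdot> t) (h' \<cdot> t)"
    using Cons.prems forces_wf(1)[OF Cons.prems(1)]
    by (intro eq_App[of w \<sigma>]) (auto simp: ts intro: eq_refl)
  from Cons.IH[OF this] Cons.prems show ?case by (auto simp: ts apps_Cons)
qed simp

text \<open>The last arguments are abstracted first: the induction hypothesis treats
  \<open>\<gamma>\<close> as one more fixed argument, which is abstracted at the end and so becomes
  the outermost.\<close>

lemma dterm_lam:
  assumes "dterm (\<alpha>s @ \<gamma>s) \<tau> f" "set \<gamma>s \<subseteq> wit_types W"
  shows "\<exists>q. dterm \<alpha>s (arrows \<gamma>s \<tau>) q \<and> (\<forall>w as gs. world w \<longrightarrow> typeds w as \<alpha>s \<longrightarrow> typeds w gs \<gamma>s \<longrightarrow>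
    w \<Vdash> Eq \<tau> (apps (q as) gs) (f (as @ gs)))"
  using assms
proof (induction \<gamma>s arbitrary: \<alpha>s)
  case Nil
  then show ?case
    by (intro exI[of _ f]) (auto intro: eq_refl dterm_typed)
next
  case (Cons \<gamma> \<gamma>s)
  obtain q where q: "dterm (\<alpha>s @ [\<gamma>]) (arrows \<gamma>s \<tau>) q"
    and q_eq: "\<And>w as gs. world w \<Longrightarrow> typeds w as (\<alpha>s @ [\<gamma>]) \<Longrightarrow> typeds w gs \<gamma>s \<Longrightarrow>
      w \<Vdash> Eq \<tau> (apps (q as) gs) (f (as @ gs))"
    using Cons.IH[of "\<alpha>s @ [\<gamma>]"] Cons.prems by auto
  obtain r where r: "dterm \<alpha>s (\<gamma> \<rightharpoonup> arrows \<gamma>s \<tau>) r"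
    and r_eq: "\<And>w as g. world w \<Longrightarrow> typeds w as \<alpha>s \<Longrightarrow> typed w g \<gamma> \<Longrightarrow>
      w \<Vdash> Eq (arrows \<gamma>s \<tau>) (r as \<cdot> g) (q (as @ [g]))"
    using dterm_lam_1[OF q] Cons.prems(2) by auto
  have "w \<Vdash> Eq \<tau> (apps (r as) gs) (f (as @ gs))"
    if "world w" "typeds w as \<alpha>s" "typeds w gs (\<gamma> # \<gamma>s)" for w as gs
  proof -
    from that(3) obtain g gs' where gs: "gs = g # gs'" "typed w g \<gamma>" "typeds w gs' \<gamma>s"
      by (cases gs) auto
    have "w \<Vdash> Eq \<tau> (apps (r as \<cdot> g) gs') (apps (q (as @ [g])) gs')"
      by (rule eq_apps[OF r_eq]) (use that gs in auto)
    also have "w \<Vdash> Eq \<tau> (apps (q (as @ [g])) gs') (f ((as @ [g]) @ gs'))"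
      by (rule q_eq) (use that gs in \<open>auto intro: list_all2_appendI\<close>)
    finally show ?thesis by (simp add: gs apps_Cons)
  qed
  with r show ?case by auto
qed

lemma dtup_lam:
  assumes "dtup (\<alpha>s @ \<gamma>s) \<beta>s F" "set \<gamma>s \<subseteq> wit_types W"
  shows "\<exists>Q. dtup \<alpha>s (map (arrows \<gamma>s) \<beta>s) Q \<and> (\<forall>w as gs. world w \<longrightarrow> typeds w as \<alpha>s \<longrightarrow>
    typeds w gs \<gamma>s \<longrightarrow> eqs w \<beta>s (map (\<lambda>h. apps h gs) (Q as)) (F (as @ gs)))"
proof -
  have "\<exists>Q. dtup \<alpha>s (map (arrows \<gamma>s) \<beta>s) Q \<and> (\<forall>i < length (map (arrows \<gamma>s) \<beta>s). \<forall>w as gs. world w \<longrightarrow>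
      typeds w as \<alpha>s \<longrightarrow> typeds w gs \<gamma>s \<longrightarrow>
      w \<Vdash> Eq (\<beta>s ! i) (apps (Q as ! i) gs) (F (as @ gs) ! i))"
    using dterm_lam[OF dtup_nth[OF assms(1)] assms(2)]
    by (intro dtup_choice[where P = "\<lambda>i q. \<forall>w as gs. world w \<longrightarrow>
      typeds w as \<alpha>s \<longrightarrow> typeds w gs \<gamma>s \<longrightarrow> w \<Vdash> Eq (\<beta>s ! i) (apps (q as) gs) (F (as @ gs) ! i)"]) simp
  then obtain Q where Q: "dtup \<alpha>s (map (arrows \<gamma>s) \<beta>s) Q"
    and eq: "\<And>i w as gs. i < length \<beta>s \<Longrightarrow> world w \<Longrightarrow> typeds w as \<alpha>s \<Longrightarrow> typeds w gs \<gamma>s \<Longrightarrow>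
      w \<Vdash> Eq (\<beta>s ! i) (apps (Q as ! i) gs) (F (as @ gs) ! i)"
    by auto
  have "eqs w \<beta>s (map (\<lambda>h. apps h gs) (Q as)) (F (as @ gs))"
    if "world w" "typeds w as \<alpha>s" "typeds w gs \<gamma>s" for w as gs
    using eq[OF _ that] dtup_length[OF Q list_all2_lengthD[OF that(2)]]
      dtup_length[OF assms(1), of "as @ gs"] that(2,3)[THEN list_all2_lengthD]
    by (simp add: eqs_def)
  with Q show ?thesis by blast
qed

section \<open>Finite bounds: singletons, unions and inclusion\<close>

definition singletons :: "'g ty list \<Rightarrow> ('g, 'c) tm list \<Rightarrow> ('g, 'c) tm list" where
  "singletons \<beta>s ts = map (\<lambda>i. Const (Singleton (\<beta>s ! i)) \<cdot> (ts ! i)) [0..<length \<beta>s]"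

definition unions :: "'g ty list \<Rightarrow> ('g, 'c) tm list \<Rightarrow> ('g, 'c) tm list \<Rightarrow> ('g, 'c) tm list" where
  "unions \<beta>s As Bs = map (\<lambda>i. Const (BinUnion (\<beta>s ! i)) \<cdot> (As ! i) \<cdot> (Bs ! i)) [0..<length \<beta>s]"

lemma dtup_singletons:
  assumes "dtup \<alpha>s \<beta>s F"
  shows "dtup \<alpha>s (map Fin \<beta>s) (\<lambda>as. singletons \<beta>s (F as))"
  unfolding dtup_def singletons_def using dtup_wit[OF assms]
  by (auto simp: subset_iff intro!: dterm_App[OF dterm_closed dtup_nth[OF assms]] Singleton_type)

lemma dtup_unions:
  assumes "dtup \<alpha>s (map Fin \<beta>s) F" "dtup \<alpha>s (map Fin \<beta>s) H"
  shows "dtup \<alpha>s (map Fin \<beta>s) (\<lambda>as. unions \<beta>s (F as) (H as))"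
  unfolding dtup_def unions_def
proof (intro conjI allI impI)
  fix i assume i: "i < length (map Fin \<beta>s)"
  with dterm_wit[OF dtup_nth[OF assms(1) i]] have wit: "\<beta>s ! i \<in> wit_types W" by simp
  have "dterm \<alpha>s (Fin (\<beta>s ! i)) (\<lambda>as. Const (BinUnion (\<beta>s ! i)) \<cdot> (F as ! i) \<cdot> (H as ! i))"
    by (rule dterm_App[OF dterm_App[OF dterm_closed[OF BinUnion_type]]])
      (use wit i dtup_nth[OF assms(1) i] dtup_nth[OF assms(2) i] in auto)
  then show "dterm \<alpha>s (map Fin \<beta>s ! i)
      (\<lambda>as. map (\<lambda>i. Const (BinUnion (\<beta>s ! i)) \<cdot> (F as ! i) \<cdot> (H as ! i)) [0..<length \<beta>s] ! i)"
    using i by simp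
qed simp

lemma members_singletons:
  "world w \<Longrightarrow> set \<beta>s \<subseteq> wit_types W \<Longrightarrow> typeds w bs \<beta>s \<Longrightarrow> members w \<beta>s bs (singletons \<beta>s bs)"
  by (auto simp: members_def singletons_def list_all2_conv_all_nth subset_iff intro!: forces_Singleton)

text \<open>Inclusion expressed by forced membership in all extensions: it persists, it transports
  \<open>members\<close>, and it does not appeal to extensionality of sets in
  \<open>T\<close>.\<close>

definition included ::
  "('g, 'c, ('g, 'q) trel) world \<Rightarrow> 'g ty list \<Rightarrow> ('g, 'c) tm list \<Rightarrow> ('g, 'c) tm list \<Rightarrow> bool" where
  "included w \<beta>s As Bs \<longleftrightarrow> (\<forall>i < length \<beta>s. \<forall>w' b. w \<preceq> w' \<longrightarrow> typed w' b (\<beta>s ! i) \<longrightarrow>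
    w' \<Vdash> Member (\<beta>s ! i) b (As ! i) \<longrightarrow> w' \<Vdash> Member (\<beta>s ! i) b (Bs ! i))"

lemma included_trans: "included w \<beta>s As Bs \<Longrightarrow> included w \<beta>s Bs Cs \<Longrightarrow> included w \<beta>s As Cs"
  by (simp add: included_def)

lemma included_members:
  "included w \<beta>s As Bs \<Longrightarrow> w \<preceq> w' \<Longrightarrow> typeds w' bs \<beta>s \<Longrightarrow> members w' \<beta>s bs As \<Longrightarrow> members w' \<beta>s bs Bs"
  by (auto simp: included_def members_def list_all2_conv_all_nth)

lemma included_unions:
  assumes "set \<beta>s \<subseteq> wit_types W" "typeds w As (map Fin \<beta>s)" "typeds w Bs (map Fin \<beta>s)"
  shows "included w \<beta>s As (unions \<beta>s As Bs)" "included w \<beta>s Bs (unions \<beta>s As Bs)"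
proof -
  have "w' \<Vdash> Member (\<beta>s ! i) b (unions \<beta>s As Bs ! i)"
    if "i < length \<beta>s" "w \<preceq> w'" "typed w' b (\<beta>s ! i)"
      "w' \<Vdash> Member (\<beta>s ! i) b (As ! i) \<or> w' \<Vdash> Member (\<beta>s ! i) b (Bs ! i)" for w' i b
  proof -
    have "w' \<Vdash> Member (\<beta>s ! i) b (Const (BinUnion (\<beta>s ! i)) \<cdot> (As ! i) \<cdot> (Bs ! i))"
      using that assms(1) typeds_mono[OF assms(2) that(2)] typeds_mono[OF assms(3) that(2)]
      by (intro forces_BinUnion extendsD(2)[OF that(2)]) (auto simp: list_all2_conv_all_nth)
    then show ?thesis using that(1) by (simp add: unions_def)
  qed
  then show "included w \<beta>s As (unions \<beta>s As Bs)" "included w \<beta>s Bs (unions \<beta>s As Bs)"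
    by (auto simp: included_def)
qed

text \<open>Using a premise once for each \<open>gs\<close> in \<open>C as\<close> makes the demands
  \<open>F (as @ gs)\<close> on a hypothesis; they are collected in one bound that no longer
  mentions \<open>gs\<close>. This serves cut, existential introduction and implication on the
  left.\<close>

lemma ex_big_union:
  assumes "dtup \<alpha>s (map Fin \<gamma>s) C" "dtup (\<alpha>s @ \<gamma>s) (map Fin \<beta>s) F" "set \<alpha>s \<subseteq> wit_types W"
  shows "\<exists>U. dtup \<alpha>s (map Fin \<beta>s) U \<and> (\<forall>w as gs. world w \<longrightarrow> typeds w as \<alpha>s \<longrightarrow> typeds w gs \<gamma>s \<longrightarrow>
    members w \<gamma>s gs (C as) \<longrightarrow> included w \<beta>s (F (as @ gs)) (U as))"
  using assms
proof (induction \<gamma>s arbitrary: \<alpha>s C)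
  case Nil
  then show ?case by (intro exI[of _ F]) (auto simp: included_def)
next
  case (Cons \<gamma> \<gamma>s)
  have \<gamma>: "\<gamma> \<in> wit_types W" and \<beta>s: "set \<beta>s \<subseteq> wit_types W"
    using dtup_wit[OF Cons.prems(1)] dtup_wit[OF Cons.prems(2)] by auto
  have \<alpha>s: "set (\<alpha>s @ [\<gamma>]) \<subseteq> wit_types W"
    using Cons.prems(3) \<gamma> by simp
  have "dtup \<alpha>s (map Fin \<gamma>s) (\<lambda>as. drop (length [Fin \<gamma>]) (C as))"
    by (rule dtup_drop) (use Cons.prems(1) in simp)
  from dtup_comp[OF this dtup_take[OF dtup_id[OF \<alpha>s]]]
  have "dtup (\<alpha>s @ [\<gamma>]) (map Fin \<gamma>s) (\<lambda>as. drop 1 (C (take (length \<alpha>s) as)))"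
    by simp
  \<comment> \<open>The union over the tail of the tuple, with the head as an additional
    parameter.\<close>
  from Cons.IH[OF this _ \<alpha>s] Cons.prems(2) obtain U where U: "dtup (\<alpha>s @ [\<gamma>]) (map Fin \<beta>s) U"
    and incl: "\<And>w as gs. world w \<Longrightarrow> typeds w as (\<alpha>s @ [\<gamma>]) \<Longrightarrow> typeds w gs \<gamma>s \<Longrightarrow>
      members w \<gamma>s gs (drop 1 (C (take (length \<alpha>s) as))) \<Longrightarrow> included w \<beta>s (F (as @ gs)) (U as)"
    by auto
  \<comment> \<open>\<open>IndUnion\<close> takes the indexed family as a term of function type, so
    \<open>U\<close> is abstracted in its last argument.\<close>
  from dtup_lam[OF U] \<gamma> obtain Q where Q: "dtup \<alpha>s (map (arrows [\<gamma>]) (map Fin \<beta>s)) Q"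
    and Q_eq: "\<And>w as g. world w \<Longrightarrow> typeds w as \<alpha>s \<Longrightarrow> typed w g \<gamma> \<Longrightarrow>
      eqs w (map Fin \<beta>s) (map (\<lambda>h. h \<cdot> g) (Q as)) (U (as @ [g]))"
    by (force simp: apps_Cons)
  let ?V = "\<lambda>as. map (\<lambda>i. Const (IndUnion \<gamma> (\<beta>s ! i)) \<cdot> (C as ! 0) \<cdot> (Q as ! i)) [0..<length \<beta>s]"
  have "dtup \<alpha>s (map Fin \<beta>s) ?V"
    unfolding dtup_def
  proof (intro conjI allI impI)
    fix i assume i: "i < length (map Fin \<beta>s)"
    with \<beta>s nth_mem[of i \<beta>s] have wit: "\<beta>s ! i \<in> wit_types W" by auto
    have "dterm \<alpha>s (Fin (\<beta>s ! i)) (\<lambda>as. Const (IndUnion \<gamma> (\<beta>s ! i)) \<cdot> (C as ! 0) \<cdot> (Q as ! i))"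
      by (rule dterm_App[OF dterm_App[OF dterm_closed[OF IndUnion_type]]])
        (use wit i \<gamma> dtup_nth[OF Q, of i] dtup_nth[OF Cons.prems(1), of 0] in auto)
    then show "dterm \<alpha>s (map Fin \<beta>s ! i) (\<lambda>as. ?V as ! i)"
      using i by simp
  qed simp
  moreover have "included w \<beta>s (F (as @ gs)) (?V as)"
    if *: "world w" "typeds w as \<alpha>s" "typeds w gs (\<gamma> # \<gamma>s)" "members w (\<gamma> # \<gamma>s) gs (C as)" for w as gs
  proof -
    from *(3) obtain g gs' where gs: "gs = g # gs'" "typed w g \<gamma>" "typeds w gs' \<gamma>s"
      by (cases gs) auto
    have C: "typeds w (C as) (map Fin (\<gamma> # \<gamma>s))"
      using dtup_typed[OF Cons.prems(1) *(2)] .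
    then obtain c cs where cs: "C as = c # cs" "typed w c (Fin \<gamma>)"
      by (cases "C as") auto
    have as: "take (length \<alpha>s) (as @ [g]) = as"
      using list_all2_lengthD[OF *(2)] by simp
    have "included w \<beta>s (F ((as @ [g]) @ gs')) (U (as @ [g]))"
      by (rule incl, unfold as) (use * gs cs in \<open>auto intro: list_all2_appendI\<close>)
    then have "included w \<beta>s (F (as @ gs)) (U (as @ [g]))"
      by (simp add: gs)
    moreover have "included w \<beta>s (U (as @ [g])) (?V as)"
      unfolding included_def
    proof (intro allI impI)
      fix i w' b
      assume i: "i < length \<beta>s" and w': "w \<preceq> w'" and b: "typed w' b (\<beta>s ! i)"
        and mem: "w' \<Vdash> Member (\<beta>s ! i) b (U (as @ [g]) ! i)"
      have wit: "\<beta>s ! i \<in> wit_types W"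
        using i \<beta>s by auto
      have "w \<Vdash> Eq (map Fin \<beta>s ! i) (U (as @ [g]) ! i) (map (\<lambda>h. h \<cdot> g) (Q as) ! i)"
        using eqs_sym[OF Q_eq[OF *(1,2) gs(2)]] i by (simp add: eqs_def del: nth_map)
      then have "w \<Vdash> Eq (Fin (\<beta>s ! i)) (U (as @ [g]) ! i) ((Q as ! i) \<cdot> g)"
        using i dtup_length[OF Q list_all2_lengthD[OF *(2)]] by simp
      from Member_cong[OF forces_mono[OF this w'] wit mem]
      have "w' \<Vdash> Member (\<beta>s ! i) b ((Q as ! i) \<cdot> g)" .
      moreover have "typed w (Q as ! i) (\<gamma> \<rightharpoonup> Fin (\<beta>s ! i))"
        using dtup_typed[OF Q *(2)] i by (auto simp: list_all2_conv_all_nth)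
      moreover have "w \<Vdash> Member \<gamma> g c"
        using *(4) gs cs by simp
      ultimately have "w' \<Vdash> Member (\<beta>s ! i) b (Const (IndUnion \<gamma> (\<beta>s ! i)) \<cdot> c \<cdot> (Q as ! i))"
        using wit \<gamma> b cs gs extendsD(2)[OF w']
        by (intro forces_IndUnion[where u = g]) (auto intro: typed_mono[OF _ w'] forces_mono[OF _ w'])
      then show "w' \<Vdash> Member (\<beta>s ! i) b (?V as ! i)"
        using i cs by simp
    qed
    ultimately show ?thesis by (rule included_trans)
  qed
  ultimately show ?case by blast
qed

section \<open>Interpreted sequents\<close>

abbreviation poss :: "('g, 'c, 'r) fm list \<Rightarrow> 'g ty list" where
  "poss \<Gamma> \<equiv> concat (map (pos I) \<Gamma>)"

abbreviation negs :: "('g, 'c, 'r) fm list \<Rightarrow> 'g ty list" where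
  "negs \<Gamma> \<equiv> concat (map (neg I) \<Gamma>)"

fun bforces_all ::
  "('g, 'c, ('g, 'q) trel) world \<Rightarrow> ('g, 'c, 'r) fm list \<Rightarrow> ('g, 'c) tm list \<Rightarrow> ('g, 'c) tm list \<Rightarrow> bool"
  where
  "bforces_all w [] as Bs \<longleftrightarrow> True"
| "bforces_all w (A # \<Gamma>) as Bs \<longleftrightarrow>
    bforces w A (take (length (pos I A)) as) (take (length (neg I A)) Bs) \<and>
    bforces_all w \<Gamma> (drop (length (pos I A)) as) (drop (length (neg I A)) Bs)"

text \<open>A smaller bound leaves fewer elements to be checked; therefore one bound that includes
  several others serves all of them.\<close>

lemma bforces_included:
  "bforces w A as Bs \<Longrightarrow> included w (neg I A) Cs Bs \<Longrightarrow> bforces w A as Cs"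
  unfolding bforces_def using included_members by blast

lemma bforces_all_mono: "bforces_all w \<Gamma> as Bs \<Longrightarrow> w \<preceq> w' \<Longrightarrow> bforces_all w' \<Gamma> as Bs"
  by (induction \<Gamma> arbitrary: as Bs) (auto intro: bforces_mono)

lemma included_take: "included w (\<beta>s @ \<gamma>s) As Bs \<Longrightarrow> included w \<beta>s (take (length \<beta>s) As) (take (length \<beta>s) Bs)"
proof (unfold included_def, intro allI impI)
  fix i w' b
  assume "\<forall>i<length (\<beta>s @ \<gamma>s). \<forall>w' b. w \<preceq> w' \<longrightarrow> typed w' b ((\<beta>s @ \<gamma>s) ! i) \<longrightarrow>
      w' \<Vdash> Member ((\<beta>s @ \<gamma>s) ! i) b (As ! i) \<longrightarrow> w' \<Vdash> Member ((\<beta>s @ \<gamma>s) ! i) b (Bs ! i)"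
    and "i < length \<beta>s" "w \<preceq> w'" "typed w' b (\<beta>s ! i)" "w' \<Vdash> Member (\<beta>s ! i) b (take (length \<beta>s) As ! i)"
  from this(1)[rule_format, of i w' b] this(2-)
  show "w' \<Vdash> Member (\<beta>s ! i) b (take (length \<beta>s) Bs ! i)"
    by (simp add: nth_append)
qed

lemma included_drop:
  assumes "included w (\<beta>s @ \<gamma>s) As Bs" "length As = length (\<beta>s @ \<gamma>s)" "length Bs = length (\<beta>s @ \<gamma>s)"
  shows "included w \<gamma>s (drop (length \<beta>s) As) (drop (length \<beta>s) Bs)"
  unfolding included_def
proof (intro allI impI)
  fix i w' b
  assume "i < length \<gamma>s" "w \<preceq> w'" "typed w' b (\<gamma>s ! i)" "w' \<Vdash> Member (\<gamma>s ! i) b (drop (length \<beta>s) As ! i)"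
  with assms(1)[unfolded included_def, rule_format, of "length \<beta>s + i" w' b] assms(2,3)
  show "w' \<Vdash> Member (\<gamma>s ! i) b (drop (length \<beta>s) Bs ! i)" by simp
qed

lemma bforces_all_included:
  "bforces_all w \<Gamma> as Bs \<Longrightarrow> included w (negs \<Gamma>) Cs Bs \<Longrightarrow> length Cs = length (negs \<Gamma>) \<Longrightarrow>
    length Bs = length (negs \<Gamma>) \<Longrightarrow> bforces_all w \<Gamma> as Cs"
proof (induction \<Gamma> arbitrary: as Bs Cs)
  case (Cons A \<Gamma>)
  then show ?case
    using included_take[of w "neg I A" "negs \<Gamma>" Cs Bs] included_drop[of w "neg I A" "negs \<Gamma>" Cs Bs]
    by (auto intro: bforces_included)
qed simp

lemma pos_neg_comp [simp]:
  "pos I \<circ> subst \<theta> = pos I" "neg I \<circ> subst \<theta> = neg I" "pos I \<circ> lift n = pos I" "neg I \<circ> lift n = neg I"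
  by auto

lemma ex_dtup_Fin: "set \<beta>s \<subseteq> wit_types W \<Longrightarrow> \<exists>F. dtup \<alpha>s (map Fin \<beta>s) F"
  by (intro ex_dtup) auto

lemma dtup_fst: "set (\<alpha>s @ \<beta>s) \<subseteq> wit_types W \<Longrightarrow> dtup (\<alpha>s @ \<beta>s) \<alpha>s (take (length \<alpha>s))"
  using dtup_take[OF dtup_id[of "\<alpha>s @ \<beta>s"]] by simp

lemma dtup_snd: "set (\<alpha>s @ \<beta>s) \<subseteq> wit_types W \<Longrightarrow> dtup (\<alpha>s @ \<beta>s) \<beta>s (drop (length \<alpha>s))"
  using dtup_drop[OF dtup_id[of "\<alpha>s @ \<beta>s"]] by simp

lemma dtup_lengths: "dtup \<alpha>s \<beta>s F \<Longrightarrow> typeds w as \<alpha>s \<Longrightarrow> length (F as) = length \<beta>s"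
  by (auto dest: list_all2_lengthD dtup_length)

text \<open>The functions \<open>s\<close> and \<open>t\<close> are fixed before the environment
  \<open>\<theta>\<close>, which expresses uniformity in the source variables. The type tuples are
  parameters so that they can be bracketed as \<open>take\<close> and \<open>drop\<close>
  require.\<close>

definition witnesses ::
  "'g ty list \<Rightarrow> ('g, 'c, 'r) fm list \<Rightarrow> ('g, 'c, 'r) fm \<Rightarrow> 'g ty list \<Rightarrow> 'g ty list \<Rightarrow>
    (('g, 'c) tm list \<Rightarrow> ('g, 'c) tm list) \<Rightarrow> (('g, 'c) tm list \<Rightarrow> ('g, 'c) tm list) \<Rightarrow> bool" where
  "witnesses \<Delta> \<Gamma> A \<alpha>s \<beta>s s t \<longleftrightarrow> dtup (\<alpha>s @ neg I A) \<beta>s s \<and> dtup \<alpha>s (pos I A) t \<and>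
    (\<forall>w \<theta> as ds. world w \<longrightarrow> sub w \<Delta> \<theta> \<longrightarrow> typeds w as \<alpha>s \<longrightarrow> typeds w ds (neg I A) \<longrightarrow>
      bforces_all w (map (subst \<theta>) \<Gamma>) as (s (as @ ds)) \<longrightarrow> w \<Vdash> interp I (subst \<theta> A) (t as) ds)"

definition interp_seq :: "'g ty list \<Rightarrow> ('g, 'c, 'r) fm list \<Rightarrow> ('g, 'c, 'r) fm \<Rightarrow> bool" where
  "interp_seq \<Delta> \<Gamma> A \<longleftrightarrow> (\<exists>s t. witnesses \<Delta> \<Gamma> A (poss \<Gamma>) (map Fin (negs \<Gamma>)) s t)"

lemma witnessesD:
  assumes "witnesses \<Delta> \<Gamma> A \<alpha>s \<beta>s s t"
  shows "dtup (\<alpha>s @ neg I A) \<beta>s s" "dtup \<alpha>s (pos I A) t"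
    and "\<And>w \<theta> as ds. world w \<Longrightarrow> sub w \<Delta> \<theta> \<Longrightarrow> typeds w as \<alpha>s \<Longrightarrow> typeds w ds (neg I A) \<Longrightarrow>
      bforces_all w (map (subst \<theta>) \<Gamma>) as (s (as @ ds)) \<Longrightarrow> w \<Vdash> interp I (subst \<theta> A) (t as) ds"
  using assms unfolding witnesses_def by blast+

definition wfs :: "'g ty list \<Rightarrow> ('g, 'c, 'r) fm list \<Rightarrow> bool" where
  "wfs \<Delta> \<Gamma> \<longleftrightarrow> (\<forall>A \<in> set \<Gamma>. wf_fm S\<^sub>T \<Delta> A)"

lemma wfs_simps [simp]: "wfs \<Delta> []" "wfs \<Delta> (A # \<Gamma>) \<longleftrightarrow> wf_fm S\<^sub>T \<Delta> A \<and> wfs \<Delta> \<Gamma>"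
  by (simp_all add: wfs_def)

lemma wfs_wit: "wfs \<Delta> \<Gamma> \<Longrightarrow> set (poss \<Gamma>) \<subseteq> wit_types W \<and> set (negs \<Gamma>) \<subseteq> wit_types W"
  by (induction \<Gamma>) (use pos_neg_wit in auto)

lemma interp_seqI:
  assumes "dtup (poss \<Gamma> @ neg I A) (map Fin (negs \<Gamma>)) s" "dtup (poss \<Gamma>) (pos I A) t"
    and "\<And>w \<theta> as ds. world w \<Longrightarrow> sub w \<Delta> \<theta> \<Longrightarrow> typeds w as (poss \<Gamma>) \<Longrightarrow> typeds w ds (neg I A) \<Longrightarrow>
      bforces_all w (map (subst \<theta>) \<Gamma>) as (s (as @ ds)) \<Longrightarrow> w \<Vdash> interp I (subst \<theta> A) (t as) ds"
  shows "interp_seq \<Delta> \<Gamma> A"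
  unfolding interp_seq_def witnesses_def using assms by blast

text \<open>The components of the bounds \<open>F\<close> that do not belong to \<open>B\<close> are irrelevant, so any closed terms
  of the right types will do.\<close>

lemma bounds_for_member:
  assumes "B \<in> set \<Gamma>" "wfs \<Delta> \<Gamma>"
  shows "\<exists>r. dtup (poss \<Gamma>) (pos I B) r \<and> (\<forall>\<alpha>s f. dtup \<alpha>s (map Fin (neg I B)) f \<longrightarrow>
    (\<exists>F. dtup \<alpha>s (map Fin (negs \<Gamma>)) F \<and> (\<forall>w \<theta> as c. typeds w c \<alpha>s \<longrightarrow>
      bforces_all w (map (subst \<theta>) \<Gamma>) as (F c) \<longrightarrow> bforces w (subst \<theta> B) (r as) (f c))))"
  using assms
proof (induction \<Gamma>)
  case (Cons A \<Gamma>)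
  have wit: "set (poss (A # \<Gamma>)) \<subseteq> wit_types W" "set (negs (A # \<Gamma>)) \<subseteq> wit_types W"
    using wfs_wit[OF Cons.prems(2)] by auto
  show ?case
  proof (cases "B = A")
    case True
    show ?thesis
    proof (rule exI[of _ "take (length (pos I A))"], intro conjI allI impI)
      show "dtup (poss (A # \<Gamma>)) (pos I B) (take (length (pos I A)))"
        using dtup_fst[of "pos I A" "poss \<Gamma>"] wit True by simp
      fix \<alpha>s f assume f: "dtup \<alpha>s (map Fin (neg I B)) f"
      obtain e where e: "dtup \<alpha>s (map Fin (negs \<Gamma>)) e"
        using ex_dtup_Fin[of "negs \<Gamma>" \<alpha>s] wit by auto
      show "\<exists>F. dtup \<alpha>s (map Fin (negs (A # \<Gamma>))) F \<and> (\<forall>w \<theta> as c. typeds w c \<alpha>s \<longrightarrow>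
        bforces_all w (map (subst \<theta>) (A # \<Gamma>)) as (F c) \<longrightarrow>
        bforces w (subst \<theta> B) (take (length (pos I A)) as) (f c))"
        using dtup_append[OF f e] dtup_lengths[OF f] True
        by (intro exI[of _ "\<lambda>c. f c @ e c"]) auto
    qed
  next
    case False
    with Cons obtain r where r: "dtup (poss \<Gamma>) (pos I B) r"
      and F: "\<And>\<alpha>s f. dtup \<alpha>s (map Fin (neg I B)) f \<Longrightarrow>
        (\<exists>F. dtup \<alpha>s (map Fin (negs \<Gamma>)) F \<and> (\<forall>w \<theta> as c. typeds w c \<alpha>s \<longrightarrow>
          bforces_all w (map (subst \<theta>) \<Gamma>) as (F c) \<longrightarrow> bforces w (subst \<theta> B) (r as) (f c)))"
      by auto
    show ?thesis
    proof (rule exI[of _ "\<lambda>as. r (drop (length (pos I A)) as)"], intro conjI allI impI)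
      show "dtup (poss (A # \<Gamma>)) (pos I B) (\<lambda>as. r (drop (length (pos I A)) as))"
        using dtup_comp[OF r dtup_snd[of "pos I A" "poss \<Gamma>"]] wit by simp
      fix \<alpha>s f assume f: "dtup \<alpha>s (map Fin (neg I B)) f"
      obtain e where e: "dtup \<alpha>s (map Fin (neg I A)) e"
        using ex_dtup_Fin[of "neg I A" \<alpha>s] wit by auto
      obtain F where F: "dtup \<alpha>s (map Fin (negs \<Gamma>)) F" and
        "\<And>w \<theta> as c. typeds w c \<alpha>s \<Longrightarrow> bforces_all w (map (subst \<theta>) \<Gamma>) as (F c) \<Longrightarrow>
          bforces w (subst \<theta> B) (r as) (f c)"
        using F[OF f] by blast
      then show "\<exists>F. dtup \<alpha>s (map Fin (negs (A # \<Gamma>))) F \<and> (\<forall>w \<theta> as c. typeds w c \<alpha>s \<longrightarrow>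
        bforces_all w (map (subst \<theta>) (A # \<Gamma>)) as (F c) \<longrightarrow>
        bforces w (subst \<theta> B) (r (drop (length (pos I A)) as)) (f c))"
        using dtup_append[OF e F] dtup_lengths[OF e]
        by (intro exI[of _ "\<lambda>c. e c @ F c"]) auto
    qed
  qed
qed simp

lemma ex_union:
  assumes "dtup \<alpha>s (map Fin \<beta>s) F" "dtup \<alpha>s (map Fin \<beta>s) H"
  shows "\<exists>U. dtup \<alpha>s (map Fin \<beta>s) U \<and> (\<forall>w c. typeds w c \<alpha>s \<longrightarrow>
    included w \<beta>s (F c) (U c) \<and> included w \<beta>s (H c) (U c))"
proof (intro exI conjI allI impI)
  show "dtup \<alpha>s (map Fin \<beta>s) (\<lambda>as. unions \<beta>s (F as) (H as))"
    by (rule dtup_unions[OF assms])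
  have wit: "set \<beta>s \<subseteq> wit_types W" using dtup_wit[OF assms(1)] by auto
  fix w c assume c: "typeds w c \<alpha>s"
  show "included w \<beta>s (F c) (unions \<beta>s (F c) (H c))" "included w \<beta>s (H c) (unions \<beta>s (F c) (H c))"
    by (intro included_unions wit dtup_typed[OF assms(1) c] dtup_typed[OF assms(2) c])+
qed

text \<open>Witnesses of hypotheses are passed from \<open>\<Gamma>'\<close> to
  \<open>\<Gamma>\<close>, bounds in the opposite direction. Each formula of \<open>\<Gamma>\<close>
  is charged to its first occurrence in \<open>\<Gamma>'\<close>; where several are charged to the
  same occurrence, as in contraction, the union takes care of all of them.\<close>

lemma bounds_for_subset:
  assumes "set \<Gamma> \<subseteq> set \<Gamma>'" "wfs \<Delta> \<Gamma>'"
  shows "\<exists>r. dtup (poss \<Gamma>') (poss \<Gamma>) r \<and> (\<forall>\<alpha>s f. dtup \<alpha>s (map Fin (negs \<Gamma>)) f \<longrightarrow>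
    (\<exists>F. dtup \<alpha>s (map Fin (negs \<Gamma>')) F \<and> (\<forall>w \<theta> as c. typeds w c \<alpha>s \<longrightarrow> typeds w as (poss \<Gamma>') \<longrightarrow>
      bforces_all w (map (subst \<theta>) \<Gamma>') as (F c) \<longrightarrow> bforces_all w (map (subst \<theta>) \<Gamma>) (r as) (f c))))"
  using assms(1)
proof (induction \<Gamma>)
  case Nil
  have "\<exists>F. dtup \<alpha>s (map Fin (negs \<Gamma>')) F" for \<alpha>s
    using wfs_wit[OF assms(2)] by (intro ex_dtup) auto
  then show ?case by (intro exI[of _ "\<lambda>as. []"]) (auto intro: dtup_Nil)
next
  case (Cons B \<Gamma>)
  obtain r1 where r1: "dtup (poss \<Gamma>') (pos I B) r1"
    and F1: "\<And>\<alpha>s f. dtup \<alpha>s (map Fin (neg I B)) f \<Longrightarrow>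
        (\<exists>F. dtup \<alpha>s (map Fin (negs \<Gamma>')) F \<and> (\<forall>w \<theta> as c. typeds w c \<alpha>s \<longrightarrow>
          bforces_all w (map (subst \<theta>) \<Gamma>') as (F c) \<longrightarrow> bforces w (subst \<theta> B) (r1 as) (f c)))"
    using bounds_for_member[of B \<Gamma>' \<Delta>] Cons.prems assms(2) by auto
  obtain r2 where r2: "dtup (poss \<Gamma>') (poss \<Gamma>) r2"
    and F2: "\<And>\<alpha>s f. dtup \<alpha>s (map Fin (negs \<Gamma>)) f \<Longrightarrow>
        (\<exists>F. dtup \<alpha>s (map Fin (negs \<Gamma>')) F \<and> (\<forall>w \<theta> as c. typeds w c \<alpha>s \<longrightarrow> typeds w as (poss \<Gamma>') \<longrightarrow>
          bforces_all w (map (subst \<theta>) \<Gamma>') as (F c) \<longrightarrow> bforces_all w (map (subst \<theta>) \<Gamma>) (r2 as) (f c)))"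
    using Cons by auto
  show ?case
  proof (rule exI[of _ "\<lambda>as. r1 as @ r2 as"], intro conjI allI impI)
    show "dtup (poss \<Gamma>') (poss (B # \<Gamma>)) (\<lambda>as. r1 as @ r2 as)"
      using dtup_append[OF r1 r2] by simp
    fix \<alpha>s f assume "dtup \<alpha>s (map Fin (negs (B # \<Gamma>))) f"
    then have f: "dtup \<alpha>s (map Fin (neg I B) @ map Fin (negs \<Gamma>)) f" by simp
    obtain H1 where H1: "dtup \<alpha>s (map Fin (negs \<Gamma>')) H1"
      and b1: "\<And>w \<theta> as c. typeds w c \<alpha>s \<Longrightarrow> bforces_all w (map (subst \<theta>) \<Gamma>') as (H1 c) \<Longrightarrow>
        bforces w (subst \<theta> B) (r1 as) (take (length (neg I B)) (f c))"
      using F1[OF dtup_take[OF f]] by auto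
    obtain H2 where H2: "dtup \<alpha>s (map Fin (negs \<Gamma>')) H2"
      and b2: "\<And>w \<theta> as c. typeds w c \<alpha>s \<Longrightarrow> typeds w as (poss \<Gamma>') \<Longrightarrow> bforces_all w (map (subst \<theta>) \<Gamma>') as (H2 c) \<Longrightarrow>
        bforces_all w (map (subst \<theta>) \<Gamma>) (r2 as) (drop (length (neg I B)) (f c))"
      using F2[OF dtup_drop[OF f]] by auto
    obtain U where U: "dtup \<alpha>s (map Fin (negs \<Gamma>')) U"
      and incl: "\<And>w c. typeds w c \<alpha>s \<Longrightarrow> included w (negs \<Gamma>') (H1 c) (U c) \<and> included w (negs \<Gamma>') (H2 c) (U c)"
      using ex_union[OF H1 H2] by blast
    show "\<exists>F. dtup \<alpha>s (map Fin (negs \<Gamma>')) F \<and> (\<forall>w \<theta> as c. typeds w c \<alpha>s \<longrightarrow> typeds w as (poss \<Gamma>') \<longrightarrow>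
      bforces_all w (map (subst \<theta>) \<Gamma>') as (F c) \<longrightarrow>
      bforces_all w (map (subst \<theta>) (B # \<Gamma>)) (r1 as @ r2 as) (f c))"
    proof (intro exI[of _ U] conjI allI impI U)
      fix w \<theta> as c
      assume *: "typeds w c \<alpha>s" "typeds w as (poss \<Gamma>')" "bforces_all w (map (subst \<theta>) \<Gamma>') as (U c)"
      have "bforces_all w (map (subst \<theta>) \<Gamma>') as (H1 c)" "bforces_all w (map (subst \<theta>) \<Gamma>') as (H2 c)"
        by (rule bforces_all_included[OF *(3)];
            use incl[OF *(1)] dtup_lengths[OF H1 *(1)] dtup_lengths[OF H2 *(1)] dtup_lengths[OF U *(1)] in simp)+
      with b1[OF *(1)] b2[OF *(1,2)] dtup_lengths[OF r1 *(2)]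
      show "bforces_all w (map (subst \<theta>) (B # \<Gamma>)) (r1 as @ r2 as) (f c)"
        by simp
    qed
  qed
qed

section \<open>Soundness of the sequent rules\<close>

lemma seq_ident:
  assumes "A \<in> set \<Gamma>" "wfs \<Delta> \<Gamma>"
  shows "interp_seq \<Delta> \<Gamma> A"
proof -
  have wit: "set (poss \<Gamma> @ neg I A) \<subseteq> wit_types W"
    using assms wfs_wit[OF assms(2)] neg_wit[of \<Delta> A] by (auto simp: wfs_def)
  \<comment> \<open>To conclude \<open>\<langle>A\<rangle>\<close> at \<open>ds\<close>, the
    hypothesis \<open>A\<close> is demanded exactly at \<open>ds\<close>: its bound is the
    singleton.\<close>
  let ?f = "\<lambda>c. singletons (neg I A) (drop (length (poss \<Gamma>)) c)"
  have f: "dtup (poss \<Gamma> @ neg I A) (map Fin (neg I A)) ?f"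
    by (rule dtup_singletons[OF dtup_snd[OF wit]])
  from bounds_for_member[OF assms] obtain r F where r: "dtup (poss \<Gamma>) (pos I A) r"
    and F: "dtup (poss \<Gamma> @ neg I A) (map Fin (negs \<Gamma>)) F"
    and b: "\<And>w \<theta> as c. typeds w c (poss \<Gamma> @ neg I A) \<Longrightarrow> bforces_all w (map (subst \<theta>) \<Gamma>) as (F c) \<Longrightarrow>
        bforces w (subst \<theta> A) (r as) (?f c)"
    using f by blast
  show ?thesis
  proof (rule interp_seqI[OF F r])
    fix w \<theta> as ds
    assume *: "world w" "typeds w as (poss \<Gamma>)" "typeds w ds (neg I A)"
      "bforces_all w (map (subst \<theta>) \<Gamma>) as (F (as @ ds))"
    have "bforces w (subst \<theta> A) (r as) (singletons (neg I A) ds)"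
      using b[OF list_all2_appendI[OF *(2,3)] *(4)] list_all2_lengthD[OF *(2)] by simp
    then show "w \<Vdash> interp I (subst \<theta> A) (r as) ds"
      using * wit by (intro bforcesD) (auto intro: members_singletons)
  qed
qed

lemma seq_struct:
  assumes "interp_seq \<Delta> \<Gamma> A" "set \<Gamma> \<subseteq> set \<Gamma>'" "wfs \<Delta> \<Gamma>'" "wf_fm S\<^sub>T \<Delta> A"
  shows "interp_seq \<Delta> \<Gamma>' A"
proof -
  have wit: "set (poss \<Gamma>' @ neg I A) \<subseteq> wit_types W"
    using assms wfs_wit[OF assms(3)] neg_wit[OF assms(4)] by auto
  obtain s t where wit_st: "witnesses \<Delta> \<Gamma> A (poss \<Gamma>) (map Fin (negs \<Gamma>)) s t"
    using assms(1) by (auto simp: interp_seq_def)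
  note s = witnessesD(1)[OF wit_st] and t = witnessesD(2)[OF wit_st] and st = witnessesD(3)[OF wit_st]
  obtain r where r: "dtup (poss \<Gamma>') (poss \<Gamma>) r"
    and F: "\<And>\<alpha>s f. dtup \<alpha>s (map Fin (negs \<Gamma>)) f \<Longrightarrow>
    (\<exists>F. dtup \<alpha>s (map Fin (negs \<Gamma>')) F \<and> (\<forall>w \<theta> as c. typeds w c \<alpha>s \<longrightarrow> typeds w as (poss \<Gamma>') \<longrightarrow>
      bforces_all w (map (subst \<theta>) \<Gamma>') as (F c) \<longrightarrow> bforces_all w (map (subst \<theta>) \<Gamma>) (r as) (f c)))"
    using bounds_for_subset[OF assms(2,3)] by blast
  let ?f = "\<lambda>c. s (r (take (length (poss \<Gamma>')) c) @ drop (length (poss \<Gamma>')) c)"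
  have "dtup (poss \<Gamma>' @ neg I A) (map Fin (negs \<Gamma>)) ?f"
    by (rule dtup_comp[OF s dtup_append[OF dtup_comp[OF r dtup_fst[OF wit]] dtup_snd[OF wit]]])
  then obtain F where F: "dtup (poss \<Gamma>' @ neg I A) (map Fin (negs \<Gamma>')) F"
    and b: "\<And>w \<theta> as c. typeds w c (poss \<Gamma>' @ neg I A) \<Longrightarrow> typeds w as (poss \<Gamma>') \<Longrightarrow>
      bforces_all w (map (subst \<theta>) \<Gamma>') as (F c) \<Longrightarrow> bforces_all w (map (subst \<theta>) \<Gamma>) (r as) (?f c)"
    using F by blast
  show ?thesis
  proof (rule interp_seqI[OF F dtup_comp[OF t r]])
    fix w \<theta> as ds
    assume *: "world w" "sub w \<Delta> \<theta>" "typeds w as (poss \<Gamma>')" "typeds w ds (neg I A)"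
      "bforces_all w (map (subst \<theta>) \<Gamma>') as (F (as @ ds))"
    have "bforces_all w (map (subst \<theta>) \<Gamma>) (r as) (s (r as @ ds))"
      using b[OF list_all2_appendI[OF *(3,4)] *(3,5)] list_all2_lengthD[OF *(3)] by simp
    then show "w \<Vdash> interp I (subst \<theta> A) (t (r as)) ds"
      using * by (intro st dtup_typed[OF r])
  qed
qed

lemma wf_S\<^sub>T_subst: "wf_fm S\<^sub>T \<Delta> A \<Longrightarrow> sub w \<Delta> \<theta> \<Longrightarrow> wf_fm S\<^sub>T (ctx w) (subst \<theta> A)"
  using wf_fm_subst[of S\<^sub>T \<Delta> A \<theta> "ctx w"] by simp

text \<open>The witness of \<open>A\<close> comes from the first premise, the bound on
  \<open>A\<close> from the second. The first premise is then used for every \<open>bs\<close> in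
  this bound, so what it demands of \<open>\<Gamma>\<close> is united over the bound and joined with
  what the second premise demands directly.\<close>

lemma seq_cut:
  assumes "interp_seq \<Delta> \<Gamma> A" "interp_seq \<Delta> (A # \<Gamma>) B" "wfs \<Delta> \<Gamma>" "wf_fm S\<^sub>T \<Delta> A" "wf_fm S\<^sub>T \<Delta> B"
  shows "interp_seq \<Delta> \<Gamma> B"
proof -
  let ?\<alpha>s = "poss \<Gamma> @ neg I B" and ?n = "length (poss \<Gamma>)"
  have wit: "set ?\<alpha>s \<subseteq> wit_types W" "set (?\<alpha>s @ neg I A) \<subseteq> wit_types W"
    using wfs_wit[OF assms(3)] neg_wit[OF assms(4)] neg_wit[OF assms(5)] by auto
  obtain s1 t1 where wit1: "witnesses \<Delta> \<Gamma> A (poss \<Gamma>) (map Fin (negs \<Gamma>)) s1 t1"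
    using assms(1) by (auto simp: interp_seq_def)
  note s1 = witnessesD(1)[OF wit1] and t1 = witnessesD(2)[OF wit1] and 1 = witnessesD(3)[OF wit1]
  obtain s2 t2 where wit2: "witnesses \<Delta> (A # \<Gamma>) B (pos I A @ poss \<Gamma>) (map Fin (neg I A) @ map Fin (negs \<Gamma>)) s2 t2"
    using assms(2) by (auto simp: interp_seq_def)
  note s2 = witnessesD(1)[OF wit2] and t2 = witnessesD(2)[OF wit2] and 2 = witnessesD(3)[OF wit2]
  \<comment> \<open>\<open>?e\<close> lists the demands of the second premise when the cut formula
    has witness \<open>t1\<close>; \<open>?C\<close> is its part for \<open>A\<close>,
    \<open>?H\<close> its part for \<open>\<Gamma>\<close>.\<close>
  let ?e = "\<lambda>c. s2 (t1 (take ?n c) @ c)"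
  let ?C = "\<lambda>c. take (length (neg I A)) (?e c)" and ?H = "\<lambda>c. drop (length (neg I A)) (?e c)"
  \<comment> \<open>The demands of the first premise on \<open>\<Gamma>\<close> in order to yield
    \<open>A\<close> at \<open>bs\<close>; its argument is \<open>as, ds, bs\<close>, of which
    \<open>as\<close> and \<open>bs\<close> are selected.\<close>
  let ?F = "\<lambda>c. s1 (take ?n (take (length ?\<alpha>s) c) @ drop (length ?\<alpha>s) c)"
  have e: "dtup ?\<alpha>s (map Fin (neg I A) @ map Fin (negs \<Gamma>)) ?e"
    using dtup_comp[OF s2[unfolded append_assoc] dtup_append[OF dtup_comp[OF t1 dtup_fst[OF wit(1)]] dtup_id[OF wit(1)]]] .
  have C: "dtup ?\<alpha>s (map Fin (neg I A)) ?C" and H: "dtup ?\<alpha>s (map Fin (negs \<Gamma>)) ?H"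
    using dtup_take[OF e] dtup_drop[OF e] by simp_all
  have F: "dtup (?\<alpha>s @ neg I A) (map Fin (negs \<Gamma>)) ?F"
    using dtup_comp[OF s1 dtup_append[OF dtup_comp[OF dtup_fst[OF wit(1)] dtup_fst[OF wit(2)]] dtup_snd[OF wit(2)]]] .
  obtain U1 where U1: "dtup ?\<alpha>s (map Fin (negs \<Gamma>)) U1"
    and incl1: "\<And>w c bs. world w \<Longrightarrow> typeds w c ?\<alpha>s \<Longrightarrow> typeds w bs (neg I A) \<Longrightarrow>
      members w (neg I A) bs (?C c) \<Longrightarrow> included w (negs \<Gamma>) (?F (c @ bs)) (U1 c)"
    using ex_big_union[OF C F wit(1)] by blast
  obtain U where U: "dtup ?\<alpha>s (map Fin (negs \<Gamma>)) U"
    and incl: "\<And>w c. typeds w c ?\<alpha>s \<Longrightarrow> included w (negs \<Gamma>) (?H c) (U c) \<and> included w (negs \<Gamma>) (U1 c) (U c)"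
    using ex_union[OF H U1] by blast
  show ?thesis
  proof (rule interp_seqI[OF U])
    show "dtup (poss \<Gamma>) (pos I B) (\<lambda>as. t2 (t1 as @ as))"
      using wfs_wit[OF assms(3)] by (intro dtup_comp[OF t2] dtup_append t1 dtup_id) auto
    fix w \<theta> as ds
    assume w: "world w" "sub w \<Delta> \<theta>" and as: "typeds w as (poss \<Gamma>)" and ds: "typeds w ds (neg I B)"
      and hyps: "bforces_all w (map (subst \<theta>) \<Gamma>) as (U (as @ ds))"
    have c: "typeds w (as @ ds) ?\<alpha>s" using as ds by (rule list_all2_appendI)
    note len = list_all2_lengthD[OF as] list_all2_lengthD[OF ds] dtup_lengths[OF t1 as]
      dtup_lengths[OF U c] dtup_lengths[OF H c]
    have "bforces w (subst \<theta> A) (t1 as) (?C (as @ ds))"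
      unfolding bforces_def
    proof (intro allI impI)
      fix w' bs
      assume w': "w \<preceq> w'" "typeds w' bs (neg I (subst \<theta> A))" "members w' (neg I (subst \<theta> A)) bs (?C (as @ ds))"
      have c': "typeds w' (as @ ds) ?\<alpha>s" using c w'(1) by (rule typeds_mono)
      have "included w' (negs \<Gamma>) (?F ((as @ ds) @ bs)) (U (as @ ds))"
        using incl1[OF extendsD(2)[OF w'(1)] c', of bs] w' incl[OF c'] included_trans by auto
      then have *: "included w' (negs \<Gamma>) (s1 (as @ bs)) (U (as @ ds))"
        using len by simp
      show "w' \<Vdash> interp I (subst \<theta> A) (t1 as) bs"
      proof (rule 1)
        have "length (s1 (as @ bs)) = length (map Fin (negs \<Gamma>))"
          using list_all2_appendI[OF typeds_mono[OF as w'(1)]] w' by (intro dtup_lengths[OF s1]) auto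
        then show "bforces_all w' (map (subst \<theta>) \<Gamma>) as (s1 (as @ bs))"
          using * len by (intro bforces_all_included[OF bforces_all_mono[OF hyps w'(1)]]) auto
      qed (use w' w as in \<open>auto intro: typeds_mono sub_mono dest: extendsD\<close>)
    qed
    moreover have "bforces_all w (map (subst \<theta>) \<Gamma>) as (?H (as @ ds))"
      using incl[OF c] len by (intro bforces_all_included[OF hyps]) auto
    ultimately have "bforces_all w (map (subst \<theta>) (A # \<Gamma>)) (t1 as @ as) (s2 ((t1 as @ as) @ ds))"
      using len by simp
    then show "w \<Vdash> interp I (subst \<theta> B) (t2 (t1 as @ as)) ds"
      using w as ds by (intro 2) (auto intro: list_all2_appendI dtup_typed[OF t1])
  qed
qed

lemma seq_var:
  assumes "interp_seq (\<sigma> # \<Delta>) (map (lift (Suc 0)) \<Gamma>) (lift (Suc 0) A)" "\<sigma> \<in> types T" "wf_fm S\<^sub>T \<Delta> A"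
  shows "interp_seq \<Delta> \<Gamma> A"
proof -
  obtain s t where wit_st: "witnesses (\<sigma> # \<Delta>) (map (lift (Suc 0)) \<Gamma>) (lift (Suc 0) A) (poss \<Gamma>) (map Fin (negs \<Gamma>)) s t"
    using assms(1) by (auto simp: interp_seq_def)
  note s = witnessesD(1)[OF wit_st, unfolded neg_lift] and t = witnessesD(2)[OF wit_st, unfolded pos_lift]
    and st = witnessesD(3)[OF wit_st, unfolded neg_lift]
  show ?thesis
  proof (rule interp_seqI[OF s t])
    fix w \<theta> as ds
    assume *: "world w" "sub w \<Delta> \<theta>" "typeds w as (poss \<Gamma>)" "typeds w ds (neg I A)"
      "bforces_all w (map (subst \<theta>) \<Gamma>) as (s (as @ ds))"
    \<comment> \<open>The additional variable of the premise needs a value: a new variable at the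
      end of the context, discarded afterwards by rule \<open>var\<close> of
      \<open>T\<close>.\<close>
    let ?w = "World (ctx w @ [\<sigma>]) (hyps w)" and ?\<theta> = "case_nat (Var (length (ctx w))) \<theta>"
    have w: "w \<preceq> ?w" using extends_snoc[OF *(1) assms(2)] .
    have "sub ?w (\<sigma> # \<Delta>) ?\<theta>"
      using sub_mono[OF *(2) w] by (auto simp: sub_type_case_nat intro: has_type_Var)
    with st[of ?w ?\<theta> as ds] have "?w \<Vdash> interp I (subst \<theta> A) (t as) ds"
      using extendsD(2)[OF w] typeds_mono[OF *(3) w] typeds_mono[OF *(4) w] bforces_all_mono[OF *(5) w]
      by (simp add: o_def)
    moreover have "wf w (interp I (subst \<theta> A) (t as) ds)"
      using wf_S\<^sub>T_subst[OF assms(3) *(2)] dtup_typed[OF t *(3)] *(4) by (intro wf_interp) auto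
    ultimately show "w \<Vdash> interp I (subst \<theta> A) (t as) ds"
      by (intro forces_discard_var[OF *(1)])
  qed
qed

lemma seq_botL:
  assumes "wfs \<Delta> \<Gamma>" "wf_fm S\<^sub>T \<Delta> A"
  shows "interp_seq \<Delta> (Bot # \<Gamma>) A"
proof -
  have "set (negs (Bot # \<Gamma>)) \<subseteq> wit_types W"
    using wfs_wit[OF assms(1)] by simp
  then obtain s where s: "dtup (poss (Bot # \<Gamma>) @ neg I A) (map Fin (negs (Bot # \<Gamma>))) s"
    using ex_dtup_Fin by blast
  obtain t where t: "dtup (poss (Bot # \<Gamma>)) (pos I A) t"
    using ex_dtup[OF pos_wit[OF assms(2)]] by blast
  show ?thesis
  proof (rule interp_seqI[OF s t])
    fix w \<theta> as ds
    assume *: "world w" "sub w \<Delta> \<theta>" "typeds w as (poss (Bot # \<Gamma>))" "typeds w ds (neg I A)"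
      "bforces_all w (map (subst \<theta>) (Bot # \<Gamma>)) as (s (as @ ds))"
    then have "w \<Vdash> interp I Bot [] []"
      by (intro bforcesD[where Bs = "[]"]) auto
    then show "w \<Vdash> interp I (subst \<theta> A) (t as) ds"
      using wf_interp[OF wf_S\<^sub>T_subst[OF assms(2) *(2)], of "t as" ds] dtup_typed[OF t *(3)] *(4)
      by (simp add: forces_BotE)
  qed
qed

lemma seq_conjR:
  assumes "interp_seq \<Delta> \<Gamma> A" "interp_seq \<Delta> \<Gamma> B" "wfs \<Delta> \<Gamma>" "wf_fm S\<^sub>T \<Delta> A" "wf_fm S\<^sub>T \<Delta> B"
  shows "interp_seq \<Delta> \<Gamma> (Conj A B)"
proof -
  let ?\<alpha>s = "poss \<Gamma> @ neg I A @ neg I B" and ?n = "length (poss \<Gamma>)" and ?m = "length (neg I A)"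
  have wit: "set (poss \<Gamma> @ neg I A @ neg I B) \<subseteq> wit_types W" "set (neg I A @ neg I B) \<subseteq> wit_types W"
    using wfs_wit[OF assms(3)] neg_wit[OF assms(4)] neg_wit[OF assms(5)] by auto
  obtain s1 t1 where wit1: "witnesses \<Delta> \<Gamma> A (poss \<Gamma>) (map Fin (negs \<Gamma>)) s1 t1"
    using assms(1) by (auto simp: interp_seq_def)
  note s1 = witnessesD(1)[OF wit1] and t1 = witnessesD(2)[OF wit1] and 1 = witnessesD(3)[OF wit1]
  obtain s2 t2 where wit2: "witnesses \<Delta> \<Gamma> B (poss \<Gamma>) (map Fin (negs \<Gamma>)) s2 t2"
    using assms(2) by (auto simp: interp_seq_def)
  note s2 = witnessesD(1)[OF wit2] and t2 = witnessesD(2)[OF wit2] and 2 = witnessesD(3)[OF wit2]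
  let ?s1 = "\<lambda>c. s1 (take ?n c @ take ?m (drop ?n c))"
  let ?s2 = "\<lambda>c. s2 (take ?n c @ drop ?m (drop ?n c))"
  have s1': "dtup ?\<alpha>s (map Fin (negs \<Gamma>)) ?s1"
    by (rule dtup_comp[OF s1 dtup_append[OF dtup_fst[OF wit(1)] dtup_take[OF dtup_snd[OF wit(1)]]]])
  have s2': "dtup ?\<alpha>s (map Fin (negs \<Gamma>)) ?s2"
    by (rule dtup_comp[OF s2 dtup_append[OF dtup_fst[OF wit(1)] dtup_drop[OF dtup_snd[OF wit(1)]]]])
  obtain U where U: "dtup ?\<alpha>s (map Fin (negs \<Gamma>)) U"
    and incl: "\<And>w c. typeds w c ?\<alpha>s \<Longrightarrow> included w (negs \<Gamma>) (?s1 c) (U c) \<and> included w (negs \<Gamma>) (?s2 c) (U c)"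
    using ex_union[OF s1' s2'] by blast
  show ?thesis
  proof (rule interp_seqI)
    show "dtup (poss \<Gamma> @ neg I (Conj A B)) (map Fin (negs \<Gamma>)) U" using U by simp
    show "dtup (poss \<Gamma>) (pos I (Conj A B)) (\<lambda>as. t1 as @ t2 as)" using dtup_append[OF t1 t2] by simp
    fix w \<theta> as bd
    assume w: "world w" "sub w \<Delta> \<theta>" and as: "typeds w as (poss \<Gamma>)" and bd: "typeds w bd (neg I (Conj A B))"
      and hyps: "bforces_all w (map (subst \<theta>) \<Gamma>) as (U (as @ bd))"
    from bd obtain b d where bd: "bd = b @ d" and b: "typeds w b (neg I A)" and d: "typeds w d (neg I B)"
      by (auto simp: list_all2_append2)
    have c: "typeds w (as @ b @ d) ?\<alpha>s" using as b d by (intro list_all2_appendI)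
    note len = as[THEN list_all2_lengthD] b[THEN list_all2_lengthD] d[THEN list_all2_lengthD]
      dtup_lengths[OF U c] dtup_lengths[OF s1' c] dtup_lengths[OF s2' c]
    have "bforces_all w (map (subst \<theta>) \<Gamma>) as (?s1 (as @ b @ d))"
      using incl[OF c] len hyps by (intro bforces_all_included[OF hyps]) (auto simp: bd)
    moreover have "bforces_all w (map (subst \<theta>) \<Gamma>) as (?s2 (as @ b @ d))"
      using incl[OF c] len hyps by (intro bforces_all_included[OF hyps]) (auto simp: bd)
    ultimately show "w \<Vdash> interp I (subst \<theta> (Conj A B)) (t1 as @ t2 as) bd"
      unfolding bd subst.simps
      using len dtup_lengths[OF t1 as] 1[OF w as b] 2[OF w as d] by (subst forces_interp_Conj) auto
  qed
qed

text \<open>The bounded quantifiers range over the components of \<open>A\<close> and of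
  \<open>B\<close> together. Keeping only those of \<open>A\<close> requires an instance
  \<open>e\<close> for those of \<open>B\<close>.\<close>

lemma bforces_Conj1:
  assumes "bforces w (Conj A B) (a @ b) (As @ Bs)" "length a = length (pos I A)"
    and "typeds w As (map Fin (neg I A))" "typeds w e (neg I B)" "members w (neg I B) e Bs"
  shows "bforces w A a As"
  unfolding bforces_def
proof (intro allI impI)
  fix w' c
  assume w': "w \<preceq> w'" "typeds w' c (neg I A)" "members w' (neg I A) c As"
  have len: "length c = length (neg I A)" "length As = length (neg I A)"
    using w'(2) assms(3) by (auto dest: list_all2_lengthD)
  have "w' \<Vdash> interp I (Conj A B) (a @ b) (c @ e)"
    by (rule bforcesD[OF bforces_mono[OF assms(1) w'(1)] extendsD(2)[OF w'(1)]])
      (use w' assms len in \<open>auto intro: list_all2_appendI typeds_mono simp: members_append members_mono\<close>)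
  then show "w' \<Vdash> interp I A a c"
    by (subst (asm) forces_interp_Conj) (use assms(2) len in auto)
qed

lemma bforces_Conj2:
  assumes "bforces w (Conj A B) (a @ b) (As @ Bs)" "length a = length (pos I A)"
    and "typeds w As (map Fin (neg I A))" "typeds w e (neg I A)" "members w (neg I A) e As"
  shows "bforces w B b Bs"
  unfolding bforces_def
proof (intro allI impI)
  fix w' d
  assume w': "w \<preceq> w'" "typeds w' d (neg I B)" "members w' (neg I B) d Bs"
  have len: "length e = length (neg I A)" "length As = length (neg I A)"
    using assms(3,4) by (auto dest: list_all2_lengthD)
  have "w' \<Vdash> interp I (Conj A B) (a @ b) (e @ d)"
    by (rule bforcesD[OF bforces_mono[OF assms(1) w'(1)] extendsD(2)[OF w'(1)]])
      (use w' assms len in \<open>auto intro: list_all2_appendI typeds_mono simp: members_append members_mono\<close>)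
  then show "w' \<Vdash> interp I B b d"
    by (subst (asm) forces_interp_Conj) (use assms(2) len in auto)
qed

text \<open>Nothing is known about non-emptiness of the elements of a type \<open>\<sigma>*\<close>, so the bounds are enlarged
  by a closed term.\<close>

lemma seq_conjL:
  assumes "interp_seq \<Delta> (A # B # \<Gamma>) C" "wfs \<Delta> \<Gamma>" "wf_fm S\<^sub>T \<Delta> A" "wf_fm S\<^sub>T \<Delta> B" "wf_fm S\<^sub>T \<Delta> C"
  shows "interp_seq \<Delta> (Conj A B # \<Gamma>) C"
proof -
  let ?ps = "(pos I A @ pos I B) @ poss \<Gamma>" and ?ns = "neg I A @ neg I B"
  let ?\<alpha>s = "?ps @ neg I C" and ?m = "length (neg I A @ neg I B)"
  have wit: "set ?ns \<subseteq> wit_types W"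
    using neg_wit[OF assms(3)] neg_wit[OF assms(4)] by auto
  obtain s t where wit_st: "witnesses \<Delta> (A # B # \<Gamma>) C (?ps) (map Fin ?ns @ map Fin (negs \<Gamma>)) s t"
    using assms(1) by (auto simp: interp_seq_def)
  note s = witnessesD(1)[OF wit_st] and t = witnessesD(2)[OF wit_st] and st = witnessesD(3)[OF wit_st]
  obtain e where e: "dtup ?\<alpha>s ?ns e"
    using ex_dtup[OF wit] by blast
  have s1: "dtup ?\<alpha>s (map Fin ?ns) (\<lambda>c. take ?m (s c))" and s2: "dtup ?\<alpha>s (map Fin (negs \<Gamma>)) (\<lambda>c. drop ?m (s c))"
    using dtup_take[OF s] dtup_drop[OF s] by simp_all
  note e' = dtup_singletons[OF e]
  let ?u = "\<lambda>c. unions ?ns (take ?m (s c)) (singletons ?ns (e c))"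
  have u: "dtup ?\<alpha>s (map Fin ?ns) ?u"
    by (rule dtup_unions[OF s1 e'])
  show ?thesis
  proof (rule interp_seqI)
    show "dtup (poss (Conj A B # \<Gamma>) @ neg I C) (map Fin (negs (Conj A B # \<Gamma>))) (\<lambda>c. ?u c @ drop ?m (s c))"
      using dtup_append[OF u s2] by simp
    show "dtup (poss (Conj A B # \<Gamma>)) (pos I C) t" using t by simp
    fix w \<theta> as ds
    assume w: "world w" "sub w \<Delta> \<theta>" and as: "typeds w as (poss (Conj A B # \<Gamma>))" and ds: "typeds w ds (neg I C)"
      and hyps: "bforces_all w (map (subst \<theta>) (Conj A B # \<Gamma>)) as (?u (as @ ds) @ drop ?m (s (as @ ds)))"
    from as obtain a b c where as: "as = a @ b @ c" and a: "typeds w a (pos I A)" and b: "typeds w b (pos I B)"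
      and c: "typeds w c (poss \<Gamma>)"
      by (auto simp: list_all2_append2)
    have as': "typeds w as ?ps" unfolding as using a b c by (auto intro: list_all2_appendI)
    have x: "typeds w (as @ ds) ?\<alpha>s" using as' ds by (intro list_all2_appendI)
    let ?x = "as @ ds"
    have U: "typeds w (?u ?x) (map Fin ?ns)" by (rule dtup_typed[OF u x])
    then obtain X Y where XY: "?u ?x = X @ Y" and X: "typeds w X (map Fin (neg I A))" and Y: "typeds w Y (map Fin (neg I B))"
      by (auto simp: list_all2_append2)
    have E: "typeds w (e ?x) ?ns" by (rule dtup_typed[OF e x])
    then obtain f g where fg: "e ?x = f @ g" and f: "typeds w f (neg I A)" and g: "typeds w g (neg I B)"
      by (auto simp: list_all2_append2)
    note incl = included_unions[OF wit dtup_typed[OF s1 x] dtup_typed[OF e' x]]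
    have "members w ?ns (e ?x) (?u ?x)"
      by (rule included_members[OF incl(2) _ E members_singletons[OF w(1) wit E]]) (simp add: w)
    then have "members w ?ns (e ?x) (X @ Y)"
      by (simp only: XY)
    then have "members w ?ns (f @ g) (X @ Y)"
      by (simp only: fg)
    then have mem: "members w (neg I A) f X" "members w (neg I B) g Y"
      using list_all2_lengthD[OF f] list_all2_lengthD[OF X] by (simp_all add: members_append)
    note len = a[THEN list_all2_lengthD] b[THEN list_all2_lengthD] c[THEN list_all2_lengthD]
      X[THEN list_all2_lengthD] Y[THEN list_all2_lengthD] dtup_lengths[OF s x]
    from hyps have Conj: "bforces w (subst \<theta> (Conj A B)) (a @ b) (X @ Y)"
      and rest: "bforces_all w (map (subst \<theta>) \<Gamma>) c (drop ?m (s ?x))"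
      unfolding XY using len by (simp_all add: as)
    have "bforces w (subst \<theta> A) a X" "bforces w (subst \<theta> B) b Y"
      using bforces_Conj1[OF Conj[unfolded subst.simps], of g] bforces_Conj2[OF Conj[unfolded subst.simps], of f]
        X Y f g mem len by auto
    moreover have "included w (neg I A) (take (length (neg I A)) (s ?x)) X"
      using included_take[OF incl(1)[unfolded XY]] len by simp
    moreover have "included w (neg I B) (take (length (neg I B)) (drop (length (neg I A)) (s ?x))) Y"
      using included_drop[OF incl(1)[unfolded XY]] len by (simp add: drop_take)
    ultimately have "bforces_all w (map (subst \<theta>) (A # B # \<Gamma>)) as (s ?x)"
      using rest len by (auto simp: as add.commute intro: bforces_included)
    then show "w \<Vdash> interp I (subst \<theta> C) (t as) ds"
      by (rule st[OF w as' ds])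
  qed
qed

text \<open>The witnesses are those of the premise: being independent of the environment, they work
  for every value of the quantified variable.\<close>

lemma seq_allR:
  assumes "interp_seq (\<sigma> # \<Delta>) (map (lift (Suc 0)) \<Gamma>) A" "wf_fm S\<^sub>T \<Delta> (All \<sigma> A)"
  shows "interp_seq \<Delta> \<Gamma> (All \<sigma> A)"
proof -
  obtain s t where wit_st: "witnesses (\<sigma> # \<Delta>) (map (lift (Suc 0)) \<Gamma>) A (poss \<Gamma>) (map Fin (negs \<Gamma>)) s t"
    using assms(1) by (auto simp: interp_seq_def)
  note s = witnessesD(1)[OF wit_st] and t = witnessesD(2)[OF wit_st] and st = witnessesD(3)[OF wit_st]
  show ?thesis
  proof (rule interp_seqI)
    show "dtup (poss \<Gamma> @ neg I (All \<sigma> A)) (map Fin (negs \<Gamma>)) s" "dtup (poss \<Gamma>) (pos I (All \<sigma> A)) t"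
      using s t by simp_all
    fix w \<theta> as ds
    assume *: "world w" "sub w \<Delta> \<theta>" "typeds w as (poss \<Gamma>)" "typeds w ds (neg I (All \<sigma> A))"
      "bforces_all w (map (subst \<theta>) \<Gamma>) as (s (as @ ds))"
    have ds: "typeds w ds (neg I A)" using *(4) by simp
    have wf: "wf_fm S\<^sub>T (ctx w) (All \<sigma> (subst (under \<theta>) A))"
      using wf_S\<^sub>T_subst[OF assms(2) *(2)] by simp
    show "w \<Vdash> interp I (subst \<theta> (All \<sigma> A)) (t as) ds"
      unfolding subst.simps
    proof (subst forces_interp_All[OF *(1) wf], goal_cases)
      case 1
      then show ?case using dtup_typed[OF t *(3)] by simp
    next
      case 2
      then show ?case using ds by simp
    next
      case 3
      show ?case
      proof (intro allI impI)
        fix w' u assume w': "w \<preceq> w'" "typed w' u \<sigma>"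
        have "sub w' (\<sigma> # \<Delta>) (case_nat u \<theta>)"
          using sub_mono[OF *(2) w'(1)] w'(2) by (simp add: sub_type_case_nat)
        then have "w' \<Vdash> interp I (subst (case_nat u \<theta>) A) (t as) ds"
          using extendsD(2)[OF w'(1)] typeds_mono[OF *(3) w'(1)] typeds_mono[OF ds w'(1)]
            bforces_all_mono[OF *(5) w'(1)]
          by (intro st) (simp_all add: o_def)
        then show "w' \<Vdash> interp I (inst (subst (under \<theta>) A) u) (t as) ds"
          by (simp add: inst_under)
      qed
    qed
  qed
qed

lemma bforces_All:
  assumes "bforces w (All \<sigma> A) as Bs" "wf_fm S\<^sub>T (ctx w) (All \<sigma> A)" "typeds w as (pos I A)" "typed w u \<sigma>"
  shows "bforces w (inst A u) as Bs"
  unfolding bforces_def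
proof (intro allI impI)
  fix w' bs
  assume w': "w \<preceq> w'" "typeds w' bs (neg I (inst A u))" "members w' (neg I (inst A u)) bs Bs"
  note w'_world = extendsD(2)[OF w'(1)]
  have "w' \<Vdash> interp I (All \<sigma> A) as bs"
    using w' by (intro bforcesD[OF bforces_mono[OF assms(1) w'(1)] w'_world]) auto
  with forces_interp_All[OF w'_world wf_S\<^sub>T_mono[OF assms(2) w'(1)] typeds_mono[OF assms(3) w'(1)], of bs]
  show "w' \<Vdash> interp I (inst A u) as bs"
    using w' w'_world typed_mono[OF assms(4) w'(1)] by simp
qed

lemma seq_allL:
  assumes "interp_seq \<Delta> (inst A u # \<Gamma>) C" "has_type T \<Delta> u \<sigma>" "wf_fm S\<^sub>T \<Delta> (All \<sigma> A)"
  shows "interp_seq \<Delta> (All \<sigma> A # \<Gamma>) C"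
proof -
  obtain s t where wit_st: "witnesses \<Delta> (inst A u # \<Gamma>) C (pos I A @ poss \<Gamma>) (map Fin (neg I A) @ map Fin (negs \<Gamma>)) s t"
    using assms(1) by (auto simp: interp_seq_def)
  note s = witnessesD(1)[OF wit_st] and t = witnessesD(2)[OF wit_st] and st = witnessesD(3)[OF wit_st]
  show ?thesis
  proof (rule interp_seqI)
    show "dtup (poss (All \<sigma> A # \<Gamma>) @ neg I C) (map Fin (negs (All \<sigma> A # \<Gamma>))) s"
      "dtup (poss (All \<sigma> A # \<Gamma>)) (pos I C) t"
      using s t by simp_all
    fix w \<theta> as ds
    assume w: "world w" "sub w \<Delta> \<theta>" and as: "typeds w as (poss (All \<sigma> A # \<Gamma>))" and ds: "typeds w ds (neg I C)"
      and hyps: "bforces_all w (map (subst \<theta>) (All \<sigma> A # \<Gamma>)) as (s (as @ ds))"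
    from as obtain a b where ab: "as = a @ b" "typeds w a (pos I A)" "typeds w b (poss \<Gamma>)"
      by (auto simp: list_all2_append2)
    have "bforces w (inst (subst (under \<theta>) A) (subst_tm \<theta> u)) a (take (length (neg I A)) (s (as @ ds)))"
      using hyps list_all2_lengthD[OF ab(2)] wf_S\<^sub>T_subst[OF assms(3) w(2)] ab(1,2)
      by (intro bforces_All[of w \<sigma>] has_type_subst[OF assms(2) w(2)]) auto
    then have "bforces_all w (map (subst \<theta>) (inst A u # \<Gamma>)) as (s (as @ ds))"
      using hyps list_all2_lengthD[OF ab(2)] ab(1) by (simp add: subst_inst)
    then show "w \<Vdash> interp I (subst \<theta> C) (t as) ds"
      using as ds by (intro st w) simp_all
  qed
qed

text \<open>The term \<open>u\<close> is used only to introduce the existential in \<open>T\<close>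
  and leaves no trace in the witnesses. What changes is the negative side: a set \<open>Ds\<close>
  takes the place of a tuple, and the premise is applied to all elements of it.\<close>

lemma seq_exR:
  assumes "interp_seq \<Delta> \<Gamma> (inst A u)" "has_type T \<Delta> u \<sigma>" "wf_fm S\<^sub>T \<Delta> (Ex \<sigma> A)" "wfs \<Delta> \<Gamma>"
  shows "interp_seq \<Delta> \<Gamma> (Ex \<sigma> A)"
proof -
  let ?n = "length (poss \<Gamma>)" and ?\<alpha>s = "poss \<Gamma> @ map Fin (neg I A)"
  obtain s t where wit_st: "witnesses \<Delta> \<Gamma> (inst A u) (poss \<Gamma>) (map Fin (negs \<Gamma>)) s t"
    using assms(1) by (auto simp: interp_seq_def)
  note s = witnessesD(1)[OF wit_st, unfolded neg_inst] and t = witnessesD(2)[OF wit_st, unfolded pos_inst]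
    and st = witnessesD(3)[OF wit_st, unfolded neg_inst]
  have wit: "set ?\<alpha>s \<subseteq> wit_types W" "set (?\<alpha>s @ neg I A) \<subseteq> wit_types W"
    using wfs_wit[OF assms(4)] neg_wit[of "\<sigma> # \<Delta>" A] assms(3) by auto
  \<comment> \<open>The demands on \<open>\<Gamma>\<close> for one element \<open>bs\<close>; they
    are united over \<open>bs\<close> in \<open>Ds\<close>, which is the last part of the
    argument.\<close>
  let ?F = "\<lambda>c. s (take ?n (take (length ?\<alpha>s) c) @ drop (length ?\<alpha>s) c)"
  have F: "dtup (?\<alpha>s @ neg I A) (map Fin (negs \<Gamma>)) ?F"
    by (rule dtup_comp[OF s dtup_append[OF dtup_comp[OF dtup_fst[OF wit(1)] dtup_fst[OF wit(2)]] dtup_snd[OF wit(2)]]])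
  obtain U where U: "dtup ?\<alpha>s (map Fin (negs \<Gamma>)) U"
    and incl: "\<And>w c bs. world w \<Longrightarrow> typeds w c ?\<alpha>s \<Longrightarrow> typeds w bs (neg I A) \<Longrightarrow>
      members w (neg I A) bs (drop ?n c) \<Longrightarrow> included w (negs \<Gamma>) (?F (c @ bs)) (U c)"
    using ex_big_union[OF dtup_snd[OF wit(1)] F wit(1)] by blast
  show ?thesis
  proof (rule interp_seqI)
    show "dtup (poss \<Gamma> @ neg I (Ex \<sigma> A)) (map Fin (negs \<Gamma>)) U" "dtup (poss \<Gamma>) (pos I (Ex \<sigma> A)) t"
      using U t by simp_all
    fix w \<theta> as Ds
    assume w: "world w" "sub w \<Delta> \<theta>" and as: "typeds w as (poss \<Gamma>)" and "typeds w Ds (neg I (Ex \<sigma> A))"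
      and hyps: "bforces_all w (map (subst \<theta>) \<Gamma>) as (U (as @ Ds))"
    then have Ds: "typeds w Ds (map Fin (neg I A))" by simp
    let ?A = "subst (under \<theta>) A"
    have c: "typeds w (as @ Ds) ?\<alpha>s" using as Ds by (rule list_all2_appendI)
    have "bforces w (inst ?A (subst_tm \<theta> u)) (t as) Ds"
      unfolding bforces_def
    proof (intro allI impI)
      fix w' bs
      assume w': "w \<preceq> w'" "typeds w' bs (neg I (inst ?A (subst_tm \<theta> u)))" "members w' (neg I (inst ?A (subst_tm \<theta> u))) bs Ds"
      have "included w' (negs \<Gamma>) (?F ((as @ Ds) @ bs)) (U (as @ Ds))"
        using w' list_all2_lengthD[OF as] by (intro incl extendsD(2)[OF w'(1)] typeds_mono[OF c w'(1)]) auto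
      then have *: "included w' (negs \<Gamma>) (s (as @ bs)) (U (as @ Ds))"
        using list_all2_lengthD[OF as] list_all2_lengthD[OF Ds] by simp
      have "length (s (as @ bs)) = length (map Fin (negs \<Gamma>))"
        using list_all2_appendI[OF typeds_mono[OF as w'(1)]] w' by (intro dtup_lengths[OF s]) auto
      then have "bforces_all w' (map (subst \<theta>) \<Gamma>) as (s (as @ bs))"
        using * dtup_lengths[OF U c] by (intro bforces_all_included[OF bforces_all_mono[OF hyps w'(1)]]) auto
      then have "w' \<Vdash> interp I (subst \<theta> (inst A u)) (t as) bs"
        using w' by (intro st extendsD(2)[OF w'(1)] sub_mono[OF w(2) w'(1)] typeds_mono[OF as w'(1)]) auto
      then show "w' \<Vdash> interp I (inst ?A (subst_tm \<theta> u)) (t as) bs"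
        by (simp add: subst_inst)
    qed
    then show "w \<Vdash> interp I (subst \<theta> (Ex \<sigma> A)) (t as) Ds"
      using w wf_S\<^sub>T_subst[OF assms(3) w(2)] dtup_typed[OF t as] Ds has_type_subst[OF assms(2) w(2)]
      unfolding subst.simps by (intro forces_interp_ExI[where t = "subst_tm \<theta> u"]) auto
  qed
qed

lemma seq_exL:
  assumes "interp_seq (\<sigma> # \<Delta>) (A # map (lift (Suc 0)) \<Gamma>) (lift (Suc 0) C)" "wf_fm S\<^sub>T \<Delta> (Ex \<sigma> A)"
    "wf_fm S\<^sub>T \<Delta> C"
  shows "interp_seq \<Delta> (Ex \<sigma> A # \<Gamma>) C"
proof -
  let ?m = "length (neg I A)"
  have wit: "set (map Fin (neg I A)) \<subseteq> wit_types W"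
    using neg_wit[of "\<sigma> # \<Delta>" A] assms(2) by auto
  obtain s t where wit_st: "witnesses (\<sigma> # \<Delta>) (A # map (lift (Suc 0)) \<Gamma>) (lift (Suc 0) C)
      (pos I A @ poss \<Gamma>) (map Fin (neg I A) @ map Fin (negs \<Gamma>)) s t"
    using assms(1) by (auto simp: interp_seq_def)
  note s = witnessesD(1)[OF wit_st, unfolded neg_lift] and t = witnessesD(2)[OF wit_st, unfolded pos_lift]
    and st = witnessesD(3)[OF wit_st, unfolded neg_lift]
  have s1: "dtup ((pos I A @ poss \<Gamma>) @ neg I C) (map Fin (neg I A)) (\<lambda>c. take ?m (s c))"
    and s2: "dtup ((pos I A @ poss \<Gamma>) @ neg I C) (map Fin (negs \<Gamma>)) (\<lambda>c. drop ?m (s c))"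
    using dtup_take[OF s] dtup_drop[OF s] by simp_all
  \<comment> \<open>The negative types of the existential formula are those of sets of
    counterexamples to \<open>A\<close>, so its bound is a set of such sets: the singleton of the
    bound that the premise puts on \<open>A\<close>.\<close>
  let ?s = "\<lambda>c. singletons (map Fin (neg I A)) (take ?m (s c)) @ drop ?m (s c)"
  show ?thesis
  proof (rule interp_seqI)
    show "dtup (poss (Ex \<sigma> A # \<Gamma>) @ neg I C) (map Fin (negs (Ex \<sigma> A # \<Gamma>))) ?s"
      using dtup_append[OF dtup_singletons[OF s1] s2] by simp
    show "dtup (poss (Ex \<sigma> A # \<Gamma>)) (pos I C) t" using t by simp
    fix w \<theta> as ds
    assume w: "world w" "sub w \<Delta> \<theta>" and "typeds w as (poss (Ex \<sigma> A # \<Gamma>))" and ds: "typeds w ds (neg I C)"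
      and hyps: "bforces_all w (map (subst \<theta>) (Ex \<sigma> A # \<Gamma>)) as (?s (as @ ds))"
    then have as: "typeds w as (pos I A @ poss \<Gamma>)" by simp
    then obtain a b where ab: "as = a @ b" "typeds w a (pos I A)" "typeds w b (poss \<Gamma>)"
      by (auto simp: list_all2_append2)
    have c: "typeds w (as @ ds) ((pos I A @ poss \<Gamma>) @ neg I C)" using as ds by (rule list_all2_appendI)
    note X = dtup_typed[OF s1 c]
    note len = list_all2_lengthD[OF ab(2)] dtup_lengths[OF s c]
    let ?A = "subst (under \<theta>) A" and ?X = "take ?m (s (as @ ds))"
    have "bforces w (Ex \<sigma> ?A) a (singletons (map Fin (neg I A)) ?X)"
      and rest: "bforces_all w (map (subst \<theta>) \<Gamma>) b (drop ?m (s (as @ ds)))"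
      using hyps len by (simp_all add: ab(1) singletons_def)
    then have Ex: "w \<Vdash> interp I (Ex \<sigma> ?A) a ?X"
      using members_singletons[OF w(1) wit X] X w by (intro bforcesD) auto
    have wf: "wf w (interp I (subst \<theta> C) (t as) ds)"
      using wf_S\<^sub>T_subst[OF assms(3) w(2)] dtup_typed[OF t as] ds by (intro wf_interp) auto
    show "w \<Vdash> interp I (subst \<theta> C) (t as) ds"
    proof (rule forces_interp_ExE[OF w(1) _ _ _ Ex wf])
      show "wf_fm S\<^sub>T (ctx w) (Ex \<sigma> ?A)" using wf_S\<^sub>T_subst[OF assms(2) w(2)] by simp
      show "typeds w a (pos I ?A)" "typeds w ?X (map Fin (neg I ?A))" using ab X by simp_all
      fix w' u
      assume w': "w \<preceq> w'" "typed w' u \<sigma>" "bforces w' (inst ?A u) a ?X"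
      have "sub w' (\<sigma> # \<Delta>) (case_nat u \<theta>)"
        using sub_mono[OF w(2) w'(1)] w'(2) by (simp add: sub_type_case_nat)
      moreover have "bforces_all w' (map (subst (case_nat u \<theta>)) (A # map (lift (Suc 0)) \<Gamma>)) as (s (as @ ds))"
        using w'(3) bforces_all_mono[OF rest w'(1)] len by (simp add: ab(1) inst_under o_def)
      ultimately have "w' \<Vdash> interp I (subst (case_nat u \<theta>) (lift (Suc 0) C)) (t as) ds"
        by (intro st extendsD(2)[OF w'(1)] typeds_mono[OF as w'(1)] typeds_mono[OF ds w'(1)])
      then show "w' \<Vdash> interp I (subst \<theta> C) (t as) ds" by simp
    qed
  qed
qed

text \<open>The implication absorbs the part of the premise that concerns \<open>A\<close>:
  \<open>t\<close> abstracted becomes \<open>f\<close>, and the bound on \<open>A\<close> abstracted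
  becomes \<open>g\<close>. The bound on \<open>\<Gamma>\<close> may keep its dependence on
  \<open>a\<close> and \<open>d\<close>, as these are now the negative tuple of the
  conclusion.\<close>

lemma seq_impR:
  assumes "interp_seq \<Delta> (A # \<Gamma>) B" "wfs \<Delta> \<Gamma>" "wf_fm S\<^sub>T \<Delta> A" "wf_fm S\<^sub>T \<Delta> B"
  shows "interp_seq \<Delta> \<Gamma> (Imp A B)"
proof -
  let ?n = "length (poss \<Gamma>)" and ?p = "length (pos I A)" and ?m = "length (neg I A)"
  obtain s t where wit_st: "witnesses \<Delta> (A # \<Gamma>) B
      (pos I A @ poss \<Gamma>) (map Fin (neg I A) @ map Fin (negs \<Gamma>)) s t"
    using assms(1) by (auto simp: interp_seq_def)
  note s = witnessesD(1)[OF wit_st] and t = witnessesD(2)[OF wit_st] and st = witnessesD(3)[OF wit_st]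
  let ?\<alpha>s = "poss \<Gamma> @ pos I A @ neg I B"
  have wit: "set ?\<alpha>s \<subseteq> wit_types W" "set (pos I A @ neg I B) \<subseteq> wit_types W" "set (poss \<Gamma> @ pos I A) \<subseteq> wit_types W"
    using wfs_wit[OF assms(2)] pos_wit[OF assms(3)] neg_wit[OF assms(4)] by auto
  \<comment> \<open>Abstraction acts on the last arguments, so \<open>a\<close> follows
    \<open>as\<close> here, whereas the premise expects \<open>a\<close> first; the order is
    restored inside \<open>s\<close>.\<close>
  let ?s = "\<lambda>c. s ((take ?p (drop ?n c) @ take ?n c) @ drop ?p (drop ?n c))"
  have s': "dtup ?\<alpha>s (map Fin (neg I A) @ map Fin (negs \<Gamma>)) ?s"
    by (rule dtup_comp[OF s dtup_append[OF dtup_append[OF dtup_take[OF dtup_snd[OF wit(1)]] dtup_fst[OF wit(1)]]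
      dtup_drop[OF dtup_snd[OF wit(1)]]]])
  have s1: "dtup ?\<alpha>s (map Fin (neg I A)) (\<lambda>c. take ?m (?s c))"
    and s2: "dtup ?\<alpha>s (map Fin (negs \<Gamma>)) (\<lambda>c. drop ?m (?s c))"
    using dtup_take[OF s'] dtup_drop[OF s'] by simp_all
  have t': "dtup (poss \<Gamma> @ pos I A) (pos I B) (\<lambda>c. t (drop ?n c @ take ?n c))"
    by (rule dtup_comp[OF t dtup_append[OF dtup_snd[OF wit(3)] dtup_fst[OF wit(3)]]])
  obtain f where f: "dtup (poss \<Gamma>) (map (arrows (pos I A)) (pos I B)) f"
    and f_eq: "\<And>w as a. world w \<Longrightarrow> typeds w as (poss \<Gamma>) \<Longrightarrow> typeds w a (pos I A) \<Longrightarrow>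
      eqs w (pos I B) (map (\<lambda>h. apps h a) (f as)) (t (drop ?n (as @ a) @ take ?n (as @ a)))"
    using dtup_lam[OF t' pos_wit[OF assms(3)]] by blast
  obtain g where "dtup (poss \<Gamma>) (map (arrows (pos I A @ neg I B)) (map Fin (neg I A))) g"
    and g_eq: "\<And>w as ad. world w \<Longrightarrow> typeds w as (poss \<Gamma>) \<Longrightarrow> typeds w ad (pos I A @ neg I B) \<Longrightarrow>
      eqs w (map Fin (neg I A)) (map (\<lambda>h. apps h ad) (g as)) (take ?m (?s (as @ ad)))"
    using dtup_lam[OF s1 wit(2)] by blast
  then have g: "dtup (poss \<Gamma>) (map (\<lambda>\<beta>. arrows (pos I A @ neg I B) (Fin \<beta>)) (neg I A)) g"
    by (simp add: o_def)
  show ?thesis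
  proof (rule interp_seqI)
    show "dtup (poss \<Gamma> @ neg I (Imp A B)) (map Fin (negs \<Gamma>)) (\<lambda>c. drop ?m (?s c))" using s2 by simp
    show "dtup (poss \<Gamma>) (pos I (Imp A B)) (\<lambda>as. f as @ g as)" using dtup_append[OF f g] by simp
    fix w \<theta> as ad
    assume w: "world w" "sub w \<Delta> \<theta>" and as: "typeds w as (poss \<Gamma>)" and ad: "typeds w ad (neg I (Imp A B))"
      and hyps: "bforces_all w (map (subst \<theta>) \<Gamma>) as (drop ?m (?s (as @ ad)))"
    from ad obtain a d where ad: "ad = a @ d" and a: "typeds w a (pos I A)" and d: "typeds w d (neg I B)"
      by (auto simp: list_all2_append2)
    note len = as[THEN list_all2_lengthD] a[THEN list_all2_lengthD] d[THEN list_all2_lengthD]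
    let ?X = "s ((a @ as) @ d)"
    have aas: "typeds w (a @ as) (pos I A @ poss \<Gamma>)" using a as by (rule list_all2_appendI)
    have X: "typeds w ?X (map Fin (neg I A) @ map Fin (negs \<Gamma>))"
      using dtup_typed[OF s list_all2_appendI[OF aas d]] .
    have s_eq: "?s (as @ a @ d) = ?X" using len by simp
    have wfA: "wf_fm S\<^sub>T (ctx w) (subst \<theta> A)" and wfB: "wf_fm S\<^sub>T (ctx w) (subst \<theta> B)"
      using wf_S\<^sub>T_subst[OF assms(3) w(2)] wf_S\<^sub>T_subst[OF assms(4) w(2)] .
    have "w' \<Vdash> interp I (subst \<theta> B) (map (\<lambda>h. apps h a) (f as)) d"
      if w': "w \<preceq> w'" and b: "bforces w' (subst \<theta> A) a (map (\<lambda>h. apps h (a @ d)) (g as))" for w'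
    proof -
      note w'' = extendsD(2)[OF w']
      \<comment> \<open>\<open>g\<close> applied to its arguments is only provably equal to the
        bound of the premise, so the hypothesis \<open>A\<close> is transferred along forced
        equality.\<close>
      have "eqs w' (map Fin (neg I A)) (map (\<lambda>h. apps h (a @ d)) (g as)) (take ?m ?X)"
        using g_eq[OF w'' typeds_mono[OF as w'] typeds_mono[OF list_all2_appendI[OF a d] w']]
        unfolding s_eq .
      then have "bforces w' (subst \<theta> A) a (take ?m ?X)"
        using wf_S\<^sub>T_mono[OF wfA w'] typeds_mono[OF a w'] w''
        by (intro bforces_cong[OF b]) (auto intro: eqs_refl)
      moreover have "bforces_all w' (map (subst \<theta>) \<Gamma>) as (drop ?m ?X)"
        using bforces_all_mono[OF hyps w'] unfolding ad s_eq .
      ultimately have "bforces_all w' (map (subst \<theta>) (A # \<Gamma>)) (a @ as) ?X"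
        using len by simp
      then have "w' \<Vdash> interp I (subst \<theta> B) (t (a @ as)) d"
        by (intro st w'' sub_mono[OF w(2) w'] typeds_mono[OF aas w'] typeds_mono[OF d w'])
      moreover have "eqs w' (pos I B) (t (a @ as)) (map (\<lambda>h. apps h a) (f as))"
        using f_eq[OF w'' typeds_mono[OF as w'] typeds_mono[OF a w']] len by (simp add: eqs_sym)
      ultimately show ?thesis
        using wf_S\<^sub>T_mono[OF wfB w'] eqs_refl[OF w'' typeds_mono[OF d w']] interp_cong_tuples[of w' "subst \<theta> B"]
        by simp
    qed
    then show "w \<Vdash> interp I (subst \<theta> (Imp A B)) (f as @ g as) ad"
      unfolding ad subst.simps
      using wfA wfB a d dtup_typed[OF f as] dtup_typed[OF g as] w(1)
      by (subst forces_interp_Imp) auto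
  qed
qed

text \<open>The implication is used at the witness of \<open>A\<close> from the first premise, and
  \<open>f\<close> turns it into the witness of \<open>B\<close> for the second. For each
  \<open>d\<close> at which \<open>B\<close> is demanded, \<open>A\<close> has to be verified on the
  bound given by \<open>g\<close>; the demands on \<open>\<Gamma>\<close> are therefore united
  twice.\<close>

lemma seq_impL:
  assumes "interp_seq \<Delta> \<Gamma> A" "interp_seq \<Delta> (B # \<Gamma>) C" "wfs \<Delta> \<Gamma>"
    and wf: "wf_fm S\<^sub>T \<Delta> A" "wf_fm S\<^sub>T \<Delta> B" "wf_fm S\<^sub>T \<Delta> C"
  shows "interp_seq \<Delta> (Imp A B # \<Gamma>) C"
proof -
  obtain s1 t1 where wit1: "witnesses \<Delta> \<Gamma> A (poss \<Gamma>) (map Fin (negs \<Gamma>)) s1 t1"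
    using assms(1) by (auto simp: interp_seq_def)
  note s1 = witnessesD(1)[OF wit1] and t1 = witnessesD(2)[OF wit1] and 1 = witnessesD(3)[OF wit1]
  obtain s2 t2 where wit2: "witnesses \<Delta> (B # \<Gamma>) C
      (pos I B @ poss \<Gamma>) (map Fin (neg I B) @ map Fin (negs \<Gamma>)) s2 t2"
    using assms(2) by (auto simp: interp_seq_def)
  note s2 = witnessesD(1)[OF wit2] and t2 = witnessesD(2)[OF wit2] and 2 = witnessesD(3)[OF wit2]
  let ?fs = "map (arrows (pos I A)) (pos I B)"
  let ?gs = "map (\<lambda>\<beta>. arrows (pos I A @ neg I B) (Fin \<beta>)) (neg I A)"
  let ?ps = "(?fs @ ?gs) @ poss \<Gamma>"
  let ?\<alpha>s = "?ps @ neg I C"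
  let ?nf = "length ?fs" and ?nfg = "length (?fs @ ?gs)" and ?n = "length (poss \<Gamma>)" and ?m = "length (neg I B)"
  have wit: "set ?ps \<subseteq> wit_types W" "set ?\<alpha>s \<subseteq> wit_types W" "set (?\<alpha>s @ neg I B) \<subseteq> wit_types W"
    "set ((?\<alpha>s @ neg I B) @ neg I A) \<subseteq> wit_types W"
    using pos_wit[of \<Delta> "Imp A B"] wf wfs_wit[OF assms(3)] neg_wit[of \<Delta>] by auto
  let ?f = "\<lambda>c. take ?nf (take ?nfg c)" and ?g = "\<lambda>c. drop ?nf (take ?nfg c)" and ?a = "\<lambda>c. drop ?nfg c"
  have f: "dtup ?ps ?fs ?f" and g: "dtup ?ps ?gs ?g" and a: "dtup ?ps (poss \<Gamma>) ?a"
    by (rule dtup_take[OF dtup_fst[OF wit(1)]], rule dtup_drop[OF dtup_fst[OF wit(1)]], rule dtup_snd[OF wit(1)])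
  let ?ta = "\<lambda>c. t1 (?a c)" and ?b = "\<lambda>c. map (\<lambda>h. apps h (t1 (?a c))) (?f c)"
  have a0: "dtup ?ps (pos I A) ?ta"
    by (rule dtup_comp[OF t1 a])
  have b: "dtup ?ps (pos I B) ?b"
    using dtup_apps[where F = "\<lambda>\<beta>. \<beta>", OF f a0] by simp
  have ba: "dtup ?ps (pos I B @ poss \<Gamma>) (\<lambda>c. ?b c @ ?a c)"
    by (rule dtup_append[OF b a])
  note fst = dtup_fst[OF wit(2)] and fst' = dtup_fst[OF wit(3)] and fst'' = dtup_fst[OF wit(4)]
  let ?k = "length ?ps" and ?k' = "length ?\<alpha>s" and ?k'' = "length (?\<alpha>s @ neg I B)"
  let ?e = "\<lambda>c. s2 ((?b (take ?k c) @ ?a (take ?k c)) @ drop ?k c)"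
  have e: "dtup ?\<alpha>s (map Fin (neg I B) @ map Fin (negs \<Gamma>)) ?e"
    by (rule dtup_comp[OF s2 dtup_append[OF dtup_comp[OF ba fst] dtup_snd[OF wit(2)]]])
  have D: "dtup ?\<alpha>s (map Fin (neg I B)) (\<lambda>c. take ?m (?e c))"
    and H: "dtup ?\<alpha>s (map Fin (negs \<Gamma>)) (\<lambda>c. drop ?m (?e c))"
    using dtup_take[OF e] dtup_drop[OF e] by simp_all
  let ?ga = "\<lambda>c. map (\<lambda>h. apps h (?ta (take ?k (take ?k' c)) @ drop ?k' c)) (?g (take ?k (take ?k' c)))"
  have ga: "dtup (?\<alpha>s @ neg I B) (map Fin (neg I A)) ?ga"
    by (rule dtup_apps[OF dtup_comp[OF g dtup_comp[OF fst fst']]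
      dtup_append[OF dtup_comp[OF a0 dtup_comp[OF fst fst']] dtup_snd[OF wit(3)]]])
  let ?F = "\<lambda>c. s1 (?a (take ?k (take ?k' (take ?k'' c))) @ drop ?k'' c)"
  have F: "dtup ((?\<alpha>s @ neg I B) @ neg I A) (map Fin (negs \<Gamma>)) ?F"
    by (rule dtup_comp[OF s1 dtup_append[OF dtup_comp[OF a dtup_comp[OF fst dtup_comp[OF fst' fst'']]] dtup_snd[OF wit(4)]]])
  \<comment> \<open>The inner union, over the elements \<open>b\<close> at which \<open>g\<close>
    requires \<open>A\<close> for a given \<open>d\<close>.\<close>
  obtain U1 where U1: "dtup (?\<alpha>s @ neg I B) (map Fin (negs \<Gamma>)) U1"
    and incl1: "\<And>w c b. world w \<Longrightarrow> typeds w c (?\<alpha>s @ neg I B) \<Longrightarrow> typeds w b (neg I A) \<Longrightarrow>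
      members w (neg I A) b (?ga c) \<Longrightarrow> included w (negs \<Gamma>) (?F (c @ b)) (U1 c)"
    using ex_big_union[OF ga F wit(3)] by blast
  \<comment> \<open>The outer union, over the elements \<open>d\<close> at which the second premise
    demands \<open>B\<close>.\<close>
  obtain U2 where U2: "dtup ?\<alpha>s (map Fin (negs \<Gamma>)) U2"
    and incl2: "\<And>w c d. world w \<Longrightarrow> typeds w c ?\<alpha>s \<Longrightarrow> typeds w d (neg I B) \<Longrightarrow>
      members w (neg I B) d (take ?m (?e c)) \<Longrightarrow> included w (negs \<Gamma>) (U1 (c @ d)) (U2 c)"
    using ex_big_union[OF D U1 wit(2)] by blast
  obtain U where U: "dtup ?\<alpha>s (map Fin (negs \<Gamma>)) U"
    and incl: "\<And>w c. typeds w c ?\<alpha>s \<Longrightarrow>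
      included w (negs \<Gamma>) (drop ?m (?e c)) (U c) \<and> included w (negs \<Gamma>) (U2 c) (U c)"
    using ex_union[OF H U2] by blast
  \<comment> \<open>The negative tuple of an implication consists of a witness of \<open>A\<close>
    and a counterexample to \<open>B\<close>: the former is demanded at one value only, hence the
    singleton, the latter on the bound of the second premise.\<close>
  let ?s = "\<lambda>c. (singletons (pos I A) (?ta (take ?k c)) @ take ?m (?e c)) @ U c"
  have s: "dtup ?\<alpha>s ((map Fin (pos I A) @ map Fin (neg I B)) @ map Fin (negs \<Gamma>)) ?s"
    by (intro dtup_append dtup_singletons dtup_comp[OF a0 fst] D U)
  show ?thesis
  proof (rule interp_seqI)
    show "dtup (poss (Imp A B # \<Gamma>) @ neg I C) (map Fin (negs (Imp A B # \<Gamma>))) ?s"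
      using s by simp
    show "dtup (poss (Imp A B # \<Gamma>)) (pos I C) (\<lambda>c. t2 (?b c @ ?a c))"
      using dtup_comp[OF t2 ba] by simp
    fix w \<theta> as ds
    assume w: "world w" "sub w \<Delta> \<theta>" and "typeds w as (poss (Imp A B # \<Gamma>))" and ds: "typeds w ds (neg I C)"
      and hyps: "bforces_all w (map (subst \<theta>) (Imp A B # \<Gamma>)) as (?s (as @ ds))"
    then have as: "typeds w as ?ps" by simp
    then obtain f g c where c: "as = (f @ g) @ c" and f: "typeds w f ?fs" and g: "typeds w g ?gs"
      and cs: "typeds w c (poss \<Gamma>)"
      by (auto simp: list_all2_append2)
    let ?x = "as @ ds"
    have x: "typeds w ?x ?\<alpha>s" using as ds by (rule list_all2_appendI)
    note len = f[THEN list_all2_lengthD] g[THEN list_all2_lengthD] cs[THEN list_all2_lengthD]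
      ds[THEN list_all2_lengthD]
    have tk: "take ?k ?x = as" "drop ?k ?x = ds" using len by (simp_all add: c)
    have fgc: "?f as = f" "?g as = g" "?a as = c" using len by (simp_all add: c)
    let ?t = "t1 c" and ?fa = "map (\<lambda>h. apps h (t1 c)) f"
    have t: "typeds w ?t (pos I A)" by (rule dtup_typed[OF t1 cs])
    have fa: "typeds w ?fa (pos I B)"
      using typeds_apps[where F = "\<lambda>\<beta>. \<beta>", OF f t] by simp
    have fac: "typeds w (?fa @ c) (pos I B @ poss \<Gamma>)" using fa cs by (rule list_all2_appendI)
    let ?X = "s2 ((?fa @ c) @ ds)"
    have e_eq: "?e ?x = ?X" by (simp only: tk fgc)
    have X: "length ?X = length (neg I B) + length (negs \<Gamma>)"
      using dtup_lengths[OF s2 list_all2_appendI[OF fac ds]] by simp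
    have "bforces w (subst \<theta> (Imp A B)) (f @ g) (singletons (pos I A) ?t @ take ?m ?X)"
      and rest: "bforces_all w (map (subst \<theta>) \<Gamma>) c (U ?x)"
      using hyps len X unfolding e_eq tk fgc by (simp_all add: c singletons_def)
    then have Imp: "bforces w (Imp (subst \<theta> A) (subst \<theta> B)) (f @ g) (singletons (pos I A) ?t @ take ?m ?X)"
      by simp
    have wfA: "wf_fm S\<^sub>T (ctx w) (subst \<theta> A)" and wfB: "wf_fm S\<^sub>T (ctx w) (subst \<theta> B)"
      using wf_S\<^sub>T_subst[OF wf(1) w(2)] wf_S\<^sub>T_subst[OF wf(2) w(2)] .
    have "bforces w (subst \<theta> B) ?fa (take ?m ?X)"
      unfolding bforces_def neg_subst
    proof (intro allI impI)
      fix w' d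
      assume w': "w \<preceq> w'" and d: "typeds w' d (neg I B)" and mem: "members w' (neg I B) d (take ?m ?X)"
      note ww' = extendsD(2)[OF w']
      note t' = typeds_mono[OF t w'] and x' = typeds_mono[OF x w']
      have "members w' (pos I A) ?t (singletons (pos I A) ?t)"
        using pos_wit[OF wf(1)] t' ww' by (intro members_singletons) auto
      then have "w' \<Vdash> interp I (Imp (subst \<theta> A) (subst \<theta> B)) (f @ g) (?t @ d)"
        using list_all2_appendI[OF t' d] mem list_all2_lengthD[OF t']
        by (intro bforcesD[OF bforces_mono[OF Imp w'] ww']) (simp_all add: members_append singletons_def)
      moreover have "bforces w' (subst \<theta> A) ?t (map (\<lambda>h. apps h (?t @ d)) g)"
        unfolding bforces_def neg_subst
      proof (intro allI impI)
        fix v b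
        assume v: "w' \<preceq> v" and b: "typeds v b (neg I A)" and mem_b: "members v (neg I A) b (map (\<lambda>h. apps h (?t @ d)) g)"
        note wv = extends_trans[OF w' v]
        note vv = extendsD(2)[OF v]
        have xd: "typeds v (?x @ d) (?\<alpha>s @ neg I B)"
          using typeds_mono[OF x wv] typeds_mono[OF d v] by (rule list_all2_appendI)
        have lx: "length ?x = ?k'" "length (?x @ d) = ?k''"
          using list_all2_lengthD[OF x] list_all2_lengthD[OF d] by simp_all
        have tk': "take ?k' (?x @ d) = ?x" "drop ?k' (?x @ d) = d" "take ?k'' ((?x @ d) @ b) = ?x @ d"
          "drop ?k'' ((?x @ d) @ b) = b"
          unfolding lx[symmetric] by simp_all
        have "included v (negs \<Gamma>) (s1 (c @ b)) (U1 (?x @ d))"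
          using incl1[OF vv xd b] mem_b unfolding tk' tk fgc by blast
        moreover have "included v (negs \<Gamma>) (U1 (?x @ d)) (U2 ?x)"
          using incl2[OF vv typeds_mono[OF x wv] typeds_mono[OF d v]] members_mono[OF mem v]
          unfolding e_eq by blast
        moreover have "included v (negs \<Gamma>) (U2 ?x) (U ?x)"
          using incl[OF typeds_mono[OF x wv]] by blast
        ultimately have "included v (negs \<Gamma>) (s1 (c @ b)) (U ?x)"
          by (blast intro: included_trans)
        then have "bforces_all v (map (subst \<theta>) \<Gamma>) c (s1 (c @ b))"
          using dtup_lengths[OF s1 list_all2_appendI[OF typeds_mono[OF cs wv] b]] dtup_lengths[OF U x]
          by (intro bforces_all_included[OF bforces_all_mono[OF rest wv]]) auto
        then show "v \<Vdash> interp I (subst \<theta> A) ?t b"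
          by (intro 1 vv sub_mono[OF w(2) wv] typeds_mono[OF cs wv] b)
      qed
      ultimately show "w' \<Vdash> interp I (subst \<theta> B) ?fa d"
        using forces_interp_Imp[of w' "subst \<theta> A" "subst \<theta> B" f g ?t d] ww' wf_S\<^sub>T_mono[OF wfA w']
          wf_S\<^sub>T_mono[OF wfB w'] typeds_mono[OF f w'] typeds_mono[OF g w'] t' d
        by (simp del: interp.simps)
    qed
    moreover have "bforces_all w (map (subst \<theta>) \<Gamma>) c (drop ?m ?X)"
      using incl[OF x] X dtup_lengths[OF U x] unfolding e_eq by (intro bforces_all_included[OF rest]) auto
    ultimately have "bforces_all w (map (subst \<theta>) (B # \<Gamma>)) (?fa @ c) ?X"
      using list_all2_lengthD[OF fa] by simp
    then show "w \<Vdash> interp I (subst \<theta> C) (t2 (?b as @ ?a as)) ds"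
      unfolding fgc by (rule 2[OF w fac ds])
  qed
qed

end

section \<open>Soundness\<close>

lemma Alls_Nil [simp]: "Alls [] A = A" and Alls_Cons [simp]: "Alls (\<sigma> # \<sigma>s) A = All \<sigma> (Alls \<sigma>s A)"
  by (simp_all add: Alls_def)

lemma subst_Alls: "subst \<theta> (Alls \<sigma>s A) = Alls \<sigma>s (subst ((under ^^ length \<sigma>s) \<theta>) A)"
  by (induction \<sigma>s arbitrary: \<theta>) (simp_all add: funpow_swap1)

lemma derives_Alls: "derives T (rev \<beta>s @ \<Delta>) [] A \<Longrightarrow> derives T \<Delta> [] (Alls \<beta>s A)"
proof (induction \<beta>s arbitrary: \<Delta>)
  case (Cons \<beta> \<beta>s)
  then have d: "derives T (\<beta> # \<Delta>) [] (Alls \<beta>s A)" by simp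
  then have "wf_seq T \<Delta> [] (All \<beta> (Alls \<beta>s A))"
    using derives_wf[OF d] by (auto simp: wf_seq_def wf_ctx_def)
  then show ?case using d by (auto intro: derives.allR)
qed simp

lemma wf_theory_axiom:
  assumes "wf_theory T" "(\<Delta>, A) \<in> axioms T"
  shows "wf_fm T \<Delta> A"
proof -
  from assms(1) have "\<forall>(\<Delta>, A) \<in> axioms T. wf_ctx T \<Delta> \<and> wf_fm T \<Delta> A"
    unfolding wf_theory_def by (elim conjE)
  with assms(2) show ?thesis by auto
qed

text \<open>Abstraction produces one flat list of closed terms, whereas \<open>interp_hyps\<close>
  expects one tuple for each hypothesis.\<close>

lemma list_all2_concat_split:
  "list_all2 P xs (concat (map f ys)) \<Longrightarrow> \<exists>xss. concat xss = xs \<and> list_all2 (\<lambda>xs y. list_all2 P xs (f y)) xss ys"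
proof (induction ys arbitrary: xs)
  case (Cons y ys)
  then obtain us vs where xs: "xs = us @ vs" and us: "list_all2 P us (f y)"
    and vs: "list_all2 P vs (concat (map f ys))"
    by (auto simp: list_all2_append2)
  with Cons.IH[OF vs] obtain xss where "concat xss = vs" "list_all2 (\<lambda>xs y. list_all2 P xs (f y)) xss ys"
    by auto
  with xs us show ?case by (intro exI[of _ "us # xss"]) auto
qed simp

context uniform_interpretation
begin

lemma forces_Alls:
  "w \<Vdash> Alls \<beta>s X \<Longrightarrow> typeds w bs \<beta>s \<Longrightarrow> w \<Vdash> subst (inst_tuple bs) X"
proof (induction \<beta>s arbitrary: bs X)
  case (Cons \<beta> \<beta>s)
  then obtain b bs' where bs: "bs = b # bs'" "typed w b \<beta>" "typeds w bs' \<beta>s" by (cases bs) auto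
  have "w \<Vdash> inst (Alls \<beta>s X) b"
    using Cons.prems(1) bs(2) by (auto intro: forces_AllE)
  then have "w \<Vdash> Alls \<beta>s (subst ((under ^^ length \<beta>s) (case_nat b Var)) X)"
    by (simp add: inst_def subst_Alls)
  from Cons.IH[OF this bs(3)] show ?case
    using list_all2_lengthD[OF bs(3)] inst_tuple_Cons[of "length \<beta>s" bs' b X] by (simp add: bs(1))
qed simp

section \<open>Axioms of the source theory\<close>

lemma seq_Eq:
  assumes "derives T \<Delta> [] (Eq \<sigma> t u)"
  shows "interp_seq \<Delta> [] (Eq \<sigma> t u)"
proof (rule interp_seqI)
  show "dtup (poss [] @ neg I (Eq \<sigma> t u)) (map Fin (negs [])) (\<lambda>as. [])"
    "dtup (poss []) (pos I (Eq \<sigma> t u)) (\<lambda>as. [])"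
    by (simp_all add: dtup_Nil)
  fix w \<theta> as ds
  assume "world w" "sub w \<Delta> \<theta>"
  from forces_derivable[OF assms this] show "w \<Vdash> interp I (subst \<theta> (Eq \<sigma> t u)) [] ds" by simp
qed

text \<open>The witnesses of the axiom serve its instances, because instantiation only composes
  \<open>\<theta>\<close> with the environment; the hypotheses are added by weakening.\<close>

lemma seq_axiom:
  assumes "interp_seq \<Delta>' [] A" "sub_type T \<Delta>' \<theta> \<Delta>" "wfs \<Delta> \<Gamma>" "wf_fm S\<^sub>T \<Delta> (subst \<theta> A)"
  shows "interp_seq \<Delta> \<Gamma> (subst \<theta> A)"
proof -
  obtain s t where wit_st: "witnesses \<Delta>' [] A [] [] s t"
    using assms(1) by (auto simp: interp_seq_def)
  note s = witnessesD(1)[OF wit_st] and t = witnessesD(2)[OF wit_st] and st = witnessesD(3)[OF wit_st]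
  have "interp_seq \<Delta> [] (subst \<theta> A)"
  proof (rule interp_seqI)
    show "dtup (poss [] @ neg I (subst \<theta> A)) (map Fin (negs [])) s" "dtup (poss []) (pos I (subst \<theta> A)) t"
      using s t by simp_all
    fix w \<eta> as ds
    assume *: "world w" "sub w \<Delta> \<eta>" "typeds w as (poss [])" "typeds w ds (neg I (subst \<theta> A))"
    from *(3,4) show "w \<Vdash> interp I (subst \<eta> (subst \<theta> A)) (t as) ds"
      unfolding subst_comp by (intro st *(1) sub_type_comp[OF assms(2) *(2)]) simp_all
  qed
  from seq_struct[OF this _ assms(3,4)] show ?thesis by simp
qed

text \<open>The witnesses of the formula before replacement are passed on unchanged, and the
  hypothesis is demanded at the given counterexample only: the content is
  \<open>interp_cong\<close>. The outer connectives of the axiom come from the sequent rules already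
  treated.\<close>

lemma seq_leibniz:
  assumes "\<sigma> \<in> types S" "wf_fm S\<^sub>T (\<sigma> # \<sigma> # \<sigma> # \<Delta>) B"
  shows "interp_seq \<Delta> [] (leibniz \<sigma> B)"
proof -
  let ?\<Delta> = "\<sigma> # \<sigma> # \<Delta>" and ?E = "Eq \<sigma> (Var 1) (Var 0)"
  have B1: "wf_fm S\<^sub>T ?\<Delta> (inst B (Var 1))" and B0: "wf_fm S\<^sub>T ?\<Delta> (inst B (Var 0))" and E: "wf_fm S\<^sub>T ?\<Delta> ?E"
    using assms(1) by (auto intro!: wf_fm_inst[OF assms(2)] has_type_Var)
  have pw: "set (pos I B) \<subseteq> wit_types W" and nw: "set (neg I B) \<subseteq> wit_types W"
    using pos_wit[OF assms(2)] neg_wit[OF assms(2)] by auto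
  let ?s = "\<lambda>c. singletons (neg I B) (drop (length (pos I B)) c)"
  have "interp_seq ?\<Delta> [inst B (Var 1), ?E] (inst B (Var 0))"
  proof (rule interp_seqI)
    show "dtup (poss [inst B (Var 1), ?E] @ neg I (inst B (Var 0))) (map Fin (negs [inst B (Var 1), ?E])) ?s"
      using dtup_singletons[OF dtup_snd[of "pos I B" "neg I B"]] pw nw by simp
    show "dtup (poss [inst B (Var 1), ?E]) (pos I (inst B (Var 0))) (\<lambda>as. as)"
      using dtup_id[OF pw] by simp
    fix w \<theta> as ds
    assume w: "world w" and \<theta>: "sub w ?\<Delta> \<theta>" and "typeds w as (poss [inst B (Var 1), ?E])"
      "typeds w ds (neg I (inst B (Var 0)))"
      and hyps: "bforces_all w (map (subst \<theta>) [inst B (Var 1), ?E]) as (?s (as @ ds))"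
    then have as: "typeds w as (pos I B)" and ds: "typeds w ds (neg I B)" by simp_all
    have sub: "subst \<theta> (inst B (Var i)) = subst (case_nat (\<theta> i) \<theta>) B" for i
      by (simp add: subst_inst inst_under)
    have b: "bforces w (subst (case_nat (\<theta> 1) \<theta>) B) as (singletons (neg I B) ds)"
      and e: "bforces w (Eq \<sigma> (\<theta> 1) (\<theta> 0)) [] []"
      using hyps list_all2_lengthD[OF as] list_all2_lengthD[OF ds] by (simp_all add: sub singletons_def)
    have "w \<Vdash> interp I (Eq \<sigma> (\<theta> 1) (\<theta> 0)) [] []"
      by (rule bforcesD[OF e w]) simp_all
    then have eq: "w \<Vdash> Eq \<sigma> (\<theta> 1) (\<theta> 0)" by simp
    have "typed w (\<theta> i) (?\<Delta> ! i)" if "i < length ?\<Delta>" for i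
      using \<theta> that by (simp add: sub_type_def)
    \<comment> \<open>The two environments differ only at index 0, the marked variable, which is
      \<open>x\<close> in one and \<open>y\<close> in the other; elsewhere reflexivity
      applies.\<close>
    then have "eqs w (\<sigma> # ?\<Delta>) (map (case_nat (\<theta> 1) \<theta>) [0..<length (\<sigma> # ?\<Delta>)])
        (map (case_nat (\<theta> 0) \<theta>) [0..<length (\<sigma> # ?\<Delta>)])"
      using eq eq_refl[OF w] by (auto simp: eqs_def nth_Cons simp del: upt_Suc split: nat.splits)
    moreover have "w \<Vdash> interp I (subst (case_nat (\<theta> 1) \<theta>) B) as ds"
      using bforcesD[OF b w, of ds] ds members_singletons[OF w nw ds] by simp
    ultimately show "w \<Vdash> interp I (subst \<theta> (inst B (Var 0))) as ds"
      unfolding sub by (rule interp_cong[OF assms(2) _ eqs_refl[OF w as] eqs_refl[OF w ds]])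
  qed
  then have "interp_seq ?\<Delta> [Conj (inst B (Var 1)) ?E] (inst B (Var 0))"
    by (rule seq_conjL) (use B0 B1 E in auto)
  then have "interp_seq ?\<Delta> [] (Imp (Conj (inst B (Var 1)) ?E) (inst B (Var 0)))"
    by (rule seq_impR) (use B0 B1 E in auto)
  then have "interp_seq (\<sigma> # \<Delta>) [] (All \<sigma> (Imp (Conj (inst B (Var 1)) ?E) (inst B (Var 0))))"
    using B0 B1 E assms(1) by - (rule seq_allR, auto)
  then show ?thesis
    unfolding leibniz_def using B0 B1 E assms(1) by - (rule seq_allR, auto)
qed

text \<open>The closed terms become constant functions. Being closed, they are unaffected by the
  environment, so the given theorem of \<open>T\<close> can be instantiated by
  \<open>\<theta>\<close> and then by the tuple \<open>ds\<close>.\<close>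

lemma seq_interpretable:
  assumes "interpretable W T I \<Delta> A" "wf_fm S\<^sub>T \<Delta> A"
  shows "interp_seq \<Delta> [] A"
proof -
  let ?n = "length (neg I A)"
  let ?X = "\<lambda>ts. interp I (lift ?n A) ts (tuple_vars 0 ?n)"
  obtain ts where ts: "list_all2 (has_type T []) ts (pos I A)"
    and d: "derives T \<Delta> [] (Alls (neg I A) (?X ts))"
    using assms(1) by (auto simp: interpretable_def closed_witnesses_def)
  obtain s where s: "dtup (neg I A) [] s" using dtup_Nil by blast
  have closed: "subst_tm \<theta> t = t" if "t \<in> set ts" for \<theta> t
    using that ts by (auto simp: list_all2_conv_all_nth in_set_conv_nth intro: subst_tm_closed)
  have wf: "wf_fm S\<^sub>T (neg I A @ \<Delta>) (lift ?n A)" by (rule wf_lift[OF assms(2)]) simp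
  show ?thesis
  proof (rule interp_seqI)
    show "dtup (poss [] @ neg I A) (map Fin (negs [])) s" using s by simp
    show "dtup (poss []) (pos I A) (\<lambda>as. ts)"
      using ts pos_wit[OF assms(2)]
      by (auto simp: dtup_def list_all2_conv_all_nth subset_iff intro!: dterm_closed)
    fix w \<theta> as ds
    assume w: "world w" "sub w \<Delta> \<theta>" and ds: "typeds w ds (neg I A)"
    have "w \<Vdash> Alls (neg I A) (subst ((under ^^ ?n) \<theta>) (?X ts))"
      using forces_derivable[OF d w] by (simp add: subst_Alls)
    from forces_Alls[OF this ds]
    have "w \<Vdash> subst (inst_tuple ds) (subst ((under ^^ ?n) \<theta>) (?X ts))" .
    also have "subst ((under ^^ ?n) \<theta>) (?X ts) = interp I (lift ?n (subst \<theta> A)) ts (tuple_vars 0 ?n)"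
      using list_all2_lengthD[OF ts] closed by (subst interp_subst[OF wf]) (simp_all add: map_idI)
    also have "subst (inst_tuple ds) \<dots> = interp I (subst \<theta> A) ts ds"
    proof -
      have "wf_fm S\<^sub>T (neg I A @ ctx w) (lift ?n (subst \<theta> A))"
        using wf_lift[OF wf_S\<^sub>T_subst[OF assms(2) w(2)]] by simp
      then show ?thesis
        using list_all2_lengthD[OF ts] list_all2_lengthD[OF ds] closed
        by (subst interp_subst) (simp_all add: map_idI)
    qed
    finally show "w \<Vdash> interp I (subst \<theta> A) ts ds" .
  qed
qed

lemma wf_seq_S: "wf_seq S \<Delta> \<Gamma> A \<Longrightarrow> wfs \<Delta> \<Gamma> \<and> wf_fm S\<^sub>T \<Delta> A"
  by (auto simp: wf_seq_def wfs_def intro: wf_S\<^sub>T)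

lemma seq_axioms:
  assumes "(\<Delta>, A) \<in> axioms S"
  shows "interp_seq \<Delta> [] A"
proof -
  have wf: "wf_fm S\<^sub>T \<Delta> A"
    using assms source by (intro wf_S\<^sub>T wf_theory_axiom) (simp_all add: source_theory_def)
  from assms source consider "(\<Delta>, A) \<in> reflexivity_axioms S" | "(\<Delta>, A) \<in> qfree_leibniz_axioms S"
    | "(\<Delta>, A) \<in> combinator_axioms (types S)" | "(\<Delta>, A) \<in> N"
    by (auto simp: source_theory_def)
  then show ?thesis
  proof cases
    case 1
    then obtain \<sigma> where A: "\<Delta> = []" "A = All \<sigma> (Eq \<sigma> (Var 0) (Var 0))" and \<sigma>: "\<sigma> \<in> types S"
      by (auto simp: reflexivity_axioms_def)
    \<comment> \<open>Forcing at a world without hypotheses is derivability in its context.\<close>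
    have w: "world (World [\<sigma>] [])"
      using \<sigma> types_S_T by (auto simp: world_def wf_ctx_def)
    have "World [\<sigma>] [] \<Vdash> Eq \<sigma> (Var 0) (Var 0)"
      by (rule eq_refl[OF w]) (auto intro: has_type_Var)
    then have "interp_seq [\<sigma>] [] (Eq \<sigma> (Var 0) (Var 0))"
      by (intro seq_Eq) (simp add: forces_def)
    then show ?thesis
      unfolding A using wf unfolding A by - (rule seq_allR, simp_all)
  next
    case 2
    then show ?thesis
      by (auto simp: qfree_leibniz_axioms_def intro: seq_leibniz wf_S\<^sub>T)
  next
    case 3
    \<comment> \<open>The combinator axioms of \<open>S\<close> and \<open>T\<close> are formulas
      over different relation symbols; being equations between terms, they can be read in either
      language.\<close>
    then obtain \<sigma> t u where A: "A = Eq \<sigma> t u"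
      and "(\<Delta>, Eq \<sigma> t u :: ('g, 'c, ('g, 'q) trel) fm) \<in> combinator_axioms (types S)"
      by (auto simp: combinator_axioms_def)
    then have "derives T \<Delta> [] (Eq \<sigma> t u)"
      using target by (auto simp: target_theory_def proves_all_def)
    then show ?thesis unfolding A by (rule seq_Eq)
  next
    case 4
    with sound wf show ?thesis
      by (auto simp: sound_interp_def intro: seq_interpretable)
  qed
qed

lemma derives_interp_seq: "derives S \<Delta> \<Gamma> A \<Longrightarrow> interp_seq \<Delta> \<Gamma> A"
proof (induction rule: derives.induct)
  case (ident \<Delta> \<Gamma> A)
  then show ?case using wf_seq_S by (auto intro: seq_ident)
next
  case (struct \<Delta> \<Gamma> A \<Gamma>')
  then show ?case using wf_seq_S by (auto intro: seq_struct)
next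
  case (cut \<Delta> \<Gamma> A B)
  then show ?case using wf_seq_S[OF derives_wf[OF cut.hyps(2)]] by (auto intro: seq_cut)
next
  case (var \<sigma> \<Delta> \<Gamma> A)
  have "\<sigma> \<in> types T"
    using derives_wf[OF var.hyps(1)] types_S_T by (auto simp: wf_seq_def wf_ctx_def)
  with var show ?case using wf_seq_S[OF var.hyps(2)] by (auto intro: seq_var)
next
  case (botL \<Delta> \<Gamma> A)
  then show ?case using wf_seq_S[OF botL] by (auto intro: seq_botL)
next
  case (conjR \<Delta> \<Gamma> A B)
  then show ?case
    using wf_seq_S[OF derives_wf[OF conjR.hyps(1)]] wf_seq_S[OF derives_wf[OF conjR.hyps(2)]]
    by (auto intro: seq_conjR)
next
  case (conjL \<Delta> A B \<Gamma> C)
  then show ?case using wf_seq_S[OF derives_wf[OF conjL.hyps]] by (auto intro: seq_conjL)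
next
  case (disjR1 \<Delta> \<Gamma> A B)
  then show ?case using source by (simp add: source_theory_def)
next
  case (disjR2 \<Delta> \<Gamma> B A)
  then show ?case using source by (simp add: source_theory_def)
next
  case (disjL \<Delta> A \<Gamma> C B)
  then show ?case using source by (simp add: source_theory_def)
next
  case (impR \<Delta> A \<Gamma> B)
  then show ?case using wf_seq_S[OF derives_wf[OF impR.hyps]] by (auto intro: seq_impR)
next
  case (impL \<Delta> \<Gamma> A B C)
  then show ?case
    using wf_seq_S[OF derives_wf[OF impL.hyps(1)]] wf_seq_S[OF derives_wf[OF impL.hyps(2)]]
    by (auto intro: seq_impL)
next
  case (allR \<sigma> \<Delta> \<Gamma> A)
  then show ?case using wf_seq_S[OF allR.hyps(2)] by (auto intro: seq_allR)
next
  case (allL \<Delta> A t \<Gamma> C \<sigma>)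
  then show ?case using has_type_mono[OF _ constants_S_T] wf_S\<^sub>T by (intro seq_allL) blast+
next
  case (exR \<Delta> \<Gamma> A t \<sigma>)
  then show ?case
    using has_type_mono[OF exR.hyps(2) constants_S_T] wf_S\<^sub>T[OF exR.hyps(3)]
      wf_seq_S[OF derives_wf[OF exR.hyps(1)]]
    by (intro seq_exR) blast+
next
  case (exL \<sigma> \<Delta> A \<Gamma> C)
  then show ?case using wf_seq_S[OF exL.hyps(2)] by (intro seq_exL) auto
next
  case (classic \<Delta> \<Gamma> A)
  then show ?case using source by (simp add: source_theory_def)
next
  case (nonlog \<Delta>' A \<Delta> \<theta> \<Gamma>)
  then have "sub_type T \<Delta>' \<theta> \<Delta>"
    using has_type_mono[OF _ constants_S_T] by (auto simp: sub_type_def)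
  then show ?case
    using seq_axioms[OF nonlog.hyps(1)] wf_seq_S[OF nonlog.hyps(3)] by (auto intro: seq_axiom)
qed

section \<open>Extraction of closed witnesses\<close>

lemma wf_bounded_interp:
  assumes "wf_fm S\<^sub>T \<Delta> A" "list_all2 (has_type T \<Delta>) as (pos I A)"
    "list_all2 (has_type T \<Delta>) Bs (map Fin (neg I A))" "n = length (neg I A)"
  shows "wf_fm T \<Delta> (bounded_Alls (neg I A) Bs (interp I (lift n A) (map (lift_tm n) as) (tuple_vars 0 n)))"
proof (rule wf_bounded_Alls[OF assms(3) neg_wit[OF assms(1)]])
  have "wf_fm S\<^sub>T (rev (neg I A) @ \<Delta>) (lift n A)"
    using assms by (intro wf_lift) auto
  then show "wf_fm T (rev (neg I A) @ \<Delta>) (interp I (lift n A) (map (lift_tm n) as) (tuple_vars 0 n))"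
    by (rule wf_interp)
      (use assms in \<open>auto intro!: list_all2_lift list_all2_tuple_vars[of _ _ _ "[]", simplified]\<close>)
qed

text \<open>Connects the formula \<open>interp_hyps\<close> with its meaning
  \<open>bforces_all\<close>, once the tuples of bounds are flattened. Its well-formedness is proved
  along with this, as it is what allows assuming it by \<open>forces_ImpI\<close>.\<close>

lemma interp_hyps_forces:
  assumes "world w" "wfs (ctx w) \<Gamma>" "typeds w as (poss \<Gamma>)" "typeds w args \<gamma>s"
    and "list_all2 (\<lambda>s B. list_all2 (has_type T []) s (map (\<lambda>\<beta>. arrows \<gamma>s (Fin \<beta>)) (neg I B))) ss \<Gamma>"
  shows "wf w (interp_hyps I \<Gamma> ss as args)"
    and "w' \<Vdash> interp_hyps I \<Gamma> ss as args \<Longrightarrow> w \<preceq> w' \<Longrightarrow>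
      bforces_all w' \<Gamma> as (map (\<lambda>h. apps h args) (concat ss))"
proof -
  have "wf w (interp_hyps I \<Gamma> ss as args) \<and> (\<forall>w'. w' \<Vdash> interp_hyps I \<Gamma> ss as args \<longrightarrow> w \<preceq> w' \<longrightarrow>
      bforces_all w' \<Gamma> as (map (\<lambda>h. apps h args) (concat ss)))"
    using assms
  proof (induction \<Gamma> arbitrary: ss as)
    case (Cons B \<Gamma>)
    let ?n = "length (neg I B)"
    from Cons.prems(5) obtain s ss' where ss: "ss = s # ss'"
      and s: "list_all2 (has_type T []) s (map (\<lambda>\<beta>. arrows \<gamma>s (Fin \<beta>)) (neg I B))"
      and ss': "list_all2 (\<lambda>s B. list_all2 (has_type T []) s (map (\<lambda>\<beta>. arrows \<gamma>s (Fin \<beta>)) (neg I B))) ss' \<Gamma>"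
      by (cases ss) auto
    from Cons.prems(3) obtain a as' where as: "as = a @ as'" and a: "typeds w a (pos I B)"
      and as': "typeds w as' (poss \<Gamma>)"
      by (auto simp: list_all2_append2)
    have "typeds w s (map (\<lambda>\<beta>. arrows \<gamma>s (Fin \<beta>)) (neg I B))"
      using s has_type_append[of T "[]" _ _ "ctx w"] by (auto elim!: list_all2_mono)
    then have s': "typeds w (map (\<lambda>h. apps h args) s) (map Fin (neg I B))"
      using Cons.prems(4) by (rule typeds_apps)
    have wfB: "wf_fm S\<^sub>T (ctx w) B" and wf\<Gamma>: "wfs (ctx w) \<Gamma>" using Cons.prems(2) by simp_all
    have eq: "interp_hyps I (B # \<Gamma>) ss as args = Conj (bounded_Alls (neg I B) (map (\<lambda>h. apps h args) s)
        (interp I (lift ?n B) (map (lift_tm ?n) a) (tuple_vars 0 ?n))) (interp_hyps I \<Gamma> ss' as' args)"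
      using list_all2_lengthD[OF a] by (simp add: ss as Let_def)
    note IH = Cons.IH[OF Cons.prems(1) wf\<Gamma> as' Cons.prems(4) ss']
    show ?case
    proof (intro conjI allI impI)
      show "wf w (interp_hyps I (B # \<Gamma>) ss as args)"
        unfolding eq using IH wf_bounded_interp[OF wfB a s' refl] by simp
      fix w' assume w': "w' \<Vdash> interp_hyps I (B # \<Gamma>) ss as args" "w \<preceq> w'"
      have "bforces w' B a (map (\<lambda>h. apps h args) s)"
        using w' forces_bounded_interp[OF extendsD(2)[OF w'(2)] wf_S\<^sub>T_mono[OF wfB w'(2)]
            typeds_mono[OF a w'(2)] typeds_mono[OF s' w'(2)] refl]
        unfolding eq forces_Conj by blast
      moreover have "bforces_all w' \<Gamma> as' (map (\<lambda>h. apps h args) (concat ss'))"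
        using w' IH unfolding eq forces_Conj by blast
      ultimately show "bforces_all w' (B # \<Gamma>) as (map (\<lambda>h. apps h args) (concat ss))"
        using list_all2_lengthD[OF a] list_all2_lengthD[OF s'] by (simp add: ss as)
    qed
  qed simp
  then show "wf w (interp_hyps I \<Gamma> ss as args)"
    and "w' \<Vdash> interp_hyps I \<Gamma> ss as args \<Longrightarrow> w \<preceq> w' \<Longrightarrow>
      bforces_all w' \<Gamma> as (map (\<lambda>h. apps h args) (concat ss))"
    by blast+
qed

lemma eqs_included:
  assumes "eqs w (map Fin \<beta>s) As Bs" "set \<beta>s \<subseteq> wit_types W"
  shows "included w \<beta>s As Bs"
  unfolding included_def
proof (intro allI impI)
  fix i w' b
  assume i: "i < length \<beta>s" and w': "w \<preceq> w'" and b: "w' \<Vdash> Member (\<beta>s ! i) b (As ! i)"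
  have "w \<Vdash> Eq (Fin (\<beta>s ! i)) (As ! i) (Bs ! i)"
    using assms(1) i by (simp add: eqs_def)
  then show "w' \<Vdash> Member (\<beta>s ! i) b (Bs ! i)"
    using i assms(2) by (intro Member_cong[OF forces_mono[OF _ w'] _ b]) auto
qed

text \<open>Abstracting every argument leaves functions of the empty tuple, and their values are
  typable in the empty context, hence closed.\<close>

lemma closed_lam:
  assumes "dtup \<gamma>s \<beta>s F" "set \<gamma>s \<subseteq> wit_types W"
  obtains hs where "list_all2 (has_type T []) hs (map (arrows \<gamma>s) \<beta>s)"
    and "\<And>w gs. world w \<Longrightarrow> typeds w gs \<gamma>s \<Longrightarrow> eqs w \<beta>s (map (\<lambda>h. apps h gs) hs) (F gs)"
proof -
  from dtup_lam[of "[]" \<gamma>s \<beta>s F] assms obtain Q where Q: "dtup [] (map (arrows \<gamma>s) \<beta>s) Q"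
    and eq: "\<And>w gs. world w \<Longrightarrow> typeds w gs \<gamma>s \<Longrightarrow> eqs w \<beta>s (map (\<lambda>h. apps h gs) (Q [])) (F gs)"
    by auto
  from dtup_typed[OF Q, of "World [] []" "[]"] eq show thesis
    by (intro that[of "Q []"]) auto
qed

lemma interp_seq_derives:
  assumes "interp_seq \<Delta> \<Gamma> A" "wf_seq S \<Delta> \<Gamma> A"
  defines "\<alpha>s \<equiv> poss \<Gamma>" and "\<delta>s \<equiv> neg I A"
  defines "a \<equiv> tuple_vars (length \<Delta> + length \<delta>s) (length \<alpha>s)" and "d \<equiv> tuple_vars (length \<Delta>) (length \<delta>s)"
  shows "\<exists>ss ts. list_all2 (closed_witnesses W T) ss
      (map (\<lambda>B. map (\<lambda>\<beta>. arrows (\<alpha>s @ \<delta>s) (Fin \<beta>)) (neg I B)) \<Gamma>) \<and>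
    closed_witnesses W T ts (map (arrows \<alpha>s) (pos I A)) \<and>
    derives T [] [] (Alls \<alpha>s (Alls \<delta>s (Alls (rev \<Delta>)
      (Imp (interp_hyps I \<Gamma> ss a (a @ d)) (interp I A (map (\<lambda>t. apps t a) ts) d)))))"
proof -
  have wf\<Gamma>: "wfs \<Delta> \<Gamma>" and wfA: "wf_fm S\<^sub>T \<Delta> A"
    using wf_seq_S[OF assms(2)] by auto
  have wit: "set \<alpha>s \<subseteq> wit_types W" "set \<delta>s \<subseteq> wit_types W" "set (negs \<Gamma>) \<subseteq> wit_types W" "set (pos I A) \<subseteq> wit_types W"
    using wfs_wit[OF wf\<Gamma>] pos_neg_wit[OF wfA] by (auto simp: \<alpha>s_def \<delta>s_def)
  obtain s t where wit_st: "witnesses \<Delta> \<Gamma> A \<alpha>s (map Fin (negs \<Gamma>)) s t"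
    using assms(1) by (auto simp: interp_seq_def \<alpha>s_def)
  note s = witnessesD(1)[OF wit_st, folded \<delta>s_def] and t = witnessesD(2)[OF wit_st]
    and st = witnessesD(3)[OF wit_st, folded \<delta>s_def]
  obtain ts where ts: "list_all2 (has_type T []) ts (map (arrows \<alpha>s) (pos I A))"
    and ts_eq: "\<And>w as. world w \<Longrightarrow> typeds w as \<alpha>s \<Longrightarrow> eqs w (pos I A) (map (\<lambda>h. apps h as) ts) (t as)"
    using closed_lam[OF t wit(1)] by blast
  obtain hs where "list_all2 (has_type T []) hs (map (arrows (\<alpha>s @ \<delta>s)) (map Fin (negs \<Gamma>)))"
    and hs_eq: "\<And>w as. world w \<Longrightarrow> typeds w as (\<alpha>s @ \<delta>s) \<Longrightarrow>
      eqs w (map Fin (negs \<Gamma>)) (map (\<lambda>h. apps h as) hs) (s as)"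
    using closed_lam[OF s] wit(1,2) by auto
  then have "list_all2 (has_type T []) hs (concat (map (\<lambda>B. map (\<lambda>\<beta>. arrows (\<alpha>s @ \<delta>s) (Fin \<beta>)) (neg I B)) \<Gamma>))"
    by (simp add: map_concat o_def)
  then obtain ss where hs: "concat ss = hs"
    and ss: "list_all2 (\<lambda>s B. list_all2 (has_type T []) s (map (\<lambda>\<beta>. arrows (\<alpha>s @ \<delta>s) (Fin \<beta>)) (neg I B))) ss \<Gamma>"
    using list_all2_concat_split by blast
  have wit_B: "set (map (\<lambda>\<beta>. arrows (\<alpha>s @ \<delta>s) (Fin \<beta>)) (neg I B)) \<subseteq> wit_types W" if "B \<in> set \<Gamma>" for B
    using that wit by (auto simp: wit_arrows)
  have "list_all2 (closed_witnesses W T) ss (map (\<lambda>B. map (\<lambda>\<beta>. arrows (\<alpha>s @ \<delta>s) (Fin \<beta>)) (neg I B)) \<Gamma>)"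
    unfolding list_all2_map2[of "closed_witnesses W T"] closed_witnesses_def
    by (rule list.rel_mono_strong[OF ss]) (use wit_B in blast)
  moreover have "closed_witnesses W T ts (map (arrows \<alpha>s) (pos I A))"
    unfolding closed_witnesses_def using ts wit by (auto simp: wit_arrows)
  moreover have "derives T [] [] (Alls \<alpha>s (Alls \<delta>s (Alls (rev \<Delta>)
      (Imp (interp_hyps I \<Gamma> ss a (a @ d)) (interp I A (map (\<lambda>t. apps t a) ts) d)))))"
  proof -
    \<comment> \<open>The context below all three blocks of quantifiers. The source variables are
      bound innermost and keep their indices in \<open>\<Delta>\<close>, so \<open>\<Gamma>\<close>
      and \<open>A\<close> need no lifting; the tuples \<open>a\<close> and \<open>d\<close> lie
      above them, which explains their offsets.\<close>
    let ?w = "World (\<Delta> @ rev \<delta>s @ rev \<alpha>s) []"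
    have "set \<Delta> \<subseteq> types T"
      using assms(2) types_S_T by (auto simp: wf_seq_def wf_ctx_def)
    then have w: "world ?w"
      using wit wit_types_T by (auto simp: world_def wf_ctx_def)
    have a: "typeds ?w a \<alpha>s" and d: "typeds ?w d \<delta>s"
      using list_all2_tuple_vars[of "length \<alpha>s" \<alpha>s "length \<Delta> + length \<delta>s" "\<Delta> @ rev \<delta>s" T "[]"]
        list_all2_tuple_vars[of "length \<delta>s" \<delta>s "length \<Delta>" \<Delta> T "rev \<alpha>s"]
      by (simp_all add: a_def d_def)
    have ad: "typeds ?w (a @ d) (\<alpha>s @ \<delta>s)" using a d by (rule list_all2_appendI)
    have wf\<Gamma>': "wfs (ctx ?w) \<Gamma>" and wfA': "wf_fm S\<^sub>T (ctx ?w) A"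
      using wf\<Gamma> wfA by (auto simp: wfs_def intro: wf_fm_append)
    have "typeds ?w a (poss \<Gamma>)" using a by (simp add: \<alpha>s_def)
    note hyps = interp_hyps_forces[OF w wf\<Gamma>' this ad ss]
    have "?w \<Vdash> Imp (interp_hyps I \<Gamma> ss a (a @ d)) (interp I A (map (\<lambda>t. apps t a) ts) d)"
    proof (rule forces_ImpI[OF w hyps(1)])
      fix w' assume w': "?w \<preceq> w'" "w' \<Vdash> interp_hyps I \<Gamma> ss a (a @ d)"
      note ww = extendsD(2)[OF w'(1)] and a' = typeds_mono[OF a w'(1)] and d' = typeds_mono[OF d w'(1)]
        and ad' = typeds_mono[OF ad w'(1)]
      have "bforces_all w' \<Gamma> a (map (\<lambda>h. apps h (a @ d)) hs)"
        using hyps(2)[OF w'(2,1)] by (simp add: hs)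
      then have "bforces_all w' \<Gamma> a (s (a @ d))"
        by (rule bforces_all_included[OF _ eqs_included[OF eqs_sym[OF hs_eq[OF ww ad']] wit(3)]])
          (use hs_eq[OF ww ad'] in \<open>auto simp: eqs_def\<close>)
      moreover have "sub w' \<Delta> Var"
        using w'(1) sub_mono[OF _ w'(1), of \<Delta> Var] sub_type_Var[of T \<Delta> "rev \<delta>s @ rev \<alpha>s"] by simp
      ultimately have "w' \<Vdash> interp I A (t a) d"
        using st[OF ww _ a' d', of Var] by (simp add: map_idI)
      then show "w' \<Vdash> interp I A (map (\<lambda>t. apps t a) ts) d"
        using interp_cong_tuples[OF wf_S\<^sub>T_mono[OF wfA' w'(1)] eqs_sym[OF ts_eq[OF ww a']]]
          eqs_refl[OF ww d'] by (simp add: \<delta>s_def)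
    qed
    then have "derives T (rev (rev \<Delta>) @ rev \<delta>s @ rev \<alpha>s @ []) []
        (Imp (interp_hyps I \<Gamma> ss a (a @ d)) (interp I A (map (\<lambda>t. apps t a) ts) d))"
      by (simp add: forces_def)
    then show ?thesis by (intro derives_Alls)
  qed
  ultimately show ?thesis by blast
qed

lemma interp_seq_interpretable:
  assumes "interp_seq \<Delta> [] A" "wf_seq S \<Delta> [] A"
  shows "interpretable W T I \<Delta> A"
proof -
  let ?n = "length (neg I A)" and ?w = "World (rev (neg I A) @ \<Delta>) []"
  have wfA: "wf_fm S\<^sub>T \<Delta> A"
    using wf_seq_S[OF assms(2)] by auto
  obtain s t where wit_st: "witnesses \<Delta> [] A [] [] s t"
    using assms(1) by (auto simp: interp_seq_def)
  have t: "list_all2 (has_type T []) (t []) (pos I A)"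
    using dtup_typed[OF witnessesD(2)[OF wit_st], of "World [] []"] by simp
  have "set \<Delta> \<subseteq> types T"
    using assms(2) types_S_T by (auto simp: wf_seq_def wf_ctx_def)
  then have w: "world ?w"
    using neg_wit[OF wfA] wit_types_T by (auto simp: world_def wf_ctx_def)
  \<comment> \<open>Here the negative tuple is bound inside \<open>\<Delta>\<close>, so the
    environment is the shift by \<open>?n\<close>, which produces the \<open>lift\<close> in
    \<open>interpretable\<close>.\<close>
  have "?w \<Vdash> interp I (subst (\<lambda>i. Var (i + ?n)) A) (t []) (tuple_vars 0 ?n)"
    using w list_all2_tuple_vars[of ?n "neg I A" 0 "[]" T \<Delta>]
    by (intro witnessesD(3)[OF wit_st])
      (auto simp: sub_type_def nth_append intro!: has_type_Var)
  then have "derives T \<Delta> [] (Alls (neg I A) (interp I (lift ?n A) (t []) (tuple_vars 0 ?n)))"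
    by (intro derives_Alls) (simp add: forces_def lift_def)
  then show ?thesis
    unfolding interpretable_def closed_witnesses_def using t pos_wit[OF wfA] by blast
qed

end

theorem theorem2p9:
  fixes G W :: "'g set"
    and N :: "('g ty list \<times> ('g, 'c, 'r) fm) set"
    and S :: "('g, 'c, 'r) fo_theory"
    and T :: "('g, 'c, ('g, 'q) trel) fo_theory"
    and I :: "('g, 'c, 'r, 'q) base_interp"
  assumes "source_theory G N S"
    and "target_theory S W T"
    and "wf_base_interp S W T I"
    and "sound_interp N W T I"
  shows "(\<forall>\<Delta> \<Gamma> A. derives S \<Delta> \<Gamma> A \<longrightarrow>
      (let \<alpha>s = concat (map (pos I) \<Gamma>);
           \<delta>s = neg I A;
           a = tuple_vars (length \<Delta> + length \<delta>s) (length \<alpha>s);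
           d = tuple_vars (length \<Delta>) (length \<delta>s)
       in \<exists>ss ts.
         list_all2 (closed_witnesses W T) ss
           (map (\<lambda>B. map (\<lambda>\<beta>. arrows (\<alpha>s @ \<delta>s) (Fin \<beta>)) (neg I B)) \<Gamma>) \<and>
         closed_witnesses W T ts (map (arrows \<alpha>s) (pos I A)) \<and>
         derives T [] []
           (Alls \<alpha>s (Alls \<delta>s (Alls (rev \<Delta>)
             (Imp (interp_hyps I \<Gamma> ss a (a @ d))
                  (interp I A (map (\<lambda>t. apps t a) ts) d)))))))
    \<and> (\<forall>\<Delta> A. derives S \<Delta> [] A \<longrightarrow> interpretable W T I \<Delta> A)"
proof -
  interpret uniform_interpretation T G W N S I
    by unfold_locales (use assms in \<open>simp_all add: target_theory_def\<close>)
  show ?thesis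
    unfolding Let_def
    using interp_seq_derives[OF derives_interp_seq derives_wf]
      interp_seq_interpretable[OF derives_interp_seq derives_wf]
    by blast
qed

end
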